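(* Let $f_1,\dots,f_n$ be non-constant entire functions on $\mathbb{C}^m$ such that $m(r,f_i/f_1)=S(r,f_1)$ for each $i=1,\dots,n$, and suppose that $f_1,\dots,f_n$ are algebraically independent over $\mathbb{C}$. If the deficiency $\delta(0,f_1)>0$, then for every transcendental entire function $F$ on $\mathbb{C}$, $$\mathrm{tr.deg}_{\mathbb{C}}\,\mathbb{C}\big(f_1,\dots,f_n,F(f_1),\dots,F(f_n)\big)=2n .$$
   Context: Nevanlinna theory on $\mathbb{C}^m$: for meromorphic $f$, $m(r,f)$ is the proximity function (average of $\log^+|f|$ over the sphere of radius $r$ w.r.t. the normalized invariant measure), $N(r,f)$ the integrated counting function of poles, $T(r,f)=m(r,f)+N(r,f)$. For $a\in\mathbb{C}$, $m(r,a,f)=m(r,1/(f-a))$ and the deficiency is $\delta(a,f)=\liminf_{r\to\infty} m(r,a,f)/T(r,f)$. $S(r,f)$ denotes any quantity that is $o(T(r,f))$ as $r\to\infty$ outside a possible exceptional set of finite linear measure. $F(f_i)=F\circ f_i$; $\mathrm{tr.deg}_{\mathbb{C}}$ denotes transcendence degree over $\mathbb{C}$ of the field generated by the listed functions. *)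

theory Defs
  imports "HOL-Analysis.Analysis" "HOL-Computational_Algebra.Polynomial"
begin

definition entire_Cm :: "(complex ^ 'm::finite \<Rightarrow> complex) \<Rightarrow> bool" where
  "entire_Cm f \<longleftrightarrow>
     (\<forall>z. \<exists>D. (f has_derivative D) (at z) \<and> (\<forall>c v. D (c *s v) = c * D v))"

definition log_plus :: "real \<Rightarrow> real" where
  "log_plus x = (if x \<le> 1 then 0 else ln x)"

text \<open>Average of h over the sphere of radius r w.r.t. the normalized invariant
  (rotation invariant) probability measure.  This measure is realised as the
  push-forward of normalized Lebesgue measure on the unit ball under x \<mapsto> x/|x|
  (the cone measure of the ball, which coincides with normalized surface measure).\<close>
definition sphere_avg :: "real \<Rightarrow> (complex ^ 'm::finite \<Rightarrow> real) \<Rightarrow> real" where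
  "sphere_avg r h =
     (LINT x : ball 0 1 | lborel. h (r *\<^sub>R sgn x)) / measure lborel (ball (0 :: complex ^ 'm) 1)"

text \<open>Proximity function m(r,g) = average of log^+|g| over the sphere of radius r.
  Meromorphic quotients are represented pointwise (values on the measure-zero
  indeterminacy/pole set are irrelevant).\<close>
definition prox :: "real \<Rightarrow> (complex ^ 'm::finite \<Rightarrow> complex) \<Rightarrow> real" where
  "prox r g = sphere_avg r (\<lambda>z. log_plus (cmod (g z)))"

text \<open>Characteristic function of an entire function: T(r,f) = m(r,f) + N(r,f) with N(r,f) = 0
  since an entire function has no poles.\<close>
definition char_entire :: "real \<Rightarrow> (complex ^ 'm::finite \<Rightarrow> complex) \<Rightarrow> real" where
  "char_entire r f = prox r f + 0"

definition small_wrt :: "(real \<Rightarrow> real) \<Rightarrow> (real \<Rightarrow> real) \<Rightarrow> bool" where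
  "small_wrt Q T \<longleftrightarrow>
     (\<exists>E. E \<in> sets lborel \<and> emeasure lborel E < \<infinity> \<and>
        (\<forall>\<epsilon>>0. \<exists>R. \<forall>r\<ge>R. r \<notin> E \<longrightarrow> \<bar>Q r\<bar> \<le> \<epsilon> * T r))"

definition deficiency :: "complex \<Rightarrow> (complex ^ 'm::finite \<Rightarrow> complex) \<Rightarrow> ereal" where
  "deficiency a f =
     Liminf at_top (\<lambda>r. ereal (prox r (\<lambda>z. 1 / (f z - a)) / char_entire r f))"

text \<open>Multivariate polynomials over C in the variables indexed by a finite set I:
  a finitely supported coefficient function on exponent vectors supported in I.\<close>
definition is_poly_in :: "nat set \<Rightarrow> ((nat \<Rightarrow> nat) \<Rightarrow> complex) \<Rightarrow> bool" where
  "is_poly_in I P \<longleftrightarrow> finite {\<alpha>. P \<alpha> \<noteq> 0} \<and> (\<forall>\<alpha>. P \<alpha> \<noteq> 0 \<longrightarrow> (\<forall>i. i \<notin> I \<longrightarrow> \<alpha> i = 0))"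

definition eval_poly_in :: "nat set \<Rightarrow> ((nat \<Rightarrow> nat) \<Rightarrow> complex) \<Rightarrow> (nat \<Rightarrow> complex) \<Rightarrow> complex" where
  "eval_poly_in I P x = (\<Sum>\<alpha> | P \<alpha> \<noteq> 0. P \<alpha> * (\<Prod>i\<in>I. x i ^ \<alpha> i))"

definition alg_indep :: "nat set \<Rightarrow> (nat \<Rightarrow> 'a \<Rightarrow> complex) \<Rightarrow> bool" where
  "alg_indep I g \<longleftrightarrow> finite I \<and>
     (\<forall>P. is_poly_in I P \<longrightarrow> (\<forall>z. eval_poly_in I P (\<lambda>i. g i z) = 0) \<longrightarrow> (\<forall>\<alpha>. P \<alpha> = 0))"

text \<open>Transcendence degree over C of the field C(g 0, ..., g (k-1)): the maximal
  number of algebraically independent generators (a transcendence basis of a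
  finitely generated extension can be chosen among the generators).\<close>
definition trdeg_gen :: "nat \<Rightarrow> (nat \<Rightarrow> 'a \<Rightarrow> complex) \<Rightarrow> nat" where
  "trdeg_gen k g = Max {card I | I. I \<subseteq> {..<k} \<and> alg_indep I g}"

definition transcendental_entire :: "(complex \<Rightarrow> complex) \<Rightarrow> bool" where
  "transcendental_entire F \<longleftrightarrow> F holomorphic_on UNIV \<and> \<not> (\<exists>p. \<forall>z. F z = poly p z)"

end

theory Submission
  imports Defs "HOL-Complex_Analysis.Complex_Analysis"
    "HOL-Computational_Algebra.Fundamental_Theorem_Algebra"
begin

text \<open>Suppose \<open>P(f, F(f)) = 0\<close> with \<open>P \<noteq> 0\<close>, and let \<open>G(w) = P(w, F(w))\<close>, a power series in \<open>n\<close> variables that is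
  nonzero because \<open>F\<close> is transcendental. Counting dimensions modulo \<open>G\<close>, for every \<open>M\<close> there is a nonzero
  polynomial \<open>A\<close> of degree less than \<open>q\<close> in each variable that vanishes to order \<open>M q\<close> at the origin on the zero
  set of \<open>G\<close>. The function \<open>A(f)\<close> does not vanish identically, since the \<open>f\<^sub>i\<close> are algebraically independent, but
  it is as small as \<open>|f\<^sub>0|\<close> to the power \<open>M q\<close> where \<open>f\<^sub>0\<close> is small, up to factors controlled by
  \<open>m(r, f\<^sub>i/f\<^sub>0)\<close>. Hence \<open>M q m(r, 1/f\<^sub>0) \<le> m(r, 1/A(f)) + S(r) \<le> m(r, A(f)) + S(r) \<le> n q T(r, f\<^sub>0) + S(r)\<close> by
  Jensen's inequality, which contradicts \<open>\<delta>(0, f\<^sub>0) > 0\<close> once \<open>M\<close> is large.\<close>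

section \<open>Rotation invariance and circle means\<close>

text \<open>The origin is where positive deficiency has leverage: \<open>1 / f\<^sub>0\<close> has
  large proximity, so \<open>f\<^sub>0\<close> is small on the sphere in the logarithmic mean, and
  the hypothesis on \<open>m(r, f\<^sub>i/f\<^sub>0)\<close> drags the whole point \<open>f\<close>
  towards 0 at a comparable scale. Hence local information at one point is enough. On a full
  neighbourhood no nonzero \<open>A\<close> could vanish to an order beyond its total degree; it is
  possible on the zero set of \<open>G\<close>, which has dimension \<open>n - 1\<close>.

  Two analytic obstacles shape the proof. The function \<open>log |g|\<close> is unbounded below
  near zeros, so all integrals use \<open>log max(|g|, t)\<close>, with bounds uniform in
  \<open>t\<close>, and \<open>t\<close> tends to 0 at the end. And a nonintegrable function has
  integral 0 by convention, so every use of \<open>m(r, 1/f\<^sub>0)\<close> needs integrability;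
  positive deficiency supplies it by making that value nonzero.

  Only one inequality of Jensen's formula is needed. It comes from the maximum principle on finite
  grids of roots of unity, without integrals over circles or a Poisson kernel.\<close>

lemma nn_integral_lborel_translate:
  fixes f :: "'a::euclidean_space \<Rightarrow> ennreal"
  assumes [measurable]: "f \<in> borel_measurable borel"
  shows "(\<integral>\<^sup>+x. f (c + x) \<partial>lborel) = (\<integral>\<^sup>+x. f x \<partial>lborel)"
proof -
  have "(\<integral>\<^sup>+x. f x \<partial>lborel) = (\<integral>\<^sup>+x. f x \<partial>distr lborel borel ((+) c))"
    by (simp only: lborel_distr_plus)
  also have "\<dots> = (\<integral>\<^sup>+x. f (c + x) \<partial>lborel)"
    by (subst nn_integral_distr) auto
  finally show ?thesis ..
qed

lemma nn_integral_lborel_reflect: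
  fixes f :: "'a::euclidean_space \<Rightarrow> ennreal"
  assumes [measurable]: "f \<in> borel_measurable borel"
  shows "(\<integral>\<^sup>+x. f (c - x) \<partial>lborel) = (\<integral>\<^sup>+x. f x \<partial>lborel)"
proof -
  have "distr lborel borel (\<lambda>x. c - x :: 'a) = lborel"
    using lborel_affine[of "-1" c] by (simp add: density_1)
  then have "(\<integral>\<^sup>+x. f x \<partial>lborel) = (\<integral>\<^sup>+x. f x \<partial>distr lborel borel (\<lambda>x. c - x))"
    by simp
  also have "\<dots> = (\<integral>\<^sup>+x. f (c - x) \<partial>lborel)"
    by (subst nn_integral_distr) auto
  finally show ?thesis ..
qed

text \<open>Uniqueness of Haar measure: for translation invariant integrals, Fubini gives
  \<open>(\<integral>f \<circ> L) (\<integral>g) = (\<integral>g \<circ> L) (\<integral>f)\<close>, and the indicator \<open>g\<close> of the unit ball is invariant under \<open>L\<close>.\<close>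

lemma nn_integral_lborel_linear_isometry:
  fixes L :: "'a::euclidean_space \<Rightarrow> 'a" and f :: "'a \<Rightarrow> ennreal"
  assumes lin: "linear L" and iso: "\<And>x. norm (L x) = norm x"
    and [measurable]: "f \<in> borel_measurable borel"
  shows "(\<integral>\<^sup>+x. f (L x) \<partial>lborel) = (\<integral>\<^sup>+x. f x \<partial>lborel)"
proof -
  have [measurable]: "L \<in> borel_measurable borel"
    using lin by (intro borel_measurable_continuous_onI linear_continuous_on linear_conv_bounded_linear[THEN iffD1])
  have "inj L"
    using lin iso by (metis linear_injective_0 norm_eq_zero)
  then have surj: "surj L"
    using lin linear_injective_imp_surjective by blast
  define g where "g = (indicator (ball 0 1) :: 'a \<Rightarrow> ennreal)"
  have [measurable]: "g \<in> borel_measurable borel" unfolding g_def by (simp add: borel_measurable_indicator)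
  have gL: "g (L x) = g x" for x by (auto simp: g_def indicator_def iso)
  have swap: "(\<integral>\<^sup>+x. f (L x) * g (y + L x) \<partial>lborel) = (\<integral>\<^sup>+x. f (L x - y) * g (L x) \<partial>lborel)" for y
  proof -
    \<comment> \<open>Translating \<open>x\<close> by \<open>- b\<close>, where
      \<open>L b = y\<close>, moves the shift by \<open>y\<close> from \<open>g\<close> to
      \<open>f\<close>. For fixed \<open>x\<close> the map \<open>y \<mapsto> L x - y\<close>
      preserves Lebesgue measure, which then frees \<open>f\<close> of \<open>L\<close>.\<close>
    obtain b where b: "y = L b" using surj by auto
    have "(\<integral>\<^sup>+x. f (L x) * g (y + L x) \<partial>lborel) = (\<integral>\<^sup>+x. (\<lambda>x. f (L x) * g (y + L x)) (- b + x) \<partial>lborel)"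
      by (rule nn_integral_lborel_translate[symmetric]) measurable
    also have "\<dots> = (\<integral>\<^sup>+x. f (L x - y) * g (L x) \<partial>lborel)"
      using lin by (simp add: b linear_add linear_diff algebra_simps linear_neg)
    finally show ?thesis .
  qed
  have "(\<integral>\<^sup>+x. f (L x) \<partial>lborel) * (\<integral>\<^sup>+y. g y \<partial>lborel)
      = (\<integral>\<^sup>+x. (\<integral>\<^sup>+y. f (L x) * g y \<partial>lborel) \<partial>lborel)"
    by (simp add: nn_integral_cmult nn_integral_multc)
  also have "\<dots> = (\<integral>\<^sup>+x. (\<integral>\<^sup>+y. f (L x) * g (L x + y) \<partial>lborel) \<partial>lborel)"
    by (rule nn_integral_cong) (simp add: nn_integral_cmult nn_integral_lborel_translate)
  also have "\<dots> = (\<integral>\<^sup>+x. (\<integral>\<^sup>+y. f (L x) * g (y + L x) \<partial>lborel) \<partial>lborel)"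
    by (simp add: add.commute)
  also have "\<dots> = (\<integral>\<^sup>+y. (\<integral>\<^sup>+x. f (L x) * g (y + L x) \<partial>lborel) \<partial>lborel)"
    by (rule lborel_pair.Fubini') measurable
  also have "\<dots> = (\<integral>\<^sup>+y. (\<integral>\<^sup>+x. f (L x - y) * g (L x) \<partial>lborel) \<partial>lborel)"
    by (simp add: swap)
  also have "\<dots> = (\<integral>\<^sup>+x. (\<integral>\<^sup>+y. f (L x - y) * g (L x) \<partial>lborel) \<partial>lborel)"
    by (rule lborel_pair.Fubini') measurable
  also have "\<dots> = (\<integral>\<^sup>+x. (\<integral>\<^sup>+y. f y \<partial>lborel) * g x \<partial>lborel)"
    by (rule nn_integral_cong) (simp add: nn_integral_multc nn_integral_lborel_reflect gL)
  also have "\<dots> = (\<integral>\<^sup>+y. f y \<partial>lborel) * (\<integral>\<^sup>+y. g y \<partial>lborel)"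
    by (simp add: nn_integral_cmult)
  finally have eq: "(\<integral>\<^sup>+x. f (L x) \<partial>lborel) * (\<integral>\<^sup>+y. g y \<partial>lborel)
      = (\<integral>\<^sup>+y. f y \<partial>lborel) * (\<integral>\<^sup>+y. g y \<partial>lborel)" .
  have "(\<integral>\<^sup>+y. g y \<partial>lborel) = emeasure lborel (ball (0::'a) 1)"
    by (simp add: g_def)
  also have "\<dots> = ennreal (measure lborel (ball (0::'a) 1))"
    using emeasure_bounded_finite[of "ball (0::'a) 1"] by (intro emeasure_eq_ennreal_measure) auto
  finally have "(\<integral>\<^sup>+y. g y \<partial>lborel) = ennreal (measure lborel (ball (0::'a) 1))" .
  \<comment> \<open>The common factor is finite and nonzero, so it can be cancelled in
    \<open>ennreal\<close>.\<close>
  moreover have "\<not> measure lborel (ball (0::'a) 1) \<le> 0"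
    using content_ball_pos[of 1 "0::'a"] by linarith
  ultimately show ?thesis
    using eq by (simp add: mult.commute[of _ "ennreal _"] ennreal_mult_cancel_left ennreal_eq_0_iff)
qed

lemma lborel_distr_linear_isometry:
  fixes L :: "'a::euclidean_space \<Rightarrow> 'a"
  assumes lin: "linear L" and iso: "\<And>x. norm (L x) = norm x"
  shows "distr lborel borel L = lborel"
proof (rule measure_eqI)
  have [measurable]: "L \<in> borel_measurable borel"
    using lin by (intro borel_measurable_continuous_onI linear_continuous_on linear_conv_bounded_linear[THEN iffD1])
  fix A assume "A \<in> sets (distr lborel borel L)"
  then have [measurable]: "A \<in> sets borel" by simp
  have "emeasure (distr lborel borel L) A = (\<integral>\<^sup>+x. indicator A x \<partial>distr lborel borel L)"
    by simp
  also have "\<dots> = (\<integral>\<^sup>+x. indicator A (L x) \<partial>lborel)"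
    by (subst nn_integral_distr) auto
  also have "\<dots> = (\<integral>\<^sup>+x. indicator A x \<partial>lborel)"
    by (rule nn_integral_lborel_linear_isometry[OF lin iso]) auto
  finally show "emeasure (distr lborel borel L) A = emeasure lborel A" by simp
qed simp

lemma norm_vector_smult:
  fixes x :: "complex ^ 'm::finite"
  shows "norm (c *s x) = cmod c * norm x"
  by (simp add: norm_vec_def L2_set_def norm_mult power_mult_distrib
      sum_distrib_left[symmetric] real_sqrt_mult)

lemma scaleR_eq_smult: "a *\<^sub>R (x :: complex ^ 'm::finite) = complex_of_real a *s x"
  by (simp add: vec_eq_iff scaleR_conv_of_real[symmetric])

lemma linear_smult: "linear (\<lambda>x :: complex ^ 'm::finite. c *s x)"
  by (rule linearI) (simp_all add: vec_eq_iff algebra_simps)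

text \<open>Multiplication by a unimodular scalar is a real linear isometry. Since the invariance is
  exact, a ball integral may be averaged over any finite set of such rotations.\<close>

lemma ball_integral_rotate:
  fixes h :: "complex ^ 'm::finite \<Rightarrow> real"
  assumes [measurable]: "h \<in> borel_measurable borel" and w: "cmod w = 1"
  shows "(LINT x : ball 0 \<rho> | lborel. h (w *s x)) = (LINT x : ball 0 \<rho> | lborel. h x)"
proof -
  have eq: "distr lborel borel (\<lambda>x :: complex ^ 'm. w *s x) = lborel"
    by (rule lborel_distr_linear_isometry[OF linear_smult]) (simp add: norm_vector_smult w)
  have [measurable]: "(\<lambda>x :: complex ^ 'm. w *s x) \<in> borel_measurable borel"
    by (intro borel_measurable_continuous_onI linear_continuous_on
        linear_conv_bounded_linear[THEN iffD1] linear_smult)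
  have "(LINT x : ball 0 \<rho> | lborel. h x) =
      (LINT x|distr lborel borel (\<lambda>x :: complex ^ 'm. w *s x). indicator (ball 0 \<rho>) x *\<^sub>R h x)"
    by (simp add: eq set_lebesgue_integral_def)
  also have "\<dots> = (LINT x|lborel. indicator (ball 0 \<rho>) (w *s x) *\<^sub>R h (w *s x))"
    by (subst integral_distr) (auto intro!: borel_measurable_times borel_measurable_indicator)
  also have "\<dots> = (LINT x : ball 0 \<rho> | lborel. h (w *s x))"
    unfolding set_lebesgue_integral_def
    by (intro Bochner_Integration.integral_cong) (auto simp: indicator_def norm_vector_smult w)
  finally show ?thesis ..
qed

text \<open>A product of maxima is not the modulus of a holomorphic function. Freezing, factor by
  factor, the entry that attains the maximum at the point \<open>s\<close> gives a holomorphic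
  \<open>H\<close> whose modulus agrees with the product at \<open>s\<close> and is at most the
  product everywhere, so the maximum principle for \<open>H\<close> suffices.\<close>

lemma finite_product_max_modulus:
  fixes h :: "complex \<Rightarrow> complex"
  assumes hol: "h holomorphic_on UNIV" and t: "0 < t" and fin: "finite U" and s: "0 \<le> s" "s \<le> c"
  obtains \<zeta> where "cmod \<zeta> = c"
    "(\<Prod>\<omega>\<in>U. max (cmod (h (of_real s * \<omega>))) t) \<le> (\<Prod>\<omega>\<in>U. max (cmod (h (\<zeta> * \<omega>))) t)"
proof -
  define H where "H = (\<lambda>\<zeta>. \<Prod>\<omega>\<in>U. if cmod (h (of_real s * \<omega>)) \<ge> t then h (\<zeta> * \<omega>) else of_real t)"
  have H1: "cmod (H (of_real s)) = (\<Prod>\<omega>\<in>U. max (cmod (h (of_real s * \<omega>))) t)"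
    using t by (auto simp: H_def prod_norm[symmetric] max_def intro!: prod.cong)
  have H2: "cmod (H \<zeta>) \<le> (\<Prod>\<omega>\<in>U. max (cmod (h (\<zeta> * \<omega>))) t)" for \<zeta>
    using t by (auto simp: H_def prod_norm[symmetric] intro!: prod_mono)
  have hc: "(\<lambda>\<zeta>. h (\<zeta> * \<omega>)) holomorphic_on UNIV" for \<omega>
    by (rule holomorphic_on_compose_gen[of "\<lambda>\<zeta>. \<zeta> * \<omega>" UNIV h UNIV, unfolded o_def])
      (auto intro: holomorphic_intros hol)
  have hol': "H holomorphic_on UNIV"
    unfolding H_def
  proof (rule holomorphic_on_prod)
    show "(\<lambda>\<zeta>. if cmod (h (of_real s * \<omega>)) \<ge> t then h (\<zeta> * \<omega>) else of_real t) holomorphic_on UNIV" for \<omega>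
      using hc by (cases "cmod (h (of_real s * \<omega>)) \<ge> t") auto
  qed
  then have cont: "continuous_on S H" for S
    by (meson holomorphic_on_imp_continuous_on continuous_on_subset subset_UNIV)
  have ne: "sphere (0::complex) c \<noteq> {}" using s by simp
  have "\<exists>\<zeta>\<in>sphere 0 c. \<forall>w\<in>sphere 0 c. cmod (H w) \<le> cmod (H \<zeta>)"
    by (rule continuous_attains_sup) (use ne cont in \<open>auto intro!: continuous_intros\<close>)
  then obtain \<zeta> where z: "cmod \<zeta> = c" "\<And>w. cmod w = c \<Longrightarrow> cmod (H w) \<le> cmod (H \<zeta>)" by auto
  have "cmod (H (of_real s)) \<le> cmod (H \<zeta>)"
  proof (cases "c = 0")
    case True
    then show ?thesis using s z by auto
  next
    case False
    show ?thesis
      by (rule maximum_modulus_frontier[of H "cball 0 c"])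
        (use s False z cont hol' in \<open>auto intro: holomorphic_on_subset\<close>)
  qed
  then show ?thesis using that[of \<zeta>] z(1) H1 H2[of \<zeta>] by linarith
qed

text \<open>The maximum principle yields a point of the circle that need not lie on the grid of
  \<open>N\<close>-th roots of unity. Rounding its argument down to a multiple of
  \<open>2 * pi / N\<close> costs at most the arc length, as chords are shorter than arcs.\<close>

lemma root_of_unity_near:
  assumes N: "N > 0" and z: "cmod \<zeta> = c"
  obtains \<omega> where "\<omega> ^ N = 1" "cmod (\<zeta> - of_real c * \<omega>) \<le> c * (2 * pi / real N)"
proof -
  define \<theta> where "\<theta> = Arg \<zeta>"
  have zc: "\<zeta> = of_real c * exp (\<i> * of_real \<theta>)"
    using Arg_eq[of \<zeta>] z by (cases "\<zeta> = 0") (auto simp: \<theta>_def)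
  define k where "k = \<lfloor>\<theta> * real N / (2 * pi)\<rfloor>"
  define \<phi> where "\<phi> = 2 * pi * of_int k / real N"
  have "of_int k \<le> \<theta> * real N / (2 * pi)" "\<theta> * real N / (2 * pi) < of_int k + 1"
    unfolding k_def by linarith+
  then have "\<phi> \<le> \<theta>" "\<theta> < \<phi> + 2 * pi / real N"
    using N by (simp_all add: \<phi>_def field_simps)
  then have d: "\<bar>\<theta> - \<phi>\<bar> \<le> 2 * pi / real N" by linarith
  have c: "c \<ge> 0" using z norm_ge_zero by metis
  define \<omega> where "\<omega> = exp (\<i> * of_real \<phi>)"
  have "\<omega> ^ N = exp (of_nat N * (\<i> * of_real \<phi>))"
    by (simp add: \<omega>_def exp_of_nat_mult)
  also have "of_nat N * (\<i> * of_real \<phi>) = 2 * of_int k * of_real pi * \<i>"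
    using N by (simp add: \<phi>_def field_simps)
  also have "exp \<dots> = 1"
    using exp_integer_2pi[of "of_int k"] by (simp add: mult_ac)
  finally have 1: "\<omega> ^ N = 1" .
  have "exp (\<i> * of_real \<theta>) - \<omega> = \<omega> * (exp (\<i> * of_real (\<theta> - \<phi>)) - 1)"
    by (simp add: \<omega>_def algebra_simps exp_diff)
  moreover have "cmod \<omega> = 1" by (simp add: \<omega>_def)
  ultimately have "cmod (exp (\<i> * of_real \<theta>) - \<omega>) = cmod (exp (\<i> * of_real (\<theta> - \<phi>)) - 1)"
    by (simp add: norm_mult)
  also have "\<dots> = 2 * \<bar>sin ((\<theta> - \<phi>) / 2)\<bar>"
    using dist_exp_i_1[of "\<theta> - \<phi>"] by simp
  also have "\<dots> \<le> \<bar>\<theta> - \<phi>\<bar>"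
    using abs_sin_x_le_abs_x[of "(\<theta> - \<phi>) / 2"] by simp
  finally have "cmod (exp (\<i> * of_real \<theta>) - \<omega>) \<le> 2 * pi / real N" using d by linarith
  then have "c * cmod (exp (\<i> * of_real \<theta>) - \<omega>) \<le> c * (2 * pi / real N)"
    using c by (rule mult_left_mono)
  moreover have "cmod (\<zeta> - of_real c * \<omega>) = c * cmod (exp (\<i> * of_real \<theta>) - \<omega>)"
  proof -
    have "\<zeta> - of_real c * \<omega> = of_real c * (exp (\<i> * of_real \<theta>) - \<omega>)"
      by (simp add: zc algebra_simps)
    then show ?thesis using c by (simp add: norm_mult)
  qed
  ultimately show ?thesis using that[of \<omega>] 1 by auto
qed

section \<open>Subharmonicity and Jensen's inequality\<close>

text \<open>Holomorphy on complex lines is all that the maximum principle and Liouville's theorem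
  use; continuity supplies measurability and boundedness on balls. Polynomials in such functions are
  of the same kind, with no derivatives in several variables involved.\<close>

definition slice_holomorphic :: "(complex ^ 'm::finite \<Rightarrow> complex) \<Rightarrow> bool" where
  "slice_holomorphic g \<longleftrightarrow>
     continuous_on UNIV g \<and> (\<forall>z x. (\<lambda>\<zeta>. g (z + \<zeta> *s x)) holomorphic_on UNIV)"

text \<open>The truncation of \<open>log |g|\<close> at level \<open>ln t\<close>: continuous, hence
  integrable on balls, and still subharmonic on complex lines as a maximum of two subharmonic
  functions. At \<open>t = 1\<close> it is \<open>log^+ |g|\<close>.\<close>

definition log_max :: "real \<Rightarrow> (complex ^ 'm::finite \<Rightarrow> complex) \<Rightarrow> complex ^ 'm \<Rightarrow> real" where
  "log_max t g z = ln (max (cmod (g z)) t)"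

lemma continuous_log_max:
  assumes "slice_holomorphic g" "t > 0"
  shows "continuous_on S (log_max t g)"
proof -
  have "continuous_on S g"
    using assms unfolding slice_holomorphic_def by (meson continuous_on_subset subset_UNIV)
  then show ?thesis
    using assms(2) unfolding log_max_def
    by (intro continuous_intros) (auto simp: max_def not_le intro: less_le_trans)
qed

lemma borel_measurable_log_max [measurable]:
  assumes "slice_holomorphic g" "t > 0"
  shows "log_max t g \<in> borel_measurable borel"
  by (intro borel_measurable_continuous_onI continuous_log_max assms)

text \<open>The discrete form of the fact that circle means of a subharmonic function increase with
  the radius. Taking logarithms in the product inequality compares the grid at radius
  \<open>a\<close> with a rotated grid at radius \<open>b\<close>; uniform continuity removes the
  rotation at the price of \<open>\<eta>\<close> per root.\<close>

lemma roots_of_unity_sum_mono: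
  fixes g :: "complex ^ 'm::finite \<Rightarrow> complex"
  assumes g: "slice_holomorphic g" and t: "t > 0" and N: "N > 0"
    and ab: "0 \<le> a" "a \<le> b" and R: "b * norm x \<le> R"
    and \<eta>: "\<And>p q. p \<in> cball z R \<Longrightarrow> q \<in> cball z R \<Longrightarrow> dist p q \<le> R * (2 * pi / real N) \<Longrightarrow>
              \<bar>log_max t g p - log_max t g q\<bar> \<le> \<eta>"
  shows "(\<Sum>\<omega> | \<omega> ^ N = 1. log_max t g (z + (of_real a * \<omega>) *s x))
       \<le> (\<Sum>\<omega> | \<omega> ^ N = 1. log_max t g (z + (of_real b * \<omega>) *s x)) + real N * \<eta>"
proof -
  define U where "U = {\<omega>::complex. \<omega> ^ N = 1}"
  have finU: "finite U" and cardU: "card U = N"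
    using N card_roots_unity_eq[of N] finite_roots_unity[of N] by (auto simp: U_def)
  have U1: "cmod \<omega> = 1" if "\<omega> \<in> U" for \<omega>
  proof -
    have "cmod \<omega> ^ N = 1" using that by (simp add: U_def norm_power[symmetric])
    then show ?thesis using N by (metis norm_ge_zero power_eq_1_iff norm_of_real abs_norm_cancel not_gr0 real_norm_def)
  qed
  define h where "h = (\<lambda>\<zeta>. g (z + \<zeta> *s x))"
  have hol: "h holomorphic_on UNIV" using g by (simp add: h_def slice_holomorphic_def)
  have ln_prod_h: "ln (\<Prod>\<omega>\<in>U. max (cmod (h (\<zeta> * \<omega>))) t) = (\<Sum>\<omega>\<in>U. log_max t g (z + (\<zeta> * \<omega>) *s x))" for \<zeta>
    using finU t by (subst ln_prod) (auto simp: h_def log_max_def less_max_iff_disj)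
  have pos: "(\<Prod>\<omega>\<in>U. max (cmod (h (\<zeta> * \<omega>))) t) > 0" for \<zeta>
    using t by (intro prod_pos) (auto simp: less_max_iff_disj)
  obtain \<zeta> where \<zeta>: "cmod \<zeta> = b"
    "(\<Prod>\<omega>\<in>U. max (cmod (h (of_real a * \<omega>))) t) \<le> (\<Prod>\<omega>\<in>U. max (cmod (h (\<zeta> * \<omega>))) t)"
    using finite_product_max_modulus[OF hol t finU ab] by blast
  have le: "(\<Sum>\<omega>\<in>U. log_max t g (z + (of_real a * \<omega>) *s x)) \<le> (\<Sum>\<omega>\<in>U. log_max t g (z + (\<zeta> * \<omega>) *s x))"
    using \<zeta>(2) pos ln_prod_h by (metis ln_le_cancel_iff)
  obtain \<omega>0 where w0: "\<omega>0 ^ N = 1" "cmod (\<zeta> - of_real b * \<omega>0) \<le> b * (2 * pi / real N)"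
    using root_of_unity_near[OF N \<zeta>(1)] by blast
  have w0': "\<omega>0 \<noteq> 0" "cmod \<omega>0 = 1" using U1[of \<omega>0] w0 by (auto simp: U_def)
  \<comment> \<open>Division by \<open>\<omega>0\<close> permutes the roots of unity, so the grid
    starting at \<open>\<zeta>\<close> can be matched with the one starting at \<open>b\<close> in
    such a way that paired points are close.\<close>
  have "(\<Sum>\<omega>\<in>U. log_max t g (z + (\<zeta> * \<omega>) *s x)) = (\<Sum>\<omega>\<in>U. log_max t g (z + (\<zeta> * (\<omega> / \<omega>0)) *s x))"
    by (rule sum.reindex_bij_witness[of _ "\<lambda>\<omega>. \<omega> / \<omega>0" "\<lambda>\<omega>. \<omega> * \<omega>0"])
      (use w0 w0' in \<open>auto simp: U_def power_divide power_mult_distrib\<close>)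
  also have "\<dots> \<le> (\<Sum>\<omega>\<in>U. log_max t g (z + (of_real b * \<omega>) *s x) + \<eta>)"
  proof (rule sum_mono)
    fix \<omega> assume w: "\<omega> \<in> U"
    have b: "b \<ge> 0" using ab by simp
    have d: "dist (z + (\<zeta> * (\<omega> / \<omega>0)) *s x) (z + (of_real b * \<omega>) *s x) \<le> R * (2 * pi / real N)"
    proof -
      have "dist (z + (\<zeta> * (\<omega> / \<omega>0)) *s x) (z + (of_real b * \<omega>) *s x)
          = norm ((\<zeta> * (\<omega> / \<omega>0) - of_real b * \<omega>) *s x)"
        by (simp add: dist_norm vector_sub_rdistrib)
      also have "\<dots> = cmod (\<zeta> * (\<omega> / \<omega>0) - of_real b * \<omega>) * norm x"
        by (rule norm_vector_smult)
      also have "\<zeta> * (\<omega> / \<omega>0) - of_real b * \<omega> = (\<zeta> - of_real b * \<omega>0) * (\<omega> / \<omega>0)"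
        using w0' by (simp add: field_simps)
      also have "cmod \<dots> = cmod (\<zeta> - of_real b * \<omega>0)"
        using U1[OF w] w0' by (simp add: norm_mult norm_divide)
      also have "\<dots> * norm x \<le> (b * (2 * pi / real N)) * norm x"
        using w0 by (intro mult_right_mono) auto
      also have "\<dots> = (b * norm x) * (2 * pi / real N)" by simp
      also have "\<dots> \<le> R * (2 * pi / real N)"
        using R by (intro mult_right_mono) auto
      finally show ?thesis .
    qed
    have "\<bar>log_max t g (z + (\<zeta> * (\<omega> / \<omega>0)) *s x) - log_max t g (z + (of_real b * \<omega>) *s x)\<bar> \<le> \<eta>"
      by (rule \<eta>[OF _ _ d])
        (use R \<zeta>(1) w0' U1[OF w] b in \<open>auto simp: dist_norm norm_vector_smult norm_mult norm_divide\<close>)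
    then show "log_max t g (z + (\<zeta> * (\<omega> / \<omega>0)) *s x) \<le> log_max t g (z + (of_real b * \<omega>) *s x) + \<eta>"
      by linarith
  qed
  also have "\<dots> = (\<Sum>\<omega>\<in>U. log_max t g (z + (of_real b * \<omega>) *s x)) + real N * \<eta>"
    by (simp add: sum.distrib cardU)
  finally show ?thesis using le by (simp add: U_def)
qed

lemma set_integrable_bounded:
  fixes h :: "'a::euclidean_space \<Rightarrow> real"
  assumes [measurable]: "h \<in> borel_measurable borel" and B: "\<And>x. x \<in> ball c \<rho> \<Longrightarrow> \<bar>h x\<bar> \<le> B"
  shows "set_integrable lborel (ball c \<rho>) h"
proof -
  have "integrable lborel (\<lambda>x. indicator (ball c \<rho>) x *\<^sub>R B)"
    using emeasure_bounded_finite[OF bounded_ball[of c \<rho>]]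
    by (intro integrable_real_indicator integrable_scaleR_left) auto
  then show ?thesis
    unfolding set_integrable_def
    by (rule Bochner_Integration.integrable_bound)
       (use B in \<open>auto simp: indicator_def intro!: borel_measurable_times borel_measurable_indicator
         AE_I2 order_trans[OF _ abs_ge_self]\<close>)
qed

text \<open>The function \<open>log_max t g\<close> is subharmonic along complex lines. Averages over roots of unity
  replace averages over circles: they are exactly invariant under the integral, and the maximum
  principle compares them on concentric circles.\<close>

lemma ball_integral_radial_mono:
  fixes g :: "complex ^ 'm::finite \<Rightarrow> complex"
  assumes g: "slice_holomorphic g" and t: "t > 0"
    and [measurable]: "\<alpha> \<in> borel_measurable borel" "\<beta> \<in> borel_measurable borel"
    and ab: "\<And>s. 0 \<le> s \<Longrightarrow> s < \<rho> \<Longrightarrow> 0 \<le> \<alpha> s \<and> \<alpha> s \<le> \<beta> s \<and> \<beta> s * s \<le> R"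
  shows "(LINT x : ball 0 \<rho> | lborel. log_max t g (z + \<alpha> (norm x) *\<^sub>R x))
       \<le> (LINT x : ball 0 \<rho> | lborel. log_max t g (z + \<beta> (norm x) *\<^sub>R x))"
proof -
  let ?J = "\<lambda>h. LINT x : ball (0 :: complex ^ 'm) \<rho> | lborel. h x"
  define v where "v = log_max t g"
  define V where "V = measure lborel (ball (0 :: complex ^ 'm) \<rho>)"
  have [measurable]: "v \<in> borel_measurable borel"
    unfolding v_def using g t by (rule borel_measurable_log_max)
  have vcont: "continuous_on (cball z R) v"
    unfolding v_def using g t by (rule continuous_log_max)
  then have "compact (v ` cball z R)" by (intro compact_continuous_image) auto
  then obtain B where B: "\<And>p. p \<in> cball z R \<Longrightarrow> \<bar>v p\<bar> \<le> B"
    by (meson bounded_real compact_imp_bounded imageI)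
  have int: "set_integrable lborel (ball 0 \<rho>) (\<lambda>x. v (z + (of_real (\<gamma> (norm x)) * \<omega>) *s x))"
    if [measurable]: "\<gamma> \<in> borel_measurable borel"
      and \<gamma>: "\<And>s. 0 \<le> s \<Longrightarrow> s < \<rho> \<Longrightarrow> 0 \<le> \<gamma> s \<and> \<gamma> s * s \<le> R" and w: "cmod \<omega> = 1" for \<gamma> \<omega>
  proof (rule set_integrable_bounded)
    have [measurable]: "(\<lambda>x :: complex ^ 'm. \<omega> *s x) \<in> borel_measurable borel"
      by (intro borel_measurable_continuous_onI linear_continuous_on
        linear_conv_bounded_linear[THEN iffD1] linear_smult)
    have "(\<lambda>x :: complex ^ 'm. v (z + \<gamma> (norm x) *\<^sub>R (\<omega> *s x))) \<in> borel_measurable borel"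
      by measurable
    then show "(\<lambda>x :: complex ^ 'm. v (z + (of_real (\<gamma> (norm x)) * \<omega>) *s x)) \<in> borel_measurable borel"
      by (simp add: scaleR_eq_smult vector_smult_assoc)
  next
    fix x :: "complex ^ 'm" assume "x \<in> ball 0 \<rho>"
    then show "\<bar>v (z + (of_real (\<gamma> (norm x)) * \<omega>) *s x)\<bar> \<le> B"
      using \<gamma>[of "norm x"] w by (intro B) (auto simp: dist_norm norm_vector_smult norm_mult)
  qed
  have rot: "?J (\<lambda>x. v (z + (of_real (\<gamma> (norm x)) * \<omega>) *s x)) = ?J (\<lambda>x. v (z + \<gamma> (norm x) *\<^sub>R x))"
    if [measurable]: "\<gamma> \<in> borel_measurable borel" and w: "cmod \<omega> = 1" for \<gamma> \<omega>
  proof -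
    have "(\<lambda>x :: complex ^ 'm. v (z + \<gamma> (norm x) *\<^sub>R x)) \<in> borel_measurable borel"
      by measurable
    from ball_integral_rotate[OF this w, of \<rho>] show ?thesis
      by (simp add: scaleR_eq_smult vector_smult_assoc norm_vector_smult w)
  qed
  have V0: "V \<ge> 0" by (simp add: V_def)
  have main: "?J (\<lambda>x. v (z + \<alpha> (norm x) *\<^sub>R x)) \<le> ?J (\<lambda>x. v (z + \<beta> (norm x) *\<^sub>R x)) + \<eta> * V"
    if \<eta>: "\<eta> > 0" for \<eta>
  proof -
    have "uniformly_continuous_on (cball z R) v"
      using vcont by (intro compact_uniformly_continuous) auto
    then obtain \<delta> where \<delta>: "\<delta> > 0"
      "\<And>p q. p \<in> cball z R \<Longrightarrow> q \<in> cball z R \<Longrightarrow> dist p q < \<delta> \<Longrightarrow> \<bar>v p - v q\<bar> < \<eta>"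
      using \<eta> unfolding uniformly_continuous_on_def dist_real_def by (metis abs_minus_commute dist_commute)
    \<comment> \<open>\<open>N\<close> makes the grid spacing on the largest circle, of radius at
      most \<open>R\<close>, finer than the \<open>\<delta>\<close> of uniform continuity for
      \<open>\<eta>\<close>.\<close>
    obtain N0 :: nat where N0: "real N0 > R * (2 * pi) / \<delta>" using reals_Archimedean2 by blast
    define N where "N = Suc N0"
    have N: "N > 0" "R * (2 * pi / real N) < \<delta>"
    proof -
      have "real N > R * (2 * pi) / \<delta>" using N0 by (simp add: N_def)
      then show "R * (2 * pi / real N) < \<delta>" using \<delta>(1) by (simp add: field_simps N_def)
    qed (simp add: N_def)
    define U where "U = {\<omega>::complex. \<omega> ^ N = 1}"
    have finU: "finite U" and cardU: "card U = N"
      using N card_roots_unity_eq[of N] finite_roots_unity[of N] by (auto simp: U_def)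
    have U1: "cmod \<omega> = 1" if "\<omega> \<in> U" for \<omega>
    proof -
      have "cmod \<omega> ^ N = 1" using that by (simp add: U_def norm_power[symmetric])
      then show ?thesis using N by (metis norm_ge_zero power_eq_1_iff norm_of_real abs_norm_cancel not_gr0 real_norm_def)
    qed
    \<comment> \<open>All \<open>N\<close> rotated integrands have the same integral, so the ball
      integral becomes that of a sum over roots of unity, to which the pointwise comparison
      applies.\<close>
    have avg: "real N * ?J (\<lambda>x. v (z + \<gamma> (norm x) *\<^sub>R x))
        = ?J (\<lambda>x. \<Sum>\<omega>\<in>U. v (z + (of_real (\<gamma> (norm x)) * \<omega>) *s x))"
      and avg_int: "set_integrable lborel (ball 0 \<rho>) (\<lambda>x. \<Sum>\<omega>\<in>U. v (z + (of_real (\<gamma> (norm x)) * \<omega>) *s x))"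
      if [measurable]: "\<gamma> \<in> borel_measurable borel"
        and \<gamma>: "\<And>s. 0 \<le> s \<Longrightarrow> s < \<rho> \<Longrightarrow> 0 \<le> \<gamma> s \<and> \<gamma> s * s \<le> R" for \<gamma>
    proof -
      have i: "set_integrable lborel (ball 0 \<rho>) (\<lambda>x. v (z + (of_real (\<gamma> (norm x)) * \<omega>) *s x))"
        if "\<omega> \<in> U" for \<omega>
        using that by (intro int \<gamma> U1) auto
      have "?J (\<lambda>x. \<Sum>\<omega>\<in>U. v (z + (of_real (\<gamma> (norm x)) * \<omega>) *s x))
          = (\<Sum>\<omega>\<in>U. ?J (\<lambda>x. v (z + (of_real (\<gamma> (norm x)) * \<omega>) *s x)))"
        unfolding set_lebesgue_integral_def scaleR_sum_right
        by (rule Bochner_Integration.integral_sum) (use i in \<open>auto simp: set_integrable_def\<close>)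
      also have "\<dots> = (\<Sum>\<omega>\<in>U. ?J (\<lambda>x. v (z + \<gamma> (norm x) *\<^sub>R x)))"
        using U1 by (intro sum.cong refl rot) auto
      finally show "real N * ?J (\<lambda>x. v (z + \<gamma> (norm x) *\<^sub>R x))
        = ?J (\<lambda>x. \<Sum>\<omega>\<in>U. v (z + (of_real (\<gamma> (norm x)) * \<omega>) *s x))" by (simp add: cardU)
      show "set_integrable lborel (ball 0 \<rho>) (\<lambda>x. \<Sum>\<omega>\<in>U. v (z + (of_real (\<gamma> (norm x)) * \<omega>) *s x))"
        unfolding set_integrable_def scaleR_sum_right
        by (rule Bochner_Integration.integrable_sum) (use i in \<open>auto simp: set_integrable_def\<close>)
    qed
    have a: "0 \<le> \<alpha> s \<and> \<alpha> s * s \<le> R" "0 \<le> \<beta> s \<and> \<beta> s * s \<le> R" if "0 \<le> s" "s < \<rho>" for s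
      using ab[OF that] that mult_right_mono[of "\<alpha> s" "\<beta> s" s] by auto
    have ic: "set_integrable lborel (ball (0 :: complex ^ 'm) \<rho>) (\<lambda>x. real N * \<eta>)"
      by (rule set_integrable_bounded) auto
    have "real N * ?J (\<lambda>x. v (z + \<alpha> (norm x) *\<^sub>R x))
        = ?J (\<lambda>x. \<Sum>\<omega>\<in>U. v (z + (of_real (\<alpha> (norm x)) * \<omega>) *s x))"
      by (rule avg) (use a in auto)
    also have "\<dots> \<le> ?J (\<lambda>x. (\<Sum>\<omega>\<in>U. v (z + (of_real (\<beta> (norm x)) * \<omega>) *s x)) + real N * \<eta>)"
    proof (rule set_integral_mono)
      show "set_integrable lborel (ball 0 \<rho>) (\<lambda>x :: complex ^ 'm. \<Sum>\<omega>\<in>U. v (z + (of_real (\<alpha> (norm x)) * \<omega>) *s x))"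
        by (rule avg_int) (use a in auto)
      show "set_integrable lborel (ball 0 \<rho>) (\<lambda>x :: complex ^ 'm. (\<Sum>\<omega>\<in>U. v (z + (of_real (\<beta> (norm x)) * \<omega>) *s x)) + real N * \<eta>)"
        by (intro set_integral_add avg_int ic) (use a in auto)
      fix x :: "complex ^ 'm" assume "x \<in> ball 0 \<rho>"
      then have x: "0 \<le> norm x" "norm x < \<rho>" by auto
      show "(\<Sum>\<omega>\<in>U. v (z + (of_real (\<alpha> (norm x)) * \<omega>) *s x))
          \<le> (\<Sum>\<omega>\<in>U. v (z + (of_real (\<beta> (norm x)) * \<omega>) *s x)) + real N * \<eta>"
        unfolding U_def v_def
      proof (rule roots_of_unity_sum_mono[OF g t N(1)])
        show "0 \<le> \<alpha> (norm x)" "\<alpha> (norm x) \<le> \<beta> (norm x)" "\<beta> (norm x) * norm x \<le> R"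
          using ab[OF x] by auto
        show "\<bar>log_max t g p - log_max t g q\<bar> \<le> \<eta>"
          if "p \<in> cball z R" "q \<in> cball z R" "dist p q \<le> R * (2 * pi / real N)" for p q
          using \<delta>(2)[OF that(1,2)] that(3) N(2) unfolding v_def by linarith
      qed
    qed
    also have "\<dots> = ?J (\<lambda>x. (\<Sum>\<omega>\<in>U. v (z + (of_real (\<beta> (norm x)) * \<omega>) *s x))) + ?J (\<lambda>x. real N * \<eta>)"
      by (intro set_integral_add avg_int ic) (use a in auto)
    also have "?J (\<lambda>x. (\<Sum>\<omega>\<in>U. v (z + (of_real (\<beta> (norm x)) * \<omega>) *s x))) = real N * ?J (\<lambda>x. v (z + \<beta> (norm x) *\<^sub>R x))"
      by (rule avg[symmetric]) (use a in auto)
    also have "?J (\<lambda>x. real N * \<eta>) = real N * \<eta> * V"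
      by (simp add: set_lebesgue_integral_def V_def)
    finally have "real N * ?J (\<lambda>x. v (z + \<alpha> (norm x) *\<^sub>R x))
        \<le> real N * (?J (\<lambda>x. v (z + \<beta> (norm x) *\<^sub>R x)) + \<eta> * V)"
      by (simp add: algebra_simps)
    then show ?thesis using N(1) by simp
  qed
  have "?J (\<lambda>x. v (z + \<alpha> (norm x) *\<^sub>R x)) \<le> ?J (\<lambda>x. v (z + \<beta> (norm x) *\<^sub>R x))"
  proof (rule field_le_epsilon)
    fix e :: real assume e: "e > 0"
    have "e / (V + 1) * V \<le> e" using e V0 by (simp add: field_simps)
    moreover have "e / (V + 1) > 0" using e V0 by simp
    ultimately show "?J (\<lambda>x. v (z + \<alpha> (norm x) *\<^sub>R x)) \<le> ?J (\<lambda>x. v (z + \<beta> (norm x) *\<^sub>R x)) + e"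
      using main[of "e / (V + 1)"] by linarith
  qed
  then show ?thesis by (simp add: v_def)
qed

lemma measurable_sgn_vec [measurable]: "(sgn :: 'a::euclidean_space \<Rightarrow> 'a) \<in> borel_measurable borel"
  unfolding sgn_div_norm by measurable

text \<open>The upper bound must not depend on \<open>t\<close>, because \<open>t\<close> tends to 0
  later; truncation at level 1 dominates all smaller levels.\<close>

lemma log_max_bound_above:
  fixes g :: "complex ^ 'm::finite \<Rightarrow> complex"
  assumes g: "slice_holomorphic g"
  obtains B where "B \<ge> 0" "\<And>x t. x \<in> cball z R \<Longrightarrow> 0 < t \<Longrightarrow> t \<le> 1 \<Longrightarrow> log_max t g x \<le> B"
proof -
  have "compact (log_max 1 g ` cball z R)"
    using g by (intro compact_continuous_image continuous_log_max) auto
  then obtain B where B: "\<And>p. p \<in> cball z R \<Longrightarrow> \<bar>log_max 1 g p\<bar> \<le> B"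
    by (meson bounded_real compact_imp_bounded imageI)
  have "log_max t g x \<le> max B 0" if "x \<in> cball z R" "0 < t" "t \<le> 1" for x t
  proof -
    have "log_max t g x \<le> log_max 1 g x"
      unfolding log_max_def using that by (subst ln_le_cancel_iff) (auto simp: less_max_iff_disj)
    then show ?thesis using B[OF that(1)] by linarith
  qed
  then show ?thesis using that[of "max B 0"] by auto
qed

lemma log_max_bound:
  fixes g :: "complex ^ 'm::finite \<Rightarrow> complex"
  assumes g: "slice_holomorphic g" and t: "t > 0"
  obtains B where "\<And>x. x \<in> cball z R \<Longrightarrow> \<bar>log_max t g x\<bar> \<le> B"
proof -
  have "compact (log_max t g ` cball z R)"
    using g t by (intro compact_continuous_image continuous_log_max) auto
  then obtain B where B: "\<And>p. p \<in> cball z R \<Longrightarrow> \<bar>log_max t g p\<bar> \<le> B"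
    by (meson bounded_real compact_imp_bounded imageI)
  then show ?thesis using that by blast
qed

lemma set_integrable_log_max_ball:
  fixes g :: "complex ^ 'm::finite \<Rightarrow> complex"
  assumes g: "slice_holomorphic g" and t: "t > 0"
  shows "set_integrable lborel (ball z \<rho>) (log_max t g)"
proof -
  obtain B where "\<And>x. x \<in> cball z \<rho> \<Longrightarrow> \<bar>log_max t g x\<bar> \<le> B"
    using log_max_bound[OF g t] by blast
  then show ?thesis
    by (intro set_integrable_bounded[where B = B] borel_measurable_log_max g t) auto
qed

lemma set_integrable_log_max_sphere:
  fixes g :: "complex ^ 'm::finite \<Rightarrow> complex"
  assumes g: "slice_holomorphic g" and t: "t > 0"
  shows "set_integrable lborel (ball z \<rho>) (\<lambda>x. log_max t g (r *\<^sub>R sgn x))"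
proof -
  have [measurable]: "log_max t g \<in> borel_measurable borel" by (intro borel_measurable_log_max g t)
  obtain B where "\<And>x. x \<in> cball 0 \<bar>r\<bar> \<Longrightarrow> \<bar>log_max t g x\<bar> \<le> B"
    using log_max_bound[OF g t] by blast
  then show ?thesis
    by (intro set_integrable_bounded[where B = B]) (auto simp: norm_sgn)
qed

text \<open>Pushing each \<open>x\<close> radially out to norm \<open>r\<close> is the factor
  \<open>r / s\<close> at radius \<open>s\<close>, which is at least 1 on the unit ball because
  \<open>r \<ge> 1\<close>. The factor 1 at \<open>s = 0\<close> is consistent with
  \<open>sgn 0 = 0\<close>.\<close>

lemma ball_integral_le_sphere_integral:
  fixes g :: "complex ^ 'm::finite \<Rightarrow> complex"
  assumes g: "slice_holomorphic g" and t: "t > 0" and r: "r \<ge> 1"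
  shows "(LINT x : ball 0 1 | lborel. log_max t g x)
       \<le> (LINT x : ball 0 1 | lborel. log_max t g (r *\<^sub>R sgn x))"
proof -
  have eq: "(if norm x = 0 then 1 else r / norm x) *\<^sub>R x = r *\<^sub>R sgn x" for x :: "complex ^ 'm"
    by (simp add: sgn_div_norm divide_inverse)
  have "(LINT x : ball 0 1 | lborel. log_max t g (0 + (\<lambda>_. 1) (norm x) *\<^sub>R x))
       \<le> (LINT x : ball 0 1 | lborel. log_max t g (0 + (\<lambda>s. if s = 0 then 1 else r / s) (norm x) *\<^sub>R x))"
    by (rule ball_integral_radial_mono[OF g t, where R = r]) (use r in \<open>auto simp: field_simps\<close>)
  then show ?thesis using eq by simp
qed

text \<open>The sub-mean value property: the radial factor 0 collapses the ball to its centre, the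
  factor 1 gives the ball itself, and a translation moves the centre to \<open>z\<close>.\<close>

lemma ball_submean:
  fixes g :: "complex ^ 'm::finite \<Rightarrow> complex"
  assumes g: "slice_holomorphic g" and t: "t > 0" and \<rho>: "\<rho> > 0"
  shows "measure lborel (ball (0 :: complex ^ 'm) \<rho>) * log_max t g z \<le> (LINT x : ball z \<rho> | lborel. log_max t g x)"
proof -
  have [measurable]: "log_max t g \<in> borel_measurable borel" by (intro borel_measurable_log_max g t)
  have "(LINT x : ball 0 \<rho> | lborel. log_max t g (z + (\<lambda>_. 0) (norm x) *\<^sub>R x))
       \<le> (LINT x : ball 0 \<rho> | lborel. log_max t g (z + (\<lambda>_. 1) (norm x) *\<^sub>R x))"
    by (rule ball_integral_radial_mono[OF g t, where R = \<rho>]) auto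
  moreover have "(LINT x : ball (0 :: complex ^ 'm) \<rho> | lborel. log_max t g (z + (\<lambda>_. 0) (norm x) *\<^sub>R x))
      = measure lborel (ball (0 :: complex ^ 'm) \<rho>) * log_max t g z"
    by (simp add: set_lebesgue_integral_def)
  moreover have "(LINT x : ball z \<rho> | lborel. log_max t g x) = (LINT x : ball 0 \<rho> | lborel. log_max t g (z + x))"
  proof -
    have "(LINT x : ball z \<rho> | lborel. log_max t g x)
        = (LINT x|distr lborel borel ((+) z). indicator (ball z \<rho>) x *\<^sub>R log_max t g x)"
      by (simp only: lborel_distr_plus set_lebesgue_integral_def)
    also have "\<dots> = (LINT x|lborel. indicator (ball z \<rho>) (z + x) *\<^sub>R log_max t g (z + x))"
      by (subst integral_distr) (auto intro!: borel_measurable_times borel_measurable_indicator)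
    also have "\<dots> = (LINT x : ball 0 \<rho> | lborel. log_max t g (z + x))"
      unfolding set_lebesgue_integral_def
      by (intro Bochner_Integration.integral_cong) (auto simp: indicator_def dist_norm)
    finally show ?thesis .
  qed
  ultimately show ?thesis by simp
qed

lemma set_integral_mono_subset:
  fixes h :: "'a \<Rightarrow> real"
  assumes "set_integrable M B h" "A \<in> sets M" "A \<subseteq> B" "\<And>x. x \<in> B \<Longrightarrow> h x \<ge> 0"
  shows "(LINT x : A | M. h x) \<le> (LINT x : B | M. h x)"
proof -
  have "set_integrable M A h" using assms set_integrable_subset by blast
  then show ?thesis
    using assms unfolding set_lebesgue_integral_def set_integrable_def
    by (intro integral_mono) (auto simp: indicator_def)
qed

lemma set_integral_const_ball:
  "(LINT x : ball (z :: 'a::euclidean_space) \<rho> | lborel. c) = measure lborel (ball z \<rho>) * (c::real)"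
  by (simp add: set_lebesgue_integral_def)

text \<open>The lower bound in Jensen's formula, uniformly in the truncation level \<open>t\<close>. The base point
  \<open>z0\<close> with \<open>g z0 \<noteq> 0\<close> need not be the centre of the spheres, hence the detour over balls.\<close>

lemma sphere_integral_log_max_lower:
  fixes g :: "complex ^ 'm::finite \<Rightarrow> complex"
  assumes g: "slice_holomorphic g" and z0: "g z0 \<noteq> 0"
  obtains C where "\<And>r t. r \<ge> 1 \<Longrightarrow> 0 < t \<Longrightarrow> t \<le> 1 \<Longrightarrow>
     - C \<le> (LINT x : ball 0 1 | lborel. log_max t g (r *\<^sub>R sgn x))"
proof -
  \<comment> \<open>This radius makes the ball around \<open>z0\<close> contain the unit
    ball.\<close>
  define \<rho> where "\<rho> = 1 + norm z0"
  have \<rho>: "\<rho> > 0" by (simp add: \<rho>_def add_pos_nonneg)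
  define V where "V = measure lborel (ball (0 :: complex ^ 'm) \<rho>)"
  obtain B where B: "B \<ge> 0" "\<And>x t. x \<in> cball z0 \<rho> \<Longrightarrow> 0 < t \<Longrightarrow> t \<le> 1 \<Longrightarrow> log_max t g x \<le> B"
    using log_max_bound_above[OF g] by blast
  have V: "measure lborel (ball z0 \<rho>) = V"
    using \<rho> by (simp add: V_def content_ball)
  have sub: "ball 0 1 \<subseteq> ball z0 \<rho>"
  proof
    fix x :: "complex ^ 'm" assume "x \<in> ball 0 1"
    then show "x \<in> ball z0 \<rho>" using norm_triangle_ineq4[of z0 x] by (simp add: dist_norm \<rho>_def)
  qed
  have "- (V * B - V * ln (cmod (g z0))) \<le> (LINT x : ball 0 1 | lborel. log_max t g (r *\<^sub>R sgn x))"
    if r: "r \<ge> 1" and t: "0 < t" "t \<le> 1" for r t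
  proof -
    have i: "set_integrable lborel (ball z p) (log_max t g)" for z p
      by (rule set_integrable_log_max_ball[OF g t(1)])
    have c: "set_integrable lborel (ball z p) (\<lambda>x :: complex ^ 'm. B)" for z p
      by (rule set_integrable_bounded) auto
    \<comment> \<open>Subtracting from the upper bound \<open>B\<close> makes the integrand
      nonnegative, so enlarging the ball increases the integral. The resulting lower bound involves
      only \<open>B\<close>, the volume and \<open>ln |g z0|\<close>, not \<open>t\<close>.\<close>
    have "(LINT x : ball 0 1 | lborel. B - log_max t g x) \<le> (LINT x : ball z0 \<rho> | lborel. B - log_max t g x)"
      by (rule set_integral_mono_subset) (use sub B t set_integral_diff(1)[OF c i] in auto)
    then have "(LINT x : ball (0 :: complex ^ 'm) 1 | lborel. B) - (LINT x : ball 0 1 | lborel. log_max t g x)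
        \<le> V * B - (LINT x : ball z0 \<rho> | lborel. log_max t g x)"
      unfolding set_integral_diff(2)[OF c i] by (simp only: set_integral_const_ball V)
    moreover have "(LINT x : ball (0 :: complex ^ 'm) 1 | lborel. B) \<ge> 0"
      using B by (simp add: set_integral_const_ball)
    moreover have "V * log_max t g z0 \<le> (LINT x : ball z0 \<rho> | lborel. log_max t g x)"
      unfolding V_def by (rule ball_submean[OF g t(1) \<rho>])
    moreover have "V * ln (cmod (g z0)) \<le> V * log_max t g z0"
    proof (rule mult_left_mono)
      show "ln (cmod (g z0)) \<le> log_max t g z0"
        unfolding log_max_def using z0 by (subst ln_le_cancel_iff) (auto simp: less_max_iff_disj)
    qed (simp add: V_def)
    moreover have "(LINT x : ball 0 1 | lborel. log_max t g x)
       \<le> (LINT x : ball 0 1 | lborel. log_max t g (r *\<^sub>R sgn x))"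
      by (rule ball_integral_le_sphere_integral[OF g t(1) r])
    ultimately show ?thesis by linarith
  qed
  then show ?thesis by (rule that)
qed

text \<open>On the zero set the truncated logarithm equals \<open>ln t\<close>. Were the zeros of
  positive measure, the integral would tend to \<open>-\<infinity>\<close> as \<open>t\<close> tends
  to 0, against the lower bound uniform in \<open>t\<close>.\<close>

lemma AE_sphere_nonzero:
  fixes g :: "complex ^ 'm::finite \<Rightarrow> complex"
  assumes g: "slice_holomorphic g" and z0: "g z0 \<noteq> 0" and r: "r \<ge> 1"
  shows "AE x in lborel. x \<in> ball 0 1 \<longrightarrow> g (r *\<^sub>R sgn x) \<noteq> 0"
proof -
  obtain C where C: "\<And>r t. r \<ge> 1 \<Longrightarrow> 0 < t \<Longrightarrow> t \<le> 1 \<Longrightarrow>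
     - C \<le> (LINT x : ball 0 1 | lborel. log_max t g (r *\<^sub>R sgn x))"
    using sphere_integral_log_max_lower[OF g z0] by blast
  obtain B where B: "B \<ge> 0" "\<And>x t. x \<in> cball 0 r \<Longrightarrow> 0 < t \<Longrightarrow> t \<le> 1 \<Longrightarrow> log_max t g x \<le> B"
    using log_max_bound_above[OF g] by blast
  have [measurable]: "g \<in> borel_measurable borel"
    using g by (auto simp: slice_holomorphic_def intro: borel_measurable_continuous_onI)
  define Z where "Z = {x :: complex ^ 'm. x \<in> ball 0 1 \<and> g (r *\<^sub>R sgn x) = 0}"
  have Zeq: "Z = ball 0 1 \<inter> {x. g (r *\<^sub>R sgn x) = 0}" by (auto simp: Z_def)
  have Zm: "Z \<in> sets lborel" unfolding Zeq by (intro sets.Int) measurable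
  have "bounded Z" by (rule bounded_subset[OF bounded_ball[of 0 1]]) (auto simp: Z_def)
  then have Zfin: "emeasure lborel Z < \<infinity>" by (rule emeasure_bounded_finite)
  define V where "V = measure lborel (ball (0 :: complex ^ 'm) 1)"
  have bound: "s * measure lborel Z \<le> C + V * B" if s: "s \<ge> 0" for s
  proof -
    define t where "t = exp (- s)"
    have t: "0 < t" "t \<le> 1" using s by (auto simp: t_def)
    have iZ: "set_integrable lborel (ball 0 1) (\<lambda>x. - s * indicator Z x)"
    proof (rule set_integrable_bounded)
      show "(\<lambda>x. - s * indicator Z x) \<in> borel_measurable borel"
        using Zm by (intro borel_measurable_times borel_measurable_indicator) auto
      show "\<bar>- s * indicator Z x\<bar> \<le> s" for x using s by (auto simp: indicator_def)
    qed
    have ic: "set_integrable lborel (ball 0 1) (\<lambda>x :: complex ^ 'm. B)"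
      by (rule set_integrable_bounded) auto
    have "- C \<le> (LINT x : ball 0 1 | lborel. log_max t g (r *\<^sub>R sgn x))" by (rule C[OF r t])
    also have "\<dots> \<le> (LINT x : ball 0 1 | lborel. - s * indicator Z x + B)"
    proof (rule set_integral_mono)
      show "set_integrable lborel (ball 0 1) (\<lambda>x. log_max t g (r *\<^sub>R sgn x))"
        by (rule set_integrable_log_max_sphere[OF g t(1)])
      show "set_integrable lborel (ball 0 1) (\<lambda>x. - s * indicator Z x + B)"
        by (rule set_integral_add(1)[OF iZ ic])
      fix x :: "complex ^ 'm" assume x: "x \<in> ball 0 1"
      have "log_max t g (r *\<^sub>R sgn x) \<le> B" using r t by (intro B) (auto simp: norm_sgn)
      moreover have "log_max t g (r *\<^sub>R sgn x) = - s" if "x \<in> Z"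
        using that by (simp add: Z_def log_max_def t_def max_def)
      ultimately show "log_max t g (r *\<^sub>R sgn x) \<le> - s * indicator Z x + B"
        using B(1) by (cases "x \<in> Z") auto
    qed
    also have "\<dots> = (LINT x : ball 0 1 | lborel. - s * indicator Z x) + V * B"
      using set_integral_add(2)[OF iZ ic] by (simp only: set_integral_const_ball V_def)
    also have "(LINT x : ball 0 1 | lborel. - s * indicator Z x) = (LINT x | lborel. - s * indicator Z x)"
      unfolding set_lebesgue_integral_def
      by (intro Bochner_Integration.integral_cong) (auto simp: indicator_def Z_def)
    also have "\<dots> = - s * measure lborel Z" using Zm by simp
    finally show ?thesis by simp
  qed
  have "measure lborel Z \<le> 0"
  proof (rule ccontr)
    assume "\<not> measure lborel Z \<le> 0"
    then have m: "measure lborel Z > 0" by simp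
    define s where "s = \<bar>C + V * B\<bar> / measure lborel Z + 1"
    have "s * measure lborel Z = \<bar>C + V * B\<bar> + measure lborel Z" using m by (simp add: s_def field_simps)
    moreover have "s \<ge> 0" using m by (simp add: s_def)
    ultimately show False using bound[of s] m by linarith
  qed
  then have "measure lborel Z = 0" by (simp add: measure_le_0_iff)
  then have "emeasure lborel Z = 0" using Zfin by (simp add: emeasure_eq_ennreal_measure)
  then have "Z \<in> null_sets lborel" using Zm by auto
  then have "AE x in lborel. x \<notin> Z" by (rule AE_not_in)
  then show ?thesis by eventually_elim (auto simp: Z_def)
qed

section \<open>Growth of the proximity function of a nonconstant entire function\<close>

lemma log_plus_eq_log_max: "log_plus (cmod (g z)) = log_max 1 g z"
  by (simp add: log_plus_def log_max_def max_def)

lemma prox_eq_log_max: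
  fixes f :: "complex ^ 'm::finite \<Rightarrow> complex"
  shows "prox r f = (LINT x : ball 0 1 | lborel. log_max 1 f (r *\<^sub>R sgn x)) / measure lborel (ball (0 :: complex ^ 'm) 1)"
  by (simp add: prox_def sphere_avg_def log_plus_eq_log_max)

lemma slice_holomorphic_scaleR:
  assumes "slice_holomorphic f"
  shows "slice_holomorphic (\<lambda>x. f (c *\<^sub>R x))"
proof -
  have eq: "c *\<^sub>R (z + \<zeta> *s x) = c *\<^sub>R z + \<zeta> *s (c *\<^sub>R x)" for z x :: "complex ^ 'm" and \<zeta>
    by (simp add: vec_eq_iff scaleR_right_distrib)
  have "continuous_on UNIV f" and hol: "\<And>z x. (\<lambda>\<zeta>. f (z + \<zeta> *s x)) holomorphic_on UNIV"
    using assms by (auto simp: slice_holomorphic_def)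
  then have "continuous_on UNIV (\<lambda>x. f (c *\<^sub>R x))"
    by (auto intro!: continuous_on_compose2[of UNIV f] continuous_intros)
  moreover have "(\<lambda>\<zeta>. f (c *\<^sub>R (z + \<zeta> *s x))) holomorphic_on UNIV" for z x
    unfolding eq by (rule hol)
  ultimately show ?thesis unfolding slice_holomorphic_def by blast
qed

text \<open>After rescaling by \<open>R\<close>, the ball of radius 1/2 around \<open>z / R\<close>
  lies in the unit ball. Since \<open>log_max 1\<close> is nonnegative, its integral over the small
  ball is at most that over the unit ball, which the sphere integral dominates; the constant is the
  ratio of the two volumes.\<close>

lemma log_max_one_le_prox:
  fixes f :: "complex ^ 'm::finite \<Rightarrow> complex"
  assumes f: "slice_holomorphic f" and R: "R > 0" "R \<ge> 2 * norm z"
  shows "log_max 1 f z \<le> measure lborel (ball (0 :: complex ^ 'm) 1) / measure lborel (ball (0 :: complex ^ 'm) (1/2)) * prox R f"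
proof -
  define g where "g = (\<lambda>x. f (R *\<^sub>R x))"
  have g: "slice_holomorphic g" unfolding g_def by (rule slice_holomorphic_scaleR[OF f])
  define y where "y = (1 / R) *\<^sub>R z"
  have y: "norm y \<le> 1 / 2" "R *\<^sub>R y = z" using R by (auto simp: y_def divide_le_eq)
  have sub: "ball y (1/2) \<subseteq> ball 0 1"
  proof
    fix x assume "x \<in> ball y (1/2)"
    then show "x \<in> ball 0 1" using y(1) norm_triangle_ineq2[of x y] by (simp add: dist_norm norm_minus_commute)
  qed
  have pos: "measure lborel (ball (0 :: complex ^ 'm) (1/2)) > 0" "measure lborel (ball (0 :: complex ^ 'm) 1) > 0"
    by (auto intro: content_ball_pos)
  have nn: "log_max 1 g x \<ge> 0" for x unfolding log_max_def by (rule ln_ge_zero) simp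
  have "measure lborel (ball (0 :: complex ^ 'm) (1/2)) * log_max 1 g y \<le> (LINT x : ball y (1/2) | lborel. log_max 1 g x)"
    by (rule ball_submean[OF g]) auto
  also have "\<dots> \<le> (LINT x : ball 0 1 | lborel. log_max 1 g x)"
    by (rule set_integral_mono_subset) (use sub nn set_integrable_log_max_ball[OF g] in auto)
  also have "\<dots> \<le> (LINT x : ball 0 1 | lborel. log_max 1 g (1 *\<^sub>R sgn x))"
    by (rule ball_integral_le_sphere_integral[OF g]) auto
  also have "\<dots> = measure lborel (ball (0 :: complex ^ 'm) 1) * prox R f"
    using pos by (simp add: prox_eq_log_max g_def log_max_def)
  finally show ?thesis using pos y(2) by (simp add: field_simps g_def log_max_def)
qed

text \<open>A proximity function bounded along some unbounded set of radii bounds \<open>f\<close>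
  at every point, since the pointwise estimate holds at all positive radii beyond
  \<open>2 * norm z\<close>; Liouville's theorem on each line through 0 then makes \<open>f\<close>
  constant. The divergence later absorbs additive constants.\<close>

lemma prox_tends_to_infinity:
  fixes f :: "complex ^ 'm::finite \<Rightarrow> complex"
  assumes f: "slice_holomorphic f" and nc: "\<not> (\<exists>c. \<forall>z. f z = c)"
  shows "filterlim (\<lambda>r. prox r f) at_top at_top"
  unfolding filterlim_at_top
proof (rule allI, rule ccontr)
  fix B :: real
  assume "\<not> eventually (\<lambda>r. B \<le> prox r f) at_top"
  then have small: "\<exists>r\<ge>r0. prox r f < B" for r0
    unfolding eventually_at_top_linorder by (meson not_le)
  define c where "c = measure lborel (ball (0 :: complex ^ 'm) 1) / measure lborel (ball (0 :: complex ^ 'm) (1/2))"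
  have c: "c \<ge> 0" by (simp add: c_def)
  have bound: "cmod (f z) \<le> exp (c * B)" for z
  proof -
    obtain r where r: "r \<ge> max 1 (2 * norm z)" "prox r f < B" using small by blast
    have "log_max 1 f z \<le> c * prox r f"
      unfolding c_def by (rule log_max_one_le_prox[OF f]) (use r in auto)
    also have "\<dots> \<le> c * B" using r c by (intro mult_left_mono) auto
    finally have "max (cmod (f z)) 1 \<le> exp (c * B)"
      unfolding log_max_def by (metis exp_le_cancel_iff exp_ln less_max_iff_disj zero_less_one)
    then show ?thesis by simp
  qed
  have "f z = f 0" for z
  proof -
    have hol: "(\<lambda>\<zeta>. f (0 + \<zeta> *s z)) holomorphic_on UNIV" using f unfolding slice_holomorphic_def by blast
    have "bounded (range (\<lambda>\<zeta>. f (0 + \<zeta> *s z)))"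
      unfolding bounded_iff using bound by blast
    from Liouville_theorem[OF hol this] obtain k where k: "\<And>\<zeta>. f (0 + \<zeta> *s z) = k"
      unfolding constant_on_def by blast
    show ?thesis using k[of 0] k[of 1] by (simp add: vec_eq_iff)
  qed
  then show False using nc by blast
qed

lemma entire_Cm_imp_slice_holomorphic:
  fixes f :: "complex ^ 'm::finite \<Rightarrow> complex"
  assumes "entire_Cm f"
  shows "slice_holomorphic f"
proof -
  have "continuous_on UNIV f"
    using assms unfolding entire_Cm_def
    by (metis continuous_at_imp_continuous_on has_derivative_continuous)
  moreover have "(\<lambda>\<zeta>. f (z + \<zeta> *s x)) holomorphic_on UNIV" for z x
  proof (rule holomorphic_onI)
    fix \<zeta>
    obtain D where D: "(f has_derivative D) (at (z + \<zeta> *s x))" "\<And>c v. D (c *s v) = c * D v"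
      using assms unfolding entire_Cm_def by blast
    have lin: "bounded_linear (\<lambda>\<zeta>. \<zeta> *s x)"
      by (rule linear_conv_bounded_linear[THEN iffD1], rule linearI) (simp_all add: vec_eq_iff algebra_simps)
    have "((\<lambda>\<zeta>. z + \<zeta> *s x) has_derivative (\<lambda>\<zeta>. \<zeta> *s x)) (at \<zeta>)"
      using bounded_linear_imp_has_derivative[OF lin] by (auto intro!: derivative_eq_intros)
    from has_derivative_compose[OF this D(1)]
    have "((\<lambda>\<zeta>. f (z + \<zeta> *s x)) has_derivative (\<lambda>h. D (h *s x))) (at \<zeta>)" .
    then have "((\<lambda>\<zeta>. f (z + \<zeta> *s x)) has_field_derivative D x) (at \<zeta>)"
      unfolding has_field_derivative_def by (simp add: D(2) mult.commute[of _ "D x"])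
    then show "(\<lambda>\<zeta>. f (z + \<zeta> *s x)) field_differentiable at \<zeta> within UNIV"
      unfolding field_differentiable_def by blast
  qed
  ultimately show ?thesis unfolding slice_holomorphic_def by blast
qed

section \<open>Polynomials vanishing to high order on a hypersurface germ\<close>

text \<open>Gaussian elimination: an equation with a nonzero coefficient at \<open>p\<close> is
  solved for \<open>x p\<close>, and \<open>c'\<close> holds the coefficients of the other equations
  after substitution.\<close>

lemma homogeneous_system_nontrivial:
  fixes c :: "'e \<Rightarrow> 'u \<Rightarrow> 'a::field"
  assumes "finite E" "finite U" "card E < card U"
  shows "\<exists>x. (\<exists>u\<in>U. x u \<noteq> 0) \<and> (\<forall>e\<in>E. (\<Sum>u\<in>U. c e u * x u) = 0)"
  using assms
proof (induction E arbitrary: U c rule: finite_induct)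
  case empty
  then have "U \<noteq> {}" by auto
  then show ?case by (intro exI[of _ "\<lambda>_. 1"]) auto
next
  case (insert e E)
  show ?case
  proof (cases "\<forall>u\<in>U. c e u = 0")
    case True
    obtain x where x: "\<exists>u\<in>U. x u \<noteq> 0" "\<forall>e\<in>E. (\<Sum>u\<in>U. c e u * x u) = 0"
      using insert.IH[OF insert.prems(1), of c] insert.prems insert.hyps by auto
    have "(\<Sum>u\<in>U. c e u * x u) = 0" by (intro sum.neutral) (use True in auto)
    then show ?thesis using x by blast
  next
    case False
    then obtain p where p: "p \<in> U" "c e p \<noteq> 0" by blast
    define U' where "U' = U - {p}"
    define c' where "c' = (\<lambda>e' u. c e' u - c e' p * c e u / c e p)"
    have U': "finite U'" "card E < card U'" "p \<notin> U'" "U = insert p U'"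
      using insert.prems insert.hyps p by (auto simp: U'_def)
    obtain x' where x': "\<exists>u\<in>U'. x' u \<noteq> 0" "\<And>e'. e' \<in> E \<Longrightarrow> (\<Sum>u\<in>U'. c' e' u * x' u) = 0"
      using insert.IH[OF U'(1,2), of c'] by blast
    define x where "x = x'(p := - (\<Sum>u\<in>U'. c e u * x' u) / c e p)"
    have eq: "(\<Sum>u\<in>U. c e' u * x u) = (\<Sum>u\<in>U'. c' e' u * x' u)" for e'
    proof -
      have "(\<Sum>u\<in>U. c e' u * x u) = c e' p * x p + (\<Sum>u\<in>U'. c e' u * x u)"
        using U' by (simp add: sum.insert)
      also have "(\<Sum>u\<in>U'. c e' u * x u) = (\<Sum>u\<in>U'. c e' u * x' u)"
        using U'(3) by (intro sum.cong) (auto simp: x_def)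
      also have "c e' p * x p = - (\<Sum>u\<in>U'. c e' p * c e u / c e p * x' u)"
        by (simp add: x_def sum_distrib_left sum_divide_distrib mult_ac)
      finally show ?thesis
        by (simp add: c'_def left_diff_distrib sum_subtractf)
    qed
    have "(\<Sum>u\<in>U'. c' e u * x' u) = 0"
      by (intro sum.neutral) (use p in \<open>auto simp: c'_def\<close>)
    then have "\<forall>e'\<in>insert e E. (\<Sum>u\<in>U. c e' u * x u) = 0"
      using eq x'(2) by auto
    moreover have "\<exists>u\<in>U. x u \<noteq> 0"
      using x'(1) U' by (auto simp: x_def)
    ultimately show ?thesis by blast
  qed
qed

text \<open>With the first \<open>n\<close> indices fixed and the last one running over all
  \<open>l\<close>, independence of the sequences removes the last factor. They will be Taylor
  coefficients of functions of one variable, so that a nonzero \<open>P\<close> yields a nonzero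
  power series.\<close>

lemma tensor_independent:
  fixes e :: "'x \<Rightarrow> nat \<Rightarrow> complex" and a :: "(nat \<Rightarrow> 'x) \<Rightarrow> complex"
  assumes X: "finite X"
    and indep: "\<And>c. (\<And>l. (\<Sum>x\<in>X. c x * e x l) = 0) \<Longrightarrow> \<forall>x\<in>X. c x = 0"
    and zero: "\<And>\<alpha>. (\<Sum>\<delta>\<in>PiE {..<n} (\<lambda>_. X). a \<delta> * (\<Prod>i<n. e (\<delta> i) (\<alpha> i))) = 0"
    and \<delta>: "\<delta> \<in> PiE {..<n} (\<lambda>_. X)"
  shows "a \<delta> = 0"
  using zero \<delta>
proof (induction n arbitrary: a \<delta>)
  case 0
  then show ?case by simp
next
  case (Suc n)
  have split: "(\<Sum>\<delta>\<in>PiE {..<Suc n} (\<lambda>_. X). h \<delta>) = (\<Sum>x\<in>X. \<Sum>\<delta>\<in>PiE {..<n} (\<lambda>_. X). h (\<delta>(n := x)))"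
    for h :: "(nat \<Rightarrow> 'x) \<Rightarrow> complex"
  proof -
    have eq: "PiE {..<Suc n} (\<lambda>_. X) = (\<lambda>(x, \<delta>). \<delta>(n := x)) ` (X \<times> PiE {..<n} (\<lambda>_. X))"
      by (simp add: lessThan_Suc PiE_insert_eq)
    have inj: "inj_on (\<lambda>(x, \<delta>). \<delta>(n := x)) (X \<times> PiE {..<n} (\<lambda>_. X))"
      using inj_combinator[of n "{..<n}" "\<lambda>_. X"] by simp
    show ?thesis
      unfolding eq sum.reindex[OF inj] sum.cartesian_product by (simp add: case_prod_beta o_def)
  qed
  have step: "(\<Sum>\<delta>\<in>PiE {..<n} (\<lambda>_. X). a (\<delta>(n := x)) * (\<Prod>i<n. e (\<delta> i) (\<alpha> i))) = 0"
    if x: "x \<in> X" for x \<alpha>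
  proof -
    have "(\<Sum>x\<in>X. (\<Sum>\<delta>\<in>PiE {..<n} (\<lambda>_. X). a (\<delta>(n := x)) * (\<Prod>i<n. e (\<delta> i) (\<alpha> i))) * e x l) = 0" for l
    proof -
      have "(\<Sum>\<delta>\<in>PiE {..<Suc n} (\<lambda>_. X). a \<delta> * (\<Prod>i<Suc n. e (\<delta> i) ((\<alpha>(n := l)) i))) = 0"
        by (rule Suc.prems(1))
      also have "(\<Sum>\<delta>\<in>PiE {..<Suc n} (\<lambda>_. X). a \<delta> * (\<Prod>i<Suc n. e (\<delta> i) ((\<alpha>(n := l)) i)))
        = (\<Sum>x\<in>X. (\<Sum>\<delta>\<in>PiE {..<n} (\<lambda>_. X). a (\<delta>(n := x)) * (\<Prod>i<n. e (\<delta> i) (\<alpha> i))) * e x l)"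
        unfolding split sum_distrib_right
      proof (intro sum.cong refl)
        fix x \<delta>
        have "(\<Prod>i<n. e ((\<delta>(n := x)) i) ((\<alpha>(n := l)) i)) = (\<Prod>i<n. e (\<delta> i) (\<alpha> i))"
          by (intro prod.cong) auto
        then show "a (\<delta>(n := x)) * (\<Prod>i<Suc n. e ((\<delta>(n := x)) i) ((\<alpha>(n := l)) i)) =
            a (\<delta>(n := x)) * (\<Prod>i<n. e (\<delta> i) (\<alpha> i)) * e x l"
          by (simp add: lessThan_Suc mult_ac)
      qed
      finally show ?thesis .
    qed
    then show ?thesis using indep[of "\<lambda>x. \<Sum>\<delta>\<in>PiE {..<n} (\<lambda>_. X). a (\<delta>(n := x)) * (\<Prod>i<n. e (\<delta> i) (\<alpha> i))"] x
      by auto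
  qed
  define \<delta>' where "\<delta>' = restrict \<delta> {..<n}"
  have \<delta>': "\<delta>' \<in> PiE {..<n} (\<lambda>_. X)" using Suc.prems(2) by (auto simp: \<delta>'_def PiE_iff)
  have x: "\<delta> n \<in> X" using Suc.prems(2) by (auto simp: PiE_iff)
  have "\<delta>'(n := \<delta> n) = \<delta>"
    using Suc.prems(2) by (auto simp: \<delta>'_def fun_eq_iff PiE_iff extensional_def restrict_def)
  then show ?case
    using Suc.IH[where a = "\<lambda>\<eta>. a (\<eta>(n := \<delta> n))", OF step[OF x] \<delta>'] by simp
qed

section \<open>Exponent vectors and a monomial order\<close>

text \<open>Vectors are padded by 0 beyond \<open>n\<close>, not by \<open>undefined\<close>, so
  that they can be added pointwise and have the support that \<open>is_poly_in\<close> asks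
  for.\<close>

definition expo_vecs :: "nat \<Rightarrow> (nat \<Rightarrow> nat set) \<Rightarrow> (nat \<Rightarrow> nat) set" where
  "expo_vecs n S = {\<alpha>. (\<forall>i<n. \<alpha> i \<in> S i) \<and> (\<forall>i\<ge>n. \<alpha> i = 0)}"

lemma expo_vecs_bij:
  "bij_betw (\<lambda>\<alpha> i. if i < n then \<alpha> i else 0) (PiE {..<n} S) (expo_vecs n S)"
proof (rule bij_betw_byWitness[where f' = "\<lambda>\<alpha>. restrict \<alpha> {..<n}"])
  show "\<forall>a\<in>Pi\<^sub>E {..<n} S. restrict (\<lambda>i. if i < n then a i else 0) {..<n} = a"
    by (auto simp: fun_eq_iff PiE_iff extensional_def restrict_def)
  show "\<forall>a\<in>expo_vecs n S. (\<lambda>i. if i < n then restrict a {..<n} i else 0) = a"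
  proof (rule ballI, rule ext)
    fix a i assume "a \<in> expo_vecs n S"
    then have "i \<ge> n \<Longrightarrow> a i = 0" unfolding expo_vecs_def by blast
    then show "(if i < n then restrict a {..<n} i else 0) = a i" by (cases "i < n") auto
  qed
  show "(\<lambda>\<alpha> i. if i < n then \<alpha> i else 0) ` Pi\<^sub>E {..<n} S \<subseteq> expo_vecs n S"
    by (intro image_subsetI) (simp add: expo_vecs_def PiE_iff)
  show "(\<lambda>\<alpha>. restrict \<alpha> {..<n}) ` expo_vecs n S \<subseteq> Pi\<^sub>E {..<n} S"
    by (intro image_subsetI) (simp add: expo_vecs_def PiE_iff)
qed

lemma finite_expo_vecs: "(\<And>i. i < n \<Longrightarrow> finite (S i)) \<Longrightarrow> finite (expo_vecs n S)"
  using bij_betw_finite[OF expo_vecs_bij[of n S]] finite_PiE[of "{..<n}" S] by auto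

lemma card_expo_vecs: "card (expo_vecs n S) = (\<Prod>i<n. card (S i))"
  using bij_betw_same_card[OF expo_vecs_bij[of n S]] card_PiE[of "{..<n}" S] by simp

lemma prod_sum_expo_vecs:
  fixes f :: "nat \<Rightarrow> nat \<Rightarrow> complex"
  assumes "\<And>i. i < n \<Longrightarrow> finite (S i)"
  shows "(\<Prod>i<n. \<Sum>l\<in>S i. f i l) = (\<Sum>\<alpha>\<in>expo_vecs n S. \<Prod>i<n. f i (\<alpha> i))"
proof -
  have "(\<Prod>i<n. \<Sum>l\<in>S i. f i l) = (\<Sum>\<alpha>\<in>PiE {..<n} S. \<Prod>i<n. f i (\<alpha> i))"
    using assms by (intro prod_sum_PiE) auto
  also have "\<dots> = (\<Sum>\<alpha>\<in>PiE {..<n} S. \<Prod>i<n. f i ((\<lambda>i. if i < n then \<alpha> i else 0) i))"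
    by (rule sum.cong[OF refl], rule prod.cong[OF refl]) simp
  also have "\<dots> = (\<Sum>\<alpha>\<in>expo_vecs n S. \<Prod>i<n. f i (\<alpha> i))"
    by (rule sum.reindex_bij_betw[OF expo_vecs_bij])
  finally show ?thesis .
qed

text \<open>A monomial order with values in the naturals: send the \<open>i\<close>-th variable to the \<open>i\<close>-th prime.\<close>

lemma exists_monomial_weight:
  obtains W :: "(nat \<Rightarrow> nat) \<Rightarrow> nat"
  where "\<And>\<alpha>. W \<alpha> > 0" "\<And>\<alpha> \<beta>. W (\<lambda>i. \<alpha> i + \<beta> i) = W \<alpha> * W \<beta>"
    "\<And>\<alpha> \<beta>. \<alpha> \<in> expo_vecs n (\<lambda>_. UNIV) \<Longrightarrow> \<beta> \<in> expo_vecs n (\<lambda>_. UNIV) \<Longrightarrow> W \<alpha> = W \<beta> \<Longrightarrow> \<alpha> = \<beta>"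
proof -
  obtain p :: "nat \<Rightarrow> nat" where p: "inj p" "range p \<subseteq> {p. prime p}"
    using infinite_countable_subset[OF primes_infinite] by blast
  then have prime_p: "prime (p i)" for i by auto
  define W where "W = (\<lambda>\<alpha>. \<Prod>i<n. p i ^ \<alpha> i)"
  have mult: "multiplicity (p i) (W \<alpha>) = \<alpha> i" if i: "i < n" for i \<alpha>
  proof -
    have "W \<alpha> = (\<Prod>q\<in>p ` {..<n}. q ^ \<alpha> (inv p q))"
      unfolding W_def using p(1) by (subst prod.reindex) (auto intro: inj_on_subset)
    then have "multiplicity (p i) (W \<alpha>) = (if p i \<in> p ` {..<n} then \<alpha> (inv p (p i)) else 0)"
      using prime_p by (simp only:) (rule multiplicity_prod_prime_powers, auto)
    then show ?thesis using i p(1) by auto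
  qed
  show ?thesis
  proof (rule that[of W])
    show "W \<alpha> > 0" for \<alpha> unfolding W_def using prime_p by (intro prod_pos) (auto simp: prime_gt_0_nat)
    show "W (\<lambda>i. \<alpha> i + \<beta> i) = W \<alpha> * W \<beta>" for \<alpha> \<beta>
      by (simp add: W_def power_add prod.distrib)
    show "\<alpha> = \<beta>" if "\<alpha> \<in> expo_vecs n (\<lambda>_. UNIV)" "\<beta> \<in> expo_vecs n (\<lambda>_. UNIV)" "W \<alpha> = W \<beta>" for \<alpha> \<beta>
    proof
      fix i
      show "\<alpha> i = \<beta> i"
        using that mult[of i \<alpha>] mult[of i \<beta>] by (cases "i < n") (auto simp: expo_vecs_def)
    qed
  qed
qed

section \<open>Order of vanishing along a zero set\<close>

text \<open>An analytic substitute for \<open>\<phi>\<close> lying in the ideal generated by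
  \<open>G\<close> plus the \<open>K\<close>-th power of the maximal ideal at 0:
  \<open>\<phi>\<close> is \<open>O(s^K)\<close> on the part of \<open>Z\<close> in the polydisc of
  radius \<open>s\<close>, so no quotient ring has to be formed. For \<open>K = 0\<close> it is
  boundedness on the part in the unit polydisc.\<close>

definition vanishes_on :: "(nat \<Rightarrow> complex) set \<Rightarrow> nat \<Rightarrow> nat \<Rightarrow> ((nat \<Rightarrow> complex) \<Rightarrow> complex) \<Rightarrow> bool" where
  "vanishes_on Z n K \<phi> \<longleftrightarrow> (\<exists>C. \<forall>w s. w \<in> Z \<longrightarrow> 0 \<le> s \<longrightarrow> s \<le> 1 \<longrightarrow> (\<forall>i<n. cmod (w i) \<le> s) \<longrightarrow>
      cmod (\<phi> w) \<le> C * s ^ K)"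

lemma vanishes_onI:
  assumes "\<And>w s. w \<in> Z \<Longrightarrow> 0 \<le> s \<Longrightarrow> s \<le> 1 \<Longrightarrow> (\<And>i. i < n \<Longrightarrow> cmod (w i) \<le> s) \<Longrightarrow> cmod (\<phi> w) \<le> C * s ^ K"
  shows "vanishes_on Z n K \<phi>"
  using assms unfolding vanishes_on_def by blast

lemma vanishes_onE:
  assumes "vanishes_on Z n K \<phi>"
  obtains C where "C \<ge> 0" "\<And>w s. w \<in> Z \<Longrightarrow> 0 \<le> s \<Longrightarrow> s \<le> 1 \<Longrightarrow> (\<And>i. i < n \<Longrightarrow> cmod (w i) \<le> s) \<Longrightarrow> cmod (\<phi> w) \<le> C * s ^ K"
proof -
  obtain C where C: "\<forall>w s. w \<in> Z \<longrightarrow> 0 \<le> s \<longrightarrow> s \<le> 1 \<longrightarrow> (\<forall>i<n. cmod (w i) \<le> s) \<longrightarrow> cmod (\<phi> w) \<le> C * s ^ K"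
    using assms unfolding vanishes_on_def by blast
  have "cmod (\<phi> w) \<le> max C 0 * s ^ K"
    if "w \<in> Z" "0 \<le> s" "s \<le> 1" "\<And>i. i < n \<Longrightarrow> cmod (w i) \<le> s" for w s
  proof -
    have "cmod (\<phi> w) \<le> C * s ^ K" using C that by blast
    also have "\<dots> \<le> max C 0 * s ^ K" using that by (intro mult_right_mono) auto
    finally show ?thesis .
  qed
  then show ?thesis using that[of "max C 0"] by auto
qed

lemma vanishes_on_zero [simp]: "vanishes_on Z n K (\<lambda>_. 0)"
  by (rule vanishes_onI[where C = 0]) simp

lemma vanishes_on_add:
  assumes "vanishes_on Z n K \<phi>" "vanishes_on Z n K \<psi>"
  shows "vanishes_on Z n K (\<lambda>w. \<phi> w + \<psi> w)"
proof -
  obtain C where C: "\<And>w s. w \<in> Z \<Longrightarrow> 0 \<le> s \<Longrightarrow> s \<le> 1 \<Longrightarrow> (\<And>i. i < n \<Longrightarrow> cmod (w i) \<le> s) \<Longrightarrow> cmod (\<phi> w) \<le> C * s ^ K"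
    using vanishes_onE[OF assms(1)] by metis
  obtain D where D: "\<And>w s. w \<in> Z \<Longrightarrow> 0 \<le> s \<Longrightarrow> s \<le> 1 \<Longrightarrow> (\<And>i. i < n \<Longrightarrow> cmod (w i) \<le> s) \<Longrightarrow> cmod (\<psi> w) \<le> D * s ^ K"
    using vanishes_onE[OF assms(2)] by metis
  show ?thesis
    by (rule vanishes_onI[where C = "C + D"])
      (use C D in \<open>auto simp: distrib_right intro!: norm_triangle_le add_mono\<close>)
qed

lemma vanishes_on_mult:
  assumes "vanishes_on Z n K \<phi>" "vanishes_on Z n L \<psi>"
  shows "vanishes_on Z n (K + L) (\<lambda>w. \<phi> w * \<psi> w)"
proof -
  obtain C where C: "C \<ge> 0" "\<And>w s. w \<in> Z \<Longrightarrow> 0 \<le> s \<Longrightarrow> s \<le> 1 \<Longrightarrow> (\<And>i. i < n \<Longrightarrow> cmod (w i) \<le> s) \<Longrightarrow> cmod (\<phi> w) \<le> C * s ^ K"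
    using vanishes_onE[OF assms(1)] by metis
  obtain D where D: "D \<ge> 0" "\<And>w s. w \<in> Z \<Longrightarrow> 0 \<le> s \<Longrightarrow> s \<le> 1 \<Longrightarrow> (\<And>i. i < n \<Longrightarrow> cmod (w i) \<le> s) \<Longrightarrow> cmod (\<psi> w) \<le> D * s ^ L"
    using vanishes_onE[OF assms(2)] by metis
  show ?thesis
  proof (rule vanishes_onI[where C = "C * D"])
    fix w s assume a: "w \<in> Z" "0 \<le> (s::real)" "s \<le> 1" "\<And>i. i < n \<Longrightarrow> cmod (w i) \<le> s"
    have "cmod (\<phi> w * \<psi> w) \<le> (C * s ^ K) * (D * s ^ L)"
      unfolding norm_mult using a C D by (intro mult_mono) auto
    then show "cmod (\<phi> w * \<psi> w) \<le> C * D * s ^ (K + L)" by (simp add: power_add mult_ac)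
  qed
qed

lemma bounded_on_const [simp]: "vanishes_on Z n 0 (\<lambda>_. c)"
  by (rule vanishes_onI[where C = "cmod c"]) simp

lemma vanishes_on_cmult:
  assumes "vanishes_on Z n K \<phi>" shows "vanishes_on Z n K (\<lambda>w. c * \<phi> w)"
  using vanishes_on_mult[OF bounded_on_const assms] by simp

lemma vanishes_on_minus:
  assumes "vanishes_on Z n K \<phi>" shows "vanishes_on Z n K (\<lambda>w. - \<phi> w)"
  using vanishes_on_cmult[OF assms, of "-1"] by simp

lemma vanishes_on_diff:
  assumes "vanishes_on Z n K \<phi>" "vanishes_on Z n K \<psi>"
  shows "vanishes_on Z n K (\<lambda>w. \<phi> w - \<psi> w)"
  using vanishes_on_add[OF assms(1) vanishes_on_minus[OF assms(2)]] by simp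

lemma vanishes_on_sum:
  assumes "\<And>j. j \<in> J \<Longrightarrow> vanishes_on Z n K (\<phi> j)"
  shows "vanishes_on Z n K (\<lambda>w. \<Sum>j\<in>J. \<phi> j w)"
  using assms by (induction J rule: infinite_finite_induct) (auto intro: vanishes_on_add)

lemma bounded_on_prod:
  assumes "\<And>j. j \<in> J \<Longrightarrow> vanishes_on Z n 0 (\<phi> j)"
  shows "vanishes_on Z n 0 (\<lambda>w. \<Prod>j\<in>J. \<phi> j w)"
  using assms
proof (induction J rule: infinite_finite_induct)
  case (insert j J)
  then show ?case using vanishes_on_mult[of Z n 0 "\<phi> j" 0] by auto
qed auto

text \<open>Telescoping: the factors are exchanged one at a time while the others stay
  bounded.\<close>

lemma vanishes_on_prod_diff:
  assumes "finite J" "\<And>j. j \<in> J \<Longrightarrow> vanishes_on Z n 0 (\<phi> j)" "\<And>j. j \<in> J \<Longrightarrow> vanishes_on Z n 0 (\<psi> j)"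
    "\<And>j. j \<in> J \<Longrightarrow> vanishes_on Z n K (\<lambda>w. \<phi> j w - \<psi> j w)"
  shows "vanishes_on Z n K (\<lambda>w. (\<Prod>j\<in>J. \<phi> j w) - (\<Prod>j\<in>J. \<psi> j w))"
  using assms
proof (induction J rule: finite_induct)
  case (insert j J)
  have IH: "vanishes_on Z n K (\<lambda>w. (\<Prod>j\<in>J. \<phi> j w) - (\<Prod>j\<in>J. \<psi> j w))"
    using insert by auto
  have "vanishes_on Z n K (\<lambda>w. (\<phi> j w - \<psi> j w) * (\<Prod>j\<in>J. \<phi> j w))"
    using vanishes_on_mult[OF _ bounded_on_prod, of Z n K "\<lambda>w. \<phi> j w - \<psi> j w" J \<phi>] insert by auto
  moreover have "vanishes_on Z n K (\<lambda>w. \<psi> j w * ((\<Prod>j\<in>J. \<phi> j w) - (\<Prod>j\<in>J. \<psi> j w)))"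
    using vanishes_on_mult[OF _ IH, of 0 "\<psi> j"] insert by auto
  ultimately have "vanishes_on Z n K (\<lambda>w. (\<phi> j w - \<psi> j w) * (\<Prod>j\<in>J. \<phi> j w) + \<psi> j w * ((\<Prod>j\<in>J. \<phi> j w) - (\<Prod>j\<in>J. \<psi> j w)))"
    by (rule vanishes_on_add)
  then show ?case using insert.hyps by (simp add: algebra_simps)
qed auto

definition monomial_at :: "nat \<Rightarrow> (nat \<Rightarrow> nat) \<Rightarrow> (nat \<Rightarrow> complex) \<Rightarrow> complex" where
  "monomial_at n \<alpha> w = (\<Prod>i<n. w i ^ \<alpha> i)"

lemma monomial_at_add: "monomial_at n (\<lambda>i. \<alpha> i + \<beta> i) w = monomial_at n \<alpha> w * monomial_at n \<beta> w"
  by (simp add: monomial_at_def power_add prod.distrib)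

lemma bounded_on_power:
  assumes "i < n" shows "vanishes_on Z n 0 (\<lambda>w. w i ^ k)"
  by (rule vanishes_onI[where C = 1]) (use assms in \<open>auto simp: norm_power intro!: power_le_one intro: order_trans\<close>)

lemma bounded_on_monomial: "vanishes_on Z n 0 (monomial_at n \<alpha>)"
  unfolding monomial_at_def by (rule bounded_on_prod) (auto intro: bounded_on_power)

lemma vanishes_on_monomial:
  assumes i: "i < n" "\<alpha> i \<ge> K" shows "vanishes_on Z n K (monomial_at n \<alpha>)"
proof -
  have "vanishes_on Z n K (\<lambda>w. w i ^ K)"
    by (rule vanishes_onI[where C = 1]) (use i in \<open>auto simp: norm_power intro!: power_mono\<close>)
  from vanishes_on_mult[OF this bounded_on_monomial[of Z n "\<alpha>(i := \<alpha> i - K)"]]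
  have "vanishes_on Z n K (\<lambda>w. w i ^ K * monomial_at n (\<alpha>(i := \<alpha> i - K)) w)" by simp
  moreover have "w i ^ K * monomial_at n (\<alpha>(i := \<alpha> i - K)) w = monomial_at n \<alpha> w" for w
  proof -
    have "monomial_at n \<beta> w = w i ^ \<beta> i * (\<Prod>j\<in>{..<n}-{i}. w j ^ \<beta> j)" for \<beta>
      unfolding monomial_at_def using i by (subst prod.remove[of _ i]) auto
    then show ?thesis using i by (simp add: power_add[symmetric] mult.assoc[symmetric])
  qed
  ultimately show ?thesis by simp
qed

section \<open>Division with remainder and the dimension count\<close>

abbreviation exps :: "nat \<Rightarrow> nat \<Rightarrow> (nat \<Rightarrow> nat) set" where
  "exps n K \<equiv> expo_vecs n (\<lambda>_. {..<K})"

text \<open>Division with remainder modulo a power series \<open>\<Sum> g \<alpha> w\<^sup>\<alpha>\<close> with lowest exponent \<open>\<alpha>0\<close>: on its zero set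
  every monomial is, up to high order, a combination of monomials not divisible by \<open>w\<close> to the \<open>\<alpha>0\<close>.\<close>

lemma reduce_monomial:
  fixes W :: "(nat \<Rightarrow> nat) \<Rightarrow> nat"
  assumes W: "\<And>\<alpha>. W \<alpha> > 0" "\<And>\<alpha> \<beta>. W (\<lambda>i. \<alpha> i + \<beta> i) = W \<alpha> * W \<beta>"
    and g: "vanishes_on Z n K (\<lambda>w. \<Sum>\<gamma>\<in>exps n K. g \<gamma> * monomial_at n \<gamma> w)"
    and \<alpha>0: "g \<alpha>0 \<noteq> 0" "\<And>i. i \<ge> n \<Longrightarrow> \<alpha>0 i = 0"
    and least: "\<And>\<gamma>. \<gamma> \<in> exps n K \<Longrightarrow> g \<gamma> \<noteq> 0 \<Longrightarrow> \<gamma> \<noteq> \<alpha>0 \<Longrightarrow> W \<alpha>0 < W \<gamma>"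
    and \<alpha>: "\<alpha> \<in> exps n K"
  shows "\<exists>c. vanishes_on Z n K (\<lambda>w. monomial_at n \<alpha> w -
     (\<Sum>\<beta>\<in>{\<beta> \<in> exps n K. \<not> (\<forall>i<n. \<alpha>0 i \<le> \<beta> i)}. c \<beta> * monomial_at n \<beta> w))"
proof -
  define R where "R = {\<beta> \<in> exps n K. \<not> (\<forall>i<n. \<alpha>0 i \<le> \<beta> i)}"
  have finB: "finite (exps n K)" by (rule finite_expo_vecs) auto
  then have finR: "finite R" by (auto simp: R_def)
  define N where "N = (\<Sum>\<beta>\<in>exps n K. W \<beta>)"
  have WN: "W \<beta> \<le> N" if "\<beta> \<in> exps n K" for \<beta>
    unfolding N_def using that finB by (intro member_le_sum) auto
  have "\<exists>c. vanishes_on Z n K (\<lambda>w. monomial_at n \<alpha> w - (\<Sum>\<beta>\<in>R. c \<beta> * monomial_at n \<beta> w))"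
    using \<alpha>
  \<comment> \<open>Rewriting replaces a monomial by heavier ones. It terminates because weights
    inside the finite box are at most \<open>N\<close>, while a monomial that leaves the box has an
    exponent at least \<open>K\<close> and is negligible.\<close>
  proof (induction "N - W \<alpha>" arbitrary: \<alpha> rule: less_induct)
    case less
    show ?case
    proof (cases "\<alpha> \<in> R")
      case True
      have "(\<Sum>\<beta>\<in>R. (if \<beta> = \<alpha> then 1 else 0) * monomial_at n \<beta> w) = monomial_at n \<alpha> w" for w
      proof -
        have "(\<Sum>\<beta>\<in>R. (if \<beta> = \<alpha> then 1 else 0) * monomial_at n \<beta> w) = (\<Sum>\<beta>\<in>R. if \<beta> = \<alpha> then monomial_at n \<beta> w else 0)"
          by (rule sum.cong) auto
        then show ?thesis using True finR by (simp add: sum.delta)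
      qed
      then show ?thesis by (intro exI[of _ "\<lambda>\<beta>. if \<beta> = \<alpha> then 1 else 0"]) simp
    next
      case False
      then have ge: "\<alpha>0 i \<le> \<alpha> i" if "i < n" for i using less.prems that by (auto simp: R_def)
      \<comment> \<open>Multiplying the power series by \<open>w\<close> to the
        \<open>\<beta>'\<close> turns its lowest term into a multiple of \<open>w\<close> to the
        \<open>\<alpha>\<close>, for which the relation can be solved because
        \<open>g \<alpha>0 \<noteq> 0\<close>.\<close>
      define \<beta>' where "\<beta>' = (\<lambda>i. \<alpha> i - \<alpha>0 i)"
      have \<alpha>0': "\<alpha>0 \<in> exps n K"
        unfolding expo_vecs_def using \<alpha>0(2) ge less.prems le_less_trans
        by (fastforce simp: expo_vecs_def)
      have sum_eq: "(\<lambda>i. \<alpha>0 i + \<beta>' i) = \<alpha>"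
      proof
        fix i show "\<alpha>0 i + \<beta>' i = \<alpha> i"
          using ge[of i] \<alpha>0(2)[of i] by (cases "i < n") (auto simp: \<beta>'_def)
      qed
      have \<beta>'0: "\<beta>' i = 0" if "i \<ge> n" for i using less.prems that by (auto simp: \<beta>'_def expo_vecs_def)
      let ?sh = "\<lambda>\<gamma> i. \<gamma> i + \<beta>' i"
      have "\<exists>c. vanishes_on Z n K (\<lambda>w. g \<gamma> * (monomial_at n (?sh \<gamma>) w - (\<Sum>\<beta>\<in>R. c \<beta> * monomial_at n \<beta> w)))"
        if \<gamma>: "\<gamma> \<in> exps n K - {\<alpha>0}" for \<gamma>
      proof (cases "g \<gamma> = 0")
        case gnz: False
        have lt: "W \<alpha> < W (?sh \<gamma>)"
        proof -
          have "W \<alpha> = W \<alpha>0 * W \<beta>'" using W(2)[of \<alpha>0 \<beta>'] sum_eq by simp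
          moreover have "W (?sh \<gamma>) = W \<gamma> * W \<beta>'" by (rule W(2))
          ultimately show ?thesis using least[of \<gamma>] \<gamma> gnz W(1)[of \<beta>'] by simp
        qed
        show ?thesis
        proof (cases "?sh \<gamma> \<in> exps n K")
          case True
          have "N - W (?sh \<gamma>) < N - W \<alpha>" using lt WN[OF True] by linarith
          from less.hyps[OF this True] obtain c where
            "vanishes_on Z n K (\<lambda>w. monomial_at n (?sh \<gamma>) w - (\<Sum>\<beta>\<in>R. c \<beta> * monomial_at n \<beta> w))" by blast
          then show ?thesis by (intro exI[of _ c] vanishes_on_cmult)
        next
          case False
          then obtain i where "i < n" "?sh \<gamma> i \<ge> K"
            using \<gamma> \<beta>'0 by (auto simp: expo_vecs_def not_less)
          then have "vanishes_on Z n K (monomial_at n (?sh \<gamma>))" by (rule vanishes_on_monomial)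
          then have "vanishes_on Z n K (\<lambda>w. g \<gamma> * monomial_at n (?sh \<gamma>) w)" by (rule vanishes_on_cmult)
          then show ?thesis by (intro exI[of _ "\<lambda>_. 0"]) simp
        qed
      qed simp
      then have "\<forall>\<gamma>\<in>exps n K - {\<alpha>0}. \<exists>c. vanishes_on Z n K
          (\<lambda>w. g \<gamma> * (monomial_at n (?sh \<gamma>) w - (\<Sum>\<beta>\<in>R. c \<beta> * monomial_at n \<beta> w)))"
        by (intro ballI)
      from bchoice[OF this] obtain c where c: "\<And>\<gamma>. \<gamma> \<in> exps n K - {\<alpha>0} \<Longrightarrow>
          vanishes_on Z n K (\<lambda>w. g \<gamma> * (monomial_at n (?sh \<gamma>) w - (\<Sum>\<beta>\<in>R. c \<gamma> \<beta> * monomial_at n \<beta> w)))"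
        by blast
      define c' where "c' = (\<lambda>\<beta>. - (\<Sum>\<gamma>\<in>exps n K - {\<alpha>0}. g \<gamma> / g \<alpha>0 * c \<gamma> \<beta>))"
      have v1: "vanishes_on Z n K (\<lambda>w. inverse (g \<alpha>0) * (monomial_at n \<beta>' w * (\<Sum>\<gamma>\<in>exps n K. g \<gamma> * monomial_at n \<gamma> w)))"
        using vanishes_on_mult[OF bounded_on_monomial g] by (intro vanishes_on_cmult) simp
      have v2: "vanishes_on Z n K (\<lambda>w. inverse (g \<alpha>0) * (\<Sum>\<gamma>\<in>exps n K - {\<alpha>0}.
          g \<gamma> * (monomial_at n (?sh \<gamma>) w - (\<Sum>\<beta>\<in>R. c \<gamma> \<beta> * monomial_at n \<beta> w))))"
        by (intro vanishes_on_cmult vanishes_on_sum c)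
      have "inverse (g \<alpha>0) * (monomial_at n \<beta>' w * (\<Sum>\<gamma>\<in>exps n K. g \<gamma> * monomial_at n \<gamma> w))
          - inverse (g \<alpha>0) * (\<Sum>\<gamma>\<in>exps n K - {\<alpha>0}. g \<gamma> * (monomial_at n (?sh \<gamma>) w - (\<Sum>\<beta>\<in>R. c \<gamma> \<beta> * monomial_at n \<beta> w)))
          = monomial_at n \<alpha> w - (\<Sum>\<beta>\<in>R. c' \<beta> * monomial_at n \<beta> w)" for w
      proof -
        let ?m = "\<lambda>\<gamma>. monomial_at n \<gamma> w"
        have 1: "?m \<beta>' * (\<Sum>\<gamma>\<in>exps n K. g \<gamma> * ?m \<gamma>) = g \<alpha>0 * ?m \<alpha> + (\<Sum>\<gamma>\<in>exps n K - {\<alpha>0}. g \<gamma> * ?m (?sh \<gamma>))"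
        proof -
          have "?m \<beta>' * (\<Sum>\<gamma>\<in>exps n K. g \<gamma> * ?m \<gamma>) = (\<Sum>\<gamma>\<in>exps n K. g \<gamma> * ?m (?sh \<gamma>))"
            by (simp add: sum_distrib_left monomial_at_add mult_ac)
          also have "\<dots> = g \<alpha>0 * ?m (?sh \<alpha>0) + (\<Sum>\<gamma>\<in>exps n K - {\<alpha>0}. g \<gamma> * ?m (?sh \<gamma>))"
            by (rule sum.remove[OF finB \<alpha>0'])
          finally show ?thesis using sum_eq by simp
        qed
        have 2: "(\<Sum>\<gamma>\<in>exps n K - {\<alpha>0}. g \<gamma> * (?m (?sh \<gamma>) - (\<Sum>\<beta>\<in>R. c \<gamma> \<beta> * ?m \<beta>)))
            = (\<Sum>\<gamma>\<in>exps n K - {\<alpha>0}. g \<gamma> * ?m (?sh \<gamma>)) - (\<Sum>\<gamma>\<in>exps n K - {\<alpha>0}. \<Sum>\<beta>\<in>R. g \<gamma> * c \<gamma> \<beta> * ?m \<beta>)"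
          by (simp add: right_diff_distrib sum_subtractf sum_distrib_left mult.assoc)
        have 3: "(\<Sum>\<beta>\<in>R. c' \<beta> * ?m \<beta>) = - inverse (g \<alpha>0) * (\<Sum>\<gamma>\<in>exps n K - {\<alpha>0}. \<Sum>\<beta>\<in>R. g \<gamma> * c \<gamma> \<beta> * ?m \<beta>)"
        proof -
          have "(\<Sum>\<beta>\<in>R. c' \<beta> * ?m \<beta>) = (\<Sum>\<beta>\<in>R. \<Sum>\<gamma>\<in>exps n K - {\<alpha>0}. - inverse (g \<alpha>0) * (g \<gamma> * c \<gamma> \<beta> * ?m \<beta>))"
            by (rule sum.cong[OF refl])
              (simp add: c'_def sum_distrib_right sum_distrib_left sum_negf[symmetric] divide_inverse mult_ac)
          also have "\<dots> = (\<Sum>\<gamma>\<in>exps n K - {\<alpha>0}. \<Sum>\<beta>\<in>R. - inverse (g \<alpha>0) * (g \<gamma> * c \<gamma> \<beta> * ?m \<beta>))"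
            by (rule sum.swap)
          finally show ?thesis by (simp only: sum_distrib_left)
        qed
        show ?thesis unfolding 1 2 3 using \<alpha>0(1) by (simp add: field_simps)
      qed
      then have "vanishes_on Z n K (\<lambda>w. monomial_at n \<alpha> w - (\<Sum>\<beta>\<in>R. c' \<beta> * monomial_at n \<beta> w))"
        using vanishes_on_diff[OF v1 v2] by simp
      then show ?thesis by blast
    qed
  qed
  then show ?thesis by (simp add: R_def)
qed

text \<open>A vector that does not dominate \<open>\<alpha>0\<close> is below it in some coordinate
  \<open>i\<close>, which leaves \<open>\<alpha>0 i\<close> values there and \<open>K\<close> in
  each of the other \<open>n - 1\<close> coordinates. The missing power of \<open>K\<close> reflects
  the dimension of a hypersurface.\<close>

lemma card_residual_exponents:
  "card {\<beta> \<in> exps n K. \<not> (\<forall>i<n. \<alpha>0 i \<le> \<beta> i)} \<le> (\<Sum>i<n. \<alpha>0 i) * K ^ (n - 1)"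
proof -
  let ?S = "\<lambda>i j. if j = i then {..<\<alpha>0 i} else {..<K}"
  have "{\<beta> \<in> exps n K. \<not> (\<forall>i<n. \<alpha>0 i \<le> \<beta> i)} \<subseteq> (\<Union>i<n. expo_vecs n (?S i))"
  proof
    fix \<beta> assume "\<beta> \<in> {\<beta> \<in> exps n K. \<not> (\<forall>i<n. \<alpha>0 i \<le> \<beta> i)}"
    then obtain i where "\<beta> \<in> exps n K" "i < n" "\<beta> i < \<alpha>0 i" by (auto simp: not_le)
    then have "\<beta> \<in> expo_vecs n (?S i)" unfolding expo_vecs_def by auto
    then show "\<beta> \<in> (\<Union>i<n. expo_vecs n (?S i))" using \<open>i < n\<close> by blast
  qed
  then have "card {\<beta> \<in> exps n K. \<not> (\<forall>i<n. \<alpha>0 i \<le> \<beta> i)} \<le> card (\<Union>i<n. expo_vecs n (?S i))"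
    by (intro card_mono finite_UN_I finite_expo_vecs) auto
  also have "\<dots> \<le> (\<Sum>i<n. card (expo_vecs n (?S i)))" by (rule card_UN_le) simp
  also have "\<dots> = (\<Sum>i<n. \<alpha>0 i * K ^ (n - 1))"
  proof (rule sum.cong[OF refl])
    fix i assume i: "i \<in> {..<n}"
    have "card (expo_vecs n (?S i)) = (\<Prod>j<n. card (?S i j))" by (rule card_expo_vecs)
    also have "\<dots> = card (?S i i) * (\<Prod>j\<in>{..<n} - {i}. card (?S i j))"
      using i by (intro prod.remove) auto
    also have "(\<Prod>j\<in>{..<n} - {i}. card (?S i j)) = (\<Prod>j\<in>{..<n} - {i}. K)"
      by (rule prod.cong) auto
    also have "\<dots> = K ^ (n - 1)" using i by simp
    finally show "card (expo_vecs n (?S i)) = \<alpha>0 i * K ^ (n - 1)" by simp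
  qed
  finally show ?thesis by (simp add: sum_distrib_right)
qed

text \<open>Dimension count: modulo a nonzero power series and order \<open>K\<close> there are only \<open>O(K\<^sup>n\<^sup>-\<^sup>1)\<close> independent
  monomials, fewer than the \<open>q\<^sup>n\<close> coefficients at our disposal, even though \<open>K = M q\<close> exceeds the
  degree by a factor as large as we like.\<close>

lemma exists_high_order_polynomial:
  fixes g :: "(nat \<Rightarrow> nat) \<Rightarrow> complex"
  assumes n: "n \<ge> 1" and M: "M \<ge> 1"
    and g: "\<And>K. vanishes_on Z n K (\<lambda>w. \<Sum>\<gamma>\<in>exps n K. g \<gamma> * monomial_at n \<gamma> w)"
    and nz: "\<gamma>0 \<in> expo_vecs n (\<lambda>_. UNIV)" "g \<gamma>0 \<noteq> 0"
  shows "\<exists>q A. q \<ge> 1 \<and> (\<exists>\<alpha>\<in>exps n q. A \<alpha> \<noteq> 0) \<and>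
     vanishes_on Z n (M * q) (\<lambda>w. \<Sum>\<alpha>\<in>exps n q. A \<alpha> * monomial_at n \<alpha> w)"
proof -
  obtain W :: "(nat \<Rightarrow> nat) \<Rightarrow> nat" where W: "\<And>\<alpha>. W \<alpha> > 0" "\<And>\<alpha> \<beta>. W (\<lambda>i. \<alpha> i + \<beta> i) = W \<alpha> * W \<beta>"
    and inj: "\<And>\<alpha> \<beta>. \<alpha> \<in> expo_vecs n (\<lambda>_. UNIV) \<Longrightarrow> \<beta> \<in> expo_vecs n (\<lambda>_. UNIV) \<Longrightarrow> W \<alpha> = W \<beta> \<Longrightarrow> \<alpha> = \<beta>"
    using exists_monomial_weight[of n] by blast
  obtain \<alpha>0 where \<alpha>0: "\<alpha>0 \<in> expo_vecs n (\<lambda>_. UNIV)" "g \<alpha>0 \<noteq> 0"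
    and min: "\<And>\<gamma>. \<gamma> \<in> expo_vecs n (\<lambda>_. UNIV) \<Longrightarrow> g \<gamma> \<noteq> 0 \<Longrightarrow> W \<alpha>0 \<le> W \<gamma>"
    using ex_has_least_nat[of "\<lambda>\<gamma>. \<gamma> \<in> expo_vecs n (\<lambda>_. UNIV) \<and> g \<gamma> \<noteq> 0" \<gamma>0 W] nz by blast
  define d where "d = (\<Sum>i<n. \<alpha>0 i)"
  \<comment> \<open>The least \<open>q\<close> for which
    \<open>d * K^(n-1) = d * M^(n-1) * q^(n-1)\<close> stays below \<open>q^n\<close>. If
    \<open>g\<close> has a nonzero constant term, then \<open>d = 0\<close>, \<open>q = 1\<close>
    and \<open>A\<close> is a constant: the zero set avoids a neighbourhood of the origin.\<close>
  define q where "q = d * M ^ (n - 1) + 1"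
  define K where "K = M * q"
  define R where "R = {\<beta> \<in> exps n K. \<not> (\<forall>i<n. \<alpha>0 i \<le> \<beta> i)}"
  have finq: "finite (exps n q)" and finR: "finite R"
    using finite_expo_vecs[of n "\<lambda>_. {..<q}"] finite_expo_vecs[of n "\<lambda>_. {..<K}"] by (auto simp: R_def)
  have "q \<le> K" using M by (simp add: K_def)
  then have sub: "exps n q \<subseteq> exps n K" by (auto simp: expo_vecs_def intro: less_le_trans)
  have least: "W \<alpha>0 < W \<gamma>" if "\<gamma> \<in> exps n K" "g \<gamma> \<noteq> 0" "\<gamma> \<noteq> \<alpha>0" for \<gamma>
  proof -
    have "\<gamma> \<in> expo_vecs n (\<lambda>_. UNIV)" using that by (auto simp: expo_vecs_def)
    then show ?thesis using min[of \<gamma>] inj[of \<gamma> \<alpha>0] \<alpha>0 that by (metis le_neq_implies_less)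
  qed
  have "\<exists>c. vanishes_on Z n K (\<lambda>w. monomial_at n \<alpha> w - (\<Sum>\<beta>\<in>R. c \<beta> * monomial_at n \<beta> w))"
    if "\<alpha> \<in> exps n q" for \<alpha>
    unfolding R_def
  proof (rule reduce_monomial[where W = W and g = g])
    show "\<alpha>0 i = 0" if "i \<ge> n" for i using \<alpha>0(1) that by (auto simp: expo_vecs_def)
  qed (use W g \<alpha>0(2) least that sub in blast)+
  then have "\<forall>\<alpha>\<in>exps n q. \<exists>c. vanishes_on Z n K
      (\<lambda>w. monomial_at n \<alpha> w - (\<Sum>\<beta>\<in>R. c \<beta> * monomial_at n \<beta> w))"
    by (intro ballI)
  from bchoice[OF this] obtain c where c: "\<And>\<alpha>. \<alpha> \<in> exps n q \<Longrightarrow>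
      vanishes_on Z n K (\<lambda>w. monomial_at n \<alpha> w - (\<Sum>\<beta>\<in>R. c \<alpha> \<beta> * monomial_at n \<beta> w))" by blast
  have "card R < card (exps n q)"
  proof -
    have "card R \<le> d * K ^ (n - 1)" unfolding R_def d_def by (rule card_residual_exponents)
    also have "\<dots> = d * M ^ (n - 1) * q ^ (n - 1)" by (simp add: K_def power_mult_distrib)
    also have "\<dots> < q * q ^ (n - 1)" by (rule mult_strict_right_mono) (auto simp: q_def)
    also have "\<dots> = q ^ n" using n by (cases n) auto
    also have "\<dots> = card (exps n q)" by (simp add: card_expo_vecs)
    finally show ?thesis .
  qed
  \<comment> \<open>The unknowns are the coefficients of \<open>A\<close>; each residual monomial
    \<open>\<beta>\<close> gives the equation that its coefficient in the remainder of
    \<open>A\<close> be zero.\<close>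
  from homogeneous_system_nontrivial[OF finR finq this, of "\<lambda>\<beta> \<alpha>. c \<alpha> \<beta>"]
  obtain A where A: "\<exists>\<alpha>\<in>exps n q. A \<alpha> \<noteq> 0" "\<And>\<beta>. \<beta> \<in> R \<Longrightarrow> (\<Sum>\<alpha>\<in>exps n q. c \<alpha> \<beta> * A \<alpha>) = 0" by blast
  have "vanishes_on Z n K (\<lambda>w. \<Sum>\<alpha>\<in>exps n q. A \<alpha> * (monomial_at n \<alpha> w - (\<Sum>\<beta>\<in>R. c \<alpha> \<beta> * monomial_at n \<beta> w)))"
    by (intro vanishes_on_sum vanishes_on_cmult c)
  moreover have "(\<Sum>\<alpha>\<in>exps n q. A \<alpha> * (monomial_at n \<alpha> w - (\<Sum>\<beta>\<in>R. c \<alpha> \<beta> * monomial_at n \<beta> w)))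
      = (\<Sum>\<alpha>\<in>exps n q. A \<alpha> * monomial_at n \<alpha> w)" for w
  proof -
    have "(\<Sum>\<alpha>\<in>exps n q. A \<alpha> * (\<Sum>\<beta>\<in>R. c \<alpha> \<beta> * monomial_at n \<beta> w))
        = (\<Sum>\<beta>\<in>R. \<Sum>\<alpha>\<in>exps n q. A \<alpha> * (c \<alpha> \<beta> * monomial_at n \<beta> w))"
      unfolding sum_distrib_left by (rule sum.swap)
    also have "\<dots> = (\<Sum>\<beta>\<in>R. (\<Sum>\<alpha>\<in>exps n q. c \<alpha> \<beta> * A \<alpha>) * monomial_at n \<beta> w)"
      unfolding sum_distrib_right by (intro sum.cong refl) (simp add: mult_ac)
    also have "\<dots> = 0" by (rule sum.neutral) (use A in auto)
    finally show ?thesis by (simp add: right_diff_distrib sum_subtractf)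
  qed
  ultimately have "vanishes_on Z n K (\<lambda>w. \<Sum>\<alpha>\<in>exps n q. A \<alpha> * monomial_at n \<alpha> w)" by simp
  moreover have "q \<ge> 1" by (simp add: q_def)
  ultimately show ?thesis using A(1) unfolding K_def by blast
qed

lemma entire_taylor_remainder:
  fixes u :: "complex \<Rightarrow> complex"
  assumes u: "u holomorphic_on UNIV"
  obtains C where "\<And>w. cmod w \<le> 1 \<Longrightarrow>
     cmod (u w - (\<Sum>l<K. (deriv ^^ l) u 0 / fact l * w ^ l)) \<le> C * cmod w ^ K"
proof -
  define e where "e = (\<lambda>l. (deriv ^^ l) u 0 / fact l)"
  have sums: "(\<lambda>l. e l * w ^ l) sums u w" if "cmod w < 2" for w
    using holomorphic_power_series[of u 0 2 w] holomorphic_on_subset[OF u subset_UNIV] that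
    by (simp add: e_def)
  \<comment> \<open>Convergence at \<open>3/2\<close> gives absolute convergence at 1, so the tail
    sum of the moduli of the coefficients serves as \<open>C\<close>.\<close>
  have "summable (\<lambda>l. e l * (3/2) ^ l)" using sums[of "3/2"] by (auto simp: sums_iff)
  from powser_insidea[OF this, of 1] have sm: "summable (\<lambda>l. cmod (e l))" by simp
  then have smK: "summable (\<lambda>l. cmod (e (l + K)))" by (rule summable_ignore_initial_segment)
  have "cmod (u w - (\<Sum>l<K. e l * w ^ l)) \<le> (\<Sum>l. cmod (e (l + K))) * cmod w ^ K" if w: "cmod w \<le> 1" for w
  proof -
    have le: "cmod (e (l + K) * w ^ (l + K)) \<le> cmod (e (l + K)) * cmod w ^ K" for l
    proof -
      have "cmod w ^ (l + K) \<le> cmod w ^ K" using w by (intro power_decreasing) auto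
      then show ?thesis by (simp add: norm_mult norm_power mult_left_mono)
    qed
    have "(\<lambda>l. e (l + K) * w ^ (l + K)) sums (u w - (\<Sum>l<K. e l * w ^ l))"
      using sums_split_initial_segment[OF sums[of w], of K] w by simp
    then have "cmod (u w - (\<Sum>l<K. e l * w ^ l)) = cmod (\<Sum>l. e (l + K) * w ^ (l + K))"
      by (simp add: sums_iff)
    also have "\<dots> \<le> (\<Sum>l. cmod (e (l + K)) * cmod w ^ K)"
      by (rule norm_suminf_le[OF le]) (rule summable_mult2[OF smK])
    also have "\<dots> = (\<Sum>l. cmod (e (l + K))) * cmod w ^ K"
      by (rule suminf_mult2[OF smK, symmetric])
    finally show ?thesis .
  qed
  then show ?thesis using that unfolding e_def by blast
qed

section \<open>Relations between w and F(w)\<close>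

text \<open>A relation of positive degree \<open>B\<close> in \<open>F\<close> bounds
  \<open>|F|\<close> by a power of \<open>|w|\<close> for large \<open>|w|\<close>, as a root of a
  polynomial is bounded through its coefficients; Liouville's theorem for polynomial growth then
  makes \<open>F\<close> a polynomial.\<close>

lemma transcendental_powers_independent:
  fixes F :: "complex \<Rightarrow> complex" and c :: "nat \<times> nat \<Rightarrow> complex"
  assumes F: "transcendental_entire F"
    and zero: "\<And>w. (\<Sum>x\<in>{..<D} \<times> {..<D}. c x * (w ^ fst x * F w ^ snd x)) = 0"
  shows "\<forall>x\<in>{..<D} \<times> {..<D}. c x = 0"
proof (rule ccontr)
  assume "\<not> ?thesis"
  then obtain a1 b1 where ab: "a1 < D" "b1 < D" "c (a1, b1) \<noteq> 0" by auto
  define p where "p = (\<lambda>b. \<Sum>a<D. monom (c (a, b)) a)"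
  have poly_p: "poly (p b) w = (\<Sum>a<D. c (a, b) * w ^ a)" for b w
    by (simp add: p_def poly_sum poly_monom)
  have rel: "(\<Sum>b<D. poly (p b) w * F w ^ b) = 0" for w
  proof -
    have "(\<Sum>b<D. poly (p b) w * F w ^ b) = (\<Sum>b<D. \<Sum>a<D. c (a, b) * (w ^ a * F w ^ b))"
      by (simp add: poly_p sum_distrib_right mult.assoc)
    also have "\<dots> = (\<Sum>a<D. \<Sum>b<D. c (a, b) * (w ^ a * F w ^ b))" by (rule sum.swap)
    also have "\<dots> = (\<Sum>x\<in>{..<D} \<times> {..<D}. c x * (w ^ fst x * F w ^ snd x))"
      by (simp add: sum.cartesian_product case_prod_beta)
    finally show ?thesis using zero by simp
  qed
  have "coeff (p b1) a1 = c (a1, b1)"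
    using ab by (simp add: p_def coeff_sum coeff_monom sum.delta if_distrib cong: if_cong)
  then have pb1: "p b1 \<noteq> 0" using ab by auto
  define S where "S = {b. b < D \<and> p b \<noteq> 0}"
  define B where "B = Max S"
  have finS: "finite S" "S \<noteq> {}" using ab pb1 by (auto simp: S_def)
  have B: "B < D" "p B \<noteq> 0" using Max_in[OF finS] by (auto simp: B_def S_def)
  have pz: "p b = 0" if "b < D" "b > B" for b
  proof (rule ccontr)
    assume "p b \<noteq> 0"
    then have "b \<le> B" unfolding B_def using finS that by (intro Max_ge) (auto simp: S_def)
    then show False using that by simp
  qed
  have rel': "(\<Sum>b<B. poly (p b) w * F w ^ b) + poly (p B) w * F w ^ B = 0" for w
  proof -
    have "(\<Sum>b<D. poly (p b) w * F w ^ b) = (\<Sum>b<Suc B. poly (p b) w * F w ^ b)"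
      by (rule sum.mono_neutral_right) (use B pz in \<open>auto simp: not_less Suc_le_eq\<close>)
    then show ?thesis using rel[of w] by simp
  qed
  have "B \<noteq> 0"
  proof
    assume "B = 0"
    then have "poly (p B) w = 0" for w using rel'[of w] by simp
    then show False using B(2) poly_all_0_iff_0 by blast
  qed
  \<comment> \<open>The extra factor \<open>w\<close> makes the leading coefficient grow even if
    \<open>p B\<close> is constant; it costs one more power of \<open>|w|\<close> in the
    bound.\<close>
  obtain r where r: "\<And>w. r \<le> cmod w \<Longrightarrow> 1 \<le> cmod (poly (pCons 0 (p B)) w)"
    using poly_infinity[OF B(2), of 1 0] by blast
  define L where "L = (\<Sum>b<B. \<Sum>a<D. cmod (c (a, b)))"
  have L0: "L \<ge> 0" by (auto simp: L_def intro!: sum_nonneg)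
  have bound: "cmod (F w) \<le> (1 + L) * cmod w ^ (D + 1)" if w: "max 1 r \<le> cmod w" for w
  proof -
    have w1: "cmod w \<ge> 1" "cmod w \<ge> r" using w by auto
    have low: "1 \<le> cmod w * cmod (poly (p B) w)" using r[OF w1(2)] by (simp add: norm_mult)
    have pb: "cmod (poly (p b) w) \<le> (\<Sum>a<D. cmod (c (a, b))) * cmod w ^ D" for b
    proof -
      have "cmod (poly (p b) w) \<le> (\<Sum>a<D. cmod (c (a, b) * w ^ a))" unfolding poly_p by (rule norm_sum)
      also have "\<dots> \<le> (\<Sum>a<D. cmod (c (a, b)) * cmod w ^ D)"
        using w1 by (intro sum_mono) (auto simp: norm_mult norm_power intro!: mult_left_mono power_increasing)
      finally show ?thesis by (simp add: sum_distrib_right)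
    qed
    show ?thesis
    \<comment> \<open>When \<open>|F w| > 1\<close>, all powers of \<open>F w\<close> below the
      \<open>B\<close>-th are at most the \<open>(B - 1)\<close>-st in modulus, and the relation can
      be divided by that one.\<close>
    proof (cases "cmod (F w) \<le> 1")
      case True
      also have "1 \<le> (1 + L) * cmod w ^ (D + 1)"
        using L0 w1 mult_mono[of 1 "1 + L" 1 "cmod w ^ (D + 1)"] one_le_power[of "cmod w" "D + 1"] by simp
      finally show ?thesis .
    next
      case False
      then have F1: "cmod (F w) > 1" by simp
      have "poly (p B) w * F w ^ B = - (\<Sum>b<B. poly (p b) w * F w ^ b)"
        using rel'[of w] by (simp add: add_eq_0_iff)
      then have "cmod (poly (p B) w) * cmod (F w) ^ B = cmod (\<Sum>b<B. poly (p b) w * F w ^ b)"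
        by (metis norm_minus_cancel norm_mult norm_power)
      also have "\<dots> \<le> (\<Sum>b<B. cmod (poly (p b) w * F w ^ b))" by (rule norm_sum)
      also have "\<dots> \<le> (\<Sum>b<B. ((\<Sum>a<D. cmod (c (a, b))) * cmod w ^ D) * cmod (F w) ^ (B - 1))"
      proof (rule sum_mono)
        fix b assume "b \<in> {..<B}"
        then show "cmod (poly (p b) w * F w ^ b) \<le> ((\<Sum>a<D. cmod (c (a, b))) * cmod w ^ D) * cmod (F w) ^ (B - 1)"
          unfolding norm_mult norm_power using F1 pb
          by (intro mult_mono power_increasing) (auto intro!: mult_nonneg_nonneg sum_nonneg)
      qed
      also have "\<dots> = L * cmod w ^ D * cmod (F w) ^ (B - 1)"
        by (simp add: L_def sum_distrib_right)
      finally have *: "cmod (poly (p B) w) * cmod (F w) ^ B \<le> L * cmod w ^ D * cmod (F w) ^ (B - 1)" .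
      have FB: "cmod (F w) ^ B = cmod (F w) * cmod (F w) ^ (B - 1)" using \<open>B \<noteq> 0\<close> by (cases B) auto
      have "(cmod (poly (p B) w) * cmod (F w)) * cmod (F w) ^ (B - 1) \<le> (L * cmod w ^ D) * cmod (F w) ^ (B - 1)"
        using * by (simp add: FB mult_ac)
      moreover have "cmod (F w) ^ (B - 1) > 0" using F1 by (intro zero_less_power) linarith
      ultimately have **: "cmod (poly (p B) w) * cmod (F w) \<le> L * cmod w ^ D"
        by (rule mult_right_le_imp_le)
      have "cmod (F w) \<le> (cmod w * cmod (poly (p B) w)) * cmod (F w)"
        using mult_right_mono[OF low, of "cmod (F w)"] by simp
      also have "\<dots> = cmod w * (cmod (poly (p B) w) * cmod (F w))" by simp
      also have "\<dots> \<le> cmod w * (L * cmod w ^ D)" using ** by (rule mult_left_mono) simp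
      also have "\<dots> = L * cmod w ^ (D + 1)" by simp
      also have "\<dots> \<le> (1 + L) * cmod w ^ (D + 1)" by (intro mult_right_mono) auto
      finally show ?thesis .
    qed
  qed
  have "F holomorphic_on UNIV" using F by (simp add: transcendental_entire_def)
  from Liouville_polynomial[OF this bound]
  have eqF: "F \<xi> = (\<Sum>k\<le>D + 1. (deriv ^^ k) F 0 / fact k * \<xi> ^ k)" for \<xi> .
  have "F \<xi> = poly (\<Sum>k\<le>D + 1. monom ((deriv ^^ k) F 0 / fact k) k) \<xi>" for \<xi>
    by (subst eqF) (simp add: poly_sum poly_monom)
  then show False using F unfolding transcendental_entire_def by blast
qed

lemma prod_lessThan_add:
  fixes h :: "nat \<Rightarrow> 'a::comm_monoid_mult"
  shows "(\<Prod>i<n + m. h i) = (\<Prod>i<n. h i) * (\<Prod>i<m. h (n + i))"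
  by (induction m) (auto simp: mult.assoc)

definition join_exponents :: "nat \<Rightarrow> (nat \<Rightarrow> nat \<times> nat) \<Rightarrow> nat \<Rightarrow> nat" where
  "join_exponents n \<delta> j = (if j < n then fst (\<delta> j) else if j < 2 * n then snd (\<delta> (j - n)) else 0)"

text \<open>The \<open>2 * n\<close> exponents are regrouped by variable: \<open>\<delta> i\<close>
  holds the exponents of \<open>w i\<close> and of \<open>F (w i)\<close>. Each term becomes a
  product of functions of one variable, the shape needed for the tensor argument; \<open>D\<close>
  exceeds all exponents that occur.\<close>

lemma eval_poly_in_pairs:
  assumes P: "is_poly_in {..<2 * n} P"
  shows "\<exists>D. (\<forall>w F. eval_poly_in {..<2 * n} P (\<lambda>j. if j < n then w j else F (w (j - n))) =
       (\<Sum>\<delta>\<in>PiE {..<n} (\<lambda>_. {..<D} \<times> {..<D}).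
          P (join_exponents n \<delta>) * (\<Prod>i<n. w i ^ fst (\<delta> i) * F (w i) ^ snd (\<delta> i)))) \<and>
    (\<forall>\<gamma>. P \<gamma> \<noteq> 0 \<longrightarrow> (\<exists>\<delta>\<in>PiE {..<n} (\<lambda>_. {..<D} \<times> {..<D}). \<gamma> = join_exponents n \<delta>))"
proof -
  define S where "S = {\<gamma>. P \<gamma> \<noteq> 0}"
  have finS: "finite S" and supp: "\<And>\<gamma> i. P \<gamma> \<noteq> 0 \<Longrightarrow> i \<ge> 2 * n \<Longrightarrow> \<gamma> i = 0"
    using P by (auto simp: is_poly_in_def S_def)
  have "finite ((\<lambda>(\<gamma>, j). \<gamma> j) ` (S \<times> {..<2 * n}))" using finS by (intro finite_imageI finite_cartesian_product) auto
  then obtain D where "\<forall>k\<in>(\<lambda>(\<gamma>, j). \<gamma> j) ` (S \<times> {..<2 * n}). k < D"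
    using finite_nat_set_iff_bounded by blast
  then have D: "\<gamma> j < D" if "P \<gamma> \<noteq> 0" "j < 2 * n" for \<gamma> j using that by (auto simp: S_def)
  let ?J = "join_exponents n"
  let ?Pi = "PiE {..<n} (\<lambda>_. {..<D} \<times> {..<D})"
  have join_lo: "?J \<delta> i = fst (\<delta> i)" and join_hi: "?J \<delta> (n + i) = snd (\<delta> i)" if "i < n" for \<delta> i
    using that by (auto simp: join_exponents_def)
  have inj: "inj_on ?J ?Pi"
  proof (rule inj_onI)
    fix \<delta> \<delta>' assume *: "\<delta> \<in> ?Pi" "\<delta>' \<in> ?Pi" "?J \<delta> = ?J \<delta>'"
    have "\<delta> i = \<delta>' i" if "i < n" for i
      using join_lo[OF that, of \<delta>] join_lo[OF that, of \<delta>'] join_hi[OF that, of \<delta>] join_hi[OF that, of \<delta>'] *(3)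
      by (simp add: prod_eq_iff)
    then show "\<delta> = \<delta>'" by (intro PiE_ext[OF *(1,2)]) auto
  qed
  have ex: "\<exists>\<delta>\<in>?Pi. \<gamma> = ?J \<delta>" if \<gamma>: "P \<gamma> \<noteq> 0" for \<gamma>
  proof
    let ?d = "restrict (\<lambda>i. (\<gamma> i, \<gamma> (n + i))) {..<n}"
    show "?d \<in> ?Pi" using D[OF \<gamma>] by auto
    show "\<gamma> = ?J ?d"
    proof
      fix j
      show "\<gamma> j = ?J ?d j" using supp[OF \<gamma>, of j] by (auto simp: join_exponents_def)
    qed
  qed
  have fin: "finite ?Pi" by (intro finite_PiE) auto
  have "eval_poly_in {..<2 * n} P (\<lambda>j. if j < n then w j else F (w (j - n))) =
      (\<Sum>\<delta>\<in>?Pi. P (?J \<delta>) * (\<Prod>i<n. w i ^ fst (\<delta> i) * F (w i) ^ snd (\<delta> i)))" for w F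
  proof -
    let ?y = "\<lambda>j. if j < n then w j else F (w (j - n)) :: complex"
    have "eval_poly_in {..<2 * n} P ?y = (\<Sum>\<gamma>\<in>S. P \<gamma> * (\<Prod>i<2 * n. ?y i ^ \<gamma> i))"
      by (simp add: eval_poly_in_def S_def)
    also have "\<dots> = (\<Sum>\<gamma>\<in>?J ` ?Pi. P \<gamma> * (\<Prod>i<2 * n. ?y i ^ \<gamma> i))"
      by (rule sum.mono_neutral_left) (use fin ex in \<open>auto simp: S_def\<close>)
    also have "\<dots> = (\<Sum>\<delta>\<in>?Pi. P (?J \<delta>) * (\<Prod>i<2 * n. ?y i ^ ?J \<delta> i))"
      by (subst sum.reindex[OF inj]) simp
    also have "\<dots> = (\<Sum>\<delta>\<in>?Pi. P (?J \<delta>) * (\<Prod>i<n. w i ^ fst (\<delta> i) * F (w i) ^ snd (\<delta> i)))"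
    proof (rule sum.cong[OF refl])
      fix \<delta>
      have "(\<Prod>i<2 * n. ?y i ^ ?J \<delta> i) = (\<Prod>i<n. ?y i ^ ?J \<delta> i) * (\<Prod>i<n. ?y (n + i) ^ ?J \<delta> (n + i))"
        using prod_lessThan_add[of "\<lambda>i. ?y i ^ ?J \<delta> i" n n] by (simp add: mult_2)
      also have "\<dots> = (\<Prod>i<n. w i ^ fst (\<delta> i)) * (\<Prod>i<n. F (w i) ^ snd (\<delta> i))"
        by (intro arg_cong2[where f = "(*)"] prod.cong refl) (auto simp: join_lo join_hi)
      finally show "P (?J \<delta>) * (\<Prod>i<2 * n. ?y i ^ ?J \<delta> i) = P (?J \<delta>) * (\<Prod>i<n. w i ^ fst (\<delta> i) * F (w i) ^ snd (\<delta> i))"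
        by (simp add: prod.distrib)
    qed
    finally show ?thesis .
  qed
  then show ?thesis using ex by (intro exI[of _ D] conjI allI impI)
qed

text \<open>On the zero set of \<open>G\<close> its Taylor polynomials are \<open>O(s^K)\<close> for
  every \<open>K\<close>, since they differ from \<open>G = 0\<close> by remainders only. The Taylor
  coefficients \<open>g\<close> are tensor sums of those of \<open>w^a * F(w)^b\<close>, which are
  independent because \<open>F\<close> is transcendental; so some \<open>g \<gamma>0\<close> is
  nonzero and the dimension count applies.\<close>

lemma relation_high_order:
  assumes n: "n \<ge> 1" and M: "M \<ge> 1" and F: "transcendental_entire F"
    and P: "is_poly_in {..<2 * n} P" "P \<gamma>1 \<noteq> 0"
  shows "\<exists>q A. q \<ge> 1 \<and> (\<exists>\<alpha>\<in>exps n q. A \<alpha> \<noteq> 0) \<and>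
     vanishes_on {w. eval_poly_in {..<2 * n} P (\<lambda>j. if j < n then w j else F (w (j - n))) = 0}
       n (M * q) (\<lambda>w. \<Sum>\<alpha>\<in>exps n q. A \<alpha> * monomial_at n \<alpha> w)"
proof -
  define u where "u = (\<lambda>x w. w ^ fst x * F w ^ snd x)"
  define e where "e = (\<lambda>x l. (deriv ^^ l) (u x) 0 / fact l)"
  from eval_poly_in_pairs[OF P(1)] obtain D where
    D1: "\<forall>w F. eval_poly_in {..<2 * n} P (\<lambda>j. if j < n then w j else F (w (j - n))) =
       (\<Sum>\<delta>\<in>PiE {..<n} (\<lambda>_. {..<D} \<times> {..<D}).
          P (join_exponents n \<delta>) * (\<Prod>i<n. w i ^ fst (\<delta> i) * F (w i) ^ snd (\<delta> i)))"
    and D2: "\<forall>\<gamma>. P \<gamma> \<noteq> 0 \<longrightarrow> (\<exists>\<delta>\<in>PiE {..<n} (\<lambda>_. {..<D} \<times> {..<D}). \<gamma> = join_exponents n \<delta>)"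
    by (elim exE conjE)
  define X where "X = {..<D} \<times> {..<D}"
  define Pi' where "Pi' = PiE {..<n} (\<lambda>_. X)"
  define G where "G = (\<lambda>w. \<Sum>\<delta>\<in>Pi'. P (join_exponents n \<delta>) * (\<Prod>i<n. u (\<delta> i) (w i)))"
  define Z where "Z = {w. G w = 0}"
  have holF: "F holomorphic_on UNIV" using F by (simp add: transcendental_entire_def)
  have hol: "u x holomorphic_on UNIV" for x
    unfolding u_def by (intro holomorphic_intros holF)
  define g where "g = (\<lambda>\<alpha>. \<Sum>\<delta>\<in>Pi'. P (join_exponents n \<delta>) * (\<Prod>i<n. e (\<delta> i) (\<alpha> i)))"
  have approx: "vanishes_on Z n K (\<lambda>w. u x (w i) - (\<Sum>l<K. e x l * w i ^ l))" if i: "i < n" for x i K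
  proof -
    obtain C where C: "\<And>w. cmod w \<le> 1 \<Longrightarrow> cmod (u x w - (\<Sum>l<K. e x l * w ^ l)) \<le> C * cmod w ^ K"
      unfolding e_def using entire_taylor_remainder[OF hol] by blast
    show ?thesis
    proof (rule vanishes_onI[where C = "\<bar>C\<bar>"])
      fix w s assume "0 \<le> (s::real)" "s \<le> 1" "\<And>i. i < n \<Longrightarrow> cmod (w i) \<le> s"
      then have w: "cmod (w i) \<le> s" "cmod (w i) \<le> 1" using i by force+
      have "cmod (u x (w i) - (\<Sum>l<K. e x l * w i ^ l)) \<le> C * cmod (w i) ^ K" by (rule C[OF w(2)])
      also have "\<dots> \<le> \<bar>C\<bar> * s ^ K" using w by (intro mult_mono power_mono) auto
      finally show "cmod (u x (w i) - (\<Sum>l<K. e x l * w i ^ l)) \<le> \<bar>C\<bar> * s ^ K" .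
    qed
  qed
  have ub: "vanishes_on Z n 0 (\<lambda>w. u x (w i))" if "i < n" for x i
    using approx[OF that, of 0] by simp
  have gvan: "vanishes_on Z n K (\<lambda>w. \<Sum>\<gamma>\<in>exps n K. g \<gamma> * monomial_at n \<gamma> w)" for K
  proof -
    have 1: "vanishes_on Z n K (\<lambda>w. \<Sum>\<delta>\<in>Pi'. P (join_exponents n \<delta>) *
        ((\<Prod>i<n. u (\<delta> i) (w i)) - (\<Prod>i<n. \<Sum>l<K. e (\<delta> i) l * w i ^ l)))"
      by (intro vanishes_on_sum vanishes_on_cmult vanishes_on_prod_diff) (auto intro: ub approx bounded_on_power)
    have 2: "(\<Sum>\<delta>\<in>Pi'. P (join_exponents n \<delta>) * ((\<Prod>i<n. u (\<delta> i) (w i)) - (\<Prod>i<n. \<Sum>l<K. e (\<delta> i) l * w i ^ l)))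
        = G w - (\<Sum>\<gamma>\<in>exps n K. g \<gamma> * monomial_at n \<gamma> w)" for w
    proof -
      have "(\<Prod>i<n. \<Sum>l<K. e (\<delta> i) l * w i ^ l) = (\<Sum>\<alpha>\<in>exps n K. (\<Prod>i<n. e (\<delta> i) (\<alpha> i)) * monomial_at n \<alpha> w)" for \<delta>
        by (subst prod_sum_expo_vecs) (auto simp: prod.distrib monomial_at_def)
      then have "(\<Sum>\<delta>\<in>Pi'. P (join_exponents n \<delta>) * (\<Prod>i<n. \<Sum>l<K. e (\<delta> i) l * w i ^ l))
          = (\<Sum>\<delta>\<in>Pi'. \<Sum>\<alpha>\<in>exps n K. P (join_exponents n \<delta>) * (\<Prod>i<n. e (\<delta> i) (\<alpha> i)) * monomial_at n \<alpha> w)"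
        by (simp add: sum_distrib_left mult.assoc)
      also have "\<dots> = (\<Sum>\<alpha>\<in>exps n K. \<Sum>\<delta>\<in>Pi'. P (join_exponents n \<delta>) * (\<Prod>i<n. e (\<delta> i) (\<alpha> i)) * monomial_at n \<alpha> w)"
        by (rule sum.swap)
      finally show ?thesis
        by (simp add: G_def g_def right_diff_distrib sum_subtractf sum_distrib_right)
    qed
    show ?thesis
    proof -
      from vanishes_on_minus[OF 1[unfolded 2]]
      have "vanishes_on Z n K (\<lambda>w. (\<Sum>\<gamma>\<in>exps n K. g \<gamma> * monomial_at n \<gamma> w) - G w)" by simp
      then show ?thesis unfolding vanishes_on_def Z_def by simp
    qed
  qed
  have indep: "\<forall>x\<in>X. c x = 0" if c: "\<And>l. (\<Sum>x\<in>X. c x * e x l) = 0" for c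
    unfolding X_def
  proof (rule transcendental_powers_independent[OF F])
    fix w
    have "(\<lambda>l. e x l * w ^ l) sums u x w" for x
      using holomorphic_power_series[of "u x" 0 "cmod w + 1" w] holomorphic_on_subset[OF hol subset_UNIV]
      by (simp add: e_def)
    then have "(\<lambda>l. \<Sum>x\<in>X. c x * (e x l * w ^ l)) sums (\<Sum>x\<in>X. c x * u x w)"
      by (intro sums_sum sums_mult)
    moreover have "(\<Sum>x\<in>X. c x * (e x l * w ^ l)) = 0" for l
    proof -
      have "(\<Sum>x\<in>X. c x * (e x l * w ^ l)) = (\<Sum>x\<in>X. c x * e x l) * w ^ l"
        by (simp add: sum_distrib_right mult.assoc)
      then show ?thesis using c by simp
    qed
    ultimately have "(\<lambda>l. 0) sums (\<Sum>x\<in>X. c x * u x w)" by simp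
    then have "(\<Sum>x\<in>X. c x * u x w) = 0" using sums_unique2 sums_zero by blast
    then show "(\<Sum>x\<in>{..<D} \<times> {..<D}. c x * (w ^ fst x * F w ^ snd x)) = 0"
      by (simp add: X_def u_def)
  qed
  have "\<exists>\<gamma>0\<in>expo_vecs n (\<lambda>_. UNIV). g \<gamma>0 \<noteq> 0"
  proof (rule ccontr)
    assume "\<not> ?thesis"
    then have gz: "g \<alpha> = 0" if "\<alpha> \<in> expo_vecs n (\<lambda>_. UNIV)" for \<alpha> using that by blast
    have gall: "(\<Sum>\<delta>\<in>PiE {..<n} (\<lambda>_. X). P (join_exponents n \<delta>) * (\<Prod>i<n. e (\<delta> i) (\<alpha> i))) = 0" for \<alpha>
    proof -
      have "(\<Sum>\<delta>\<in>PiE {..<n} (\<lambda>_. X). P (join_exponents n \<delta>) * (\<Prod>i<n. e (\<delta> i) (\<alpha> i))) = g (\<lambda>i. if i < n then \<alpha> i else 0)"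
        unfolding g_def Pi'_def by (intro sum.cong refl arg_cong2[where f = "(*)"] prod.cong) auto
      also have "\<dots> = 0" by (rule gz) (auto simp: expo_vecs_def)
      finally show ?thesis .
    qed
    obtain \<delta> where \<delta>: "\<delta> \<in> PiE {..<n} (\<lambda>_. X)" "\<gamma>1 = join_exponents n \<delta>" using D2[rule_format, OF P(2)] unfolding X_def by blast
    have "P (join_exponents n \<delta>) = 0"
      by (rule tensor_independent[where a = "\<lambda>\<delta>. P (join_exponents n \<delta>)" and e = e and X = X and n = n])
        (use \<delta> gall indep in \<open>auto simp: X_def\<close>)
    then show False using P(2) \<delta> by simp
  qed
  then obtain \<gamma>0 where "\<gamma>0 \<in> expo_vecs n (\<lambda>_. UNIV)" "g \<gamma>0 \<noteq> 0" by blast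
  from exists_high_order_polynomial[OF n M gvan this]
  show ?thesis by (simp only: Z_def G_def Pi'_def X_def u_def D1[rule_format])
qed

section \<open>Proximity functions\<close>

lemma slice_holomorphic_monomial_sum:
  assumes f: "\<And>i. i < n \<Longrightarrow> slice_holomorphic (f i)"
  shows "slice_holomorphic (\<lambda>z. \<Sum>\<alpha>\<in>B. A \<alpha> * monomial_at n \<alpha> (\<lambda>i. f i z))"
proof -
  have "continuous_on UNIV (\<lambda>z. \<Sum>\<alpha>\<in>B. A \<alpha> * monomial_at n \<alpha> (\<lambda>i. f i z))"
    unfolding monomial_at_def using f by (auto simp: slice_holomorphic_def intro!: continuous_intros)
  moreover have "(\<lambda>\<zeta>. \<Sum>\<alpha>\<in>B. A \<alpha> * monomial_at n \<alpha> (\<lambda>i. f i (z + \<zeta> *s x))) holomorphic_on UNIV" for z x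
    unfolding monomial_at_def using f by (auto simp: slice_holomorphic_def intro!: holomorphic_intros)
  ultimately show ?thesis unfolding slice_holomorphic_def by blast
qed

section \<open>Elementary estimates for \<open>log^+\<close> and the pointwise bound\<close>

lemma log_plus_eq: "log_plus x = ln (max x 1)"
  by (simp add: log_plus_def max_def)

lemma log_plus_nonneg: "log_plus x \<ge> 0"
  by (simp add: log_plus_def)

lemma log_plus_measurable [measurable]: "log_plus \<in> borel_measurable borel"
  unfolding log_plus_eq[abs_def] by measurable

lemma exp_log_plus_ge: "x \<le> exp (log_plus x)"
  by (simp add: log_plus_def)

lemma log_plus_mult_le:
  assumes "x \<ge> 0" "y \<ge> 0"
  shows "log_plus (x * y) \<le> log_plus x + log_plus y"
proof (cases "x * y \<le> 1")
  case False
  then have pos: "x * y > 0" by simp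
  have "x * y \<le> exp (log_plus x) * exp (log_plus y)"
    using assms by (intro mult_mono exp_log_plus_ge) auto
  then have "ln (x * y) \<le> log_plus x + log_plus y"
    using pos by (metis exp_add exp_le_cancel_iff exp_ln)
  then show ?thesis using False by (simp add: log_plus_def)
qed (simp add: log_plus_def log_plus_nonneg add_nonneg_nonneg)

lemma ln_eq_log_plus_diff:
  assumes "x > 0" shows "ln x = log_plus x - log_plus (1 / x)"
proof (cases "x \<le> 1")
  case True
  then show ?thesis using assms by (cases "x = 1") (auto simp: log_plus_def ln_div)
next
  case False
  then show ?thesis by (simp add: log_plus_def)
qed

lemma monomial_sum_growth:
  assumes u: "u \<ge> 1" and w: "\<And>i. i < n \<Longrightarrow> cmod (w i) \<le> u"
  shows "cmod (\<Sum>\<alpha>\<in>exps n q. A \<alpha> * monomial_at n \<alpha> w) \<le> (\<Sum>\<alpha>\<in>exps n q. cmod (A \<alpha>)) * u ^ (n * q)"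
proof -
  have "cmod (monomial_at n \<alpha> w) \<le> u ^ (n * q)" if \<alpha>: "\<alpha> \<in> exps n q" for \<alpha>
  proof -
    have "cmod (monomial_at n \<alpha> w) = (\<Prod>i<n. cmod (w i) ^ \<alpha> i)"
      by (simp add: monomial_at_def prod_norm[symmetric] norm_power)
    also have "\<dots> \<le> (\<Prod>i<n. u ^ q)"
    proof (rule prod_mono)
      fix i assume i: "i \<in> {..<n}"
      have "cmod (w i) ^ \<alpha> i \<le> u ^ \<alpha> i" using w i by (intro power_mono) auto
      also have "\<dots> \<le> u ^ q" using u \<alpha> i by (intro power_increasing) (auto simp: expo_vecs_def less_imp_le)
      finally show "0 \<le> cmod (w i) ^ \<alpha> i \<and> cmod (w i) ^ \<alpha> i \<le> u ^ q" by simp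
    qed
    also have "\<dots> = u ^ (n * q)" by (simp add: power_mult[symmetric] mult.commute)
    finally show ?thesis .
  qed
  then have "(\<Sum>\<alpha>\<in>exps n q. cmod (A \<alpha> * monomial_at n \<alpha> w)) \<le> (\<Sum>\<alpha>\<in>exps n q. cmod (A \<alpha>) * u ^ (n * q))"
    by (intro sum_mono) (auto simp: norm_mult intro!: mult_left_mono)
  then show ?thesis using norm_sum[of "\<lambda>\<alpha>. A \<alpha> * monomial_at n \<alpha> w" "exps n q"]
    by (simp add: sum_distrib_right)
qed

text \<open>With \<open>u = |w\<^sub>0| exp \<rho>\<close> all \<open>|w\<^sub>i|\<close> are at most \<open>u\<close>; the two cases of the proof are \<open>u \<le> 1\<close>, where the
  vanishing order applies, and \<open>u > 1\<close>, where only the degree matters.\<close>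

lemma log_max_pointwise_bound:
  assumes van: "vanishes_on Z n K (\<lambda>w. \<Sum>\<alpha>\<in>exps n q. A \<alpha> * monomial_at n \<alpha> w)"
  obtains C where "\<And>w t. w \<in> Z \<Longrightarrow> w 0 \<noteq> 0 \<Longrightarrow> 0 < t \<Longrightarrow> t \<le> 1 \<Longrightarrow>
     ln (max (cmod (\<Sum>\<alpha>\<in>exps n q. A \<alpha> * monomial_at n \<alpha> w)) t)
       \<le> real (n * q) * log_plus (cmod (w 0)) + real (K + n * q) * (\<Sum>i<n. log_plus (cmod (w i / w 0)))
          + C - min (real K * log_plus (cmod (1 / w 0))) (- ln t)"
proof -
  obtain C0 where C0: "C0 \<ge> 0" "\<And>w s. w \<in> Z \<Longrightarrow> 0 \<le> s \<Longrightarrow> s \<le> 1 \<Longrightarrow> (\<And>i. i < n \<Longrightarrow> cmod (w i) \<le> s) \<Longrightarrow>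
      cmod (\<Sum>\<alpha>\<in>exps n q. A \<alpha> * monomial_at n \<alpha> w) \<le> C0 * s ^ K"
    using vanishes_onE[OF van] by blast
  define C1 where "C1 = 1 + C0 + (\<Sum>\<alpha>\<in>exps n q. cmod (A \<alpha>))"
  have S0: "(\<Sum>\<alpha>\<in>exps n q. cmod (A \<alpha>)) \<ge> 0" by (intro sum_nonneg) auto
  have C1: "C1 \<ge> 1" "C1 \<ge> C0" "C1 \<ge> (\<Sum>\<alpha>\<in>exps n q. cmod (A \<alpha>))" using C0(1) S0 by (auto simp: C1_def)
  show ?thesis
  proof (rule that[of "ln C1"])
    fix w t assume w: "w \<in> Z" "w 0 \<noteq> 0" and t: "0 < (t::real)" "t \<le> 1"
    define G where "G = cmod (\<Sum>\<alpha>\<in>exps n q. A \<alpha> * monomial_at n \<alpha> w)"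
    define \<rho> where "\<rho> = (\<Sum>i<n. log_plus (cmod (w i / w 0)))"
    define \<tau> where "\<tau> = log_plus (cmod (w 0))"
    define h where "h = log_plus (cmod (1 / w 0))"
    define L where "L = n * q"
    define u where "u = cmod (w 0) * exp \<rho>"
    have nn: "\<rho> \<ge> 0" "\<tau> \<ge> 0" "h \<ge> 0"
      by (auto simp: \<rho>_def \<tau>_def h_def log_plus_nonneg intro!: sum_nonneg)
    have u0: "u > 0" using w by (simp add: u_def)
    have wi: "cmod (w i) \<le> u" if "i < n" for i
    proof -
      have "log_plus (cmod (w i / w 0)) \<le> \<rho>"
        unfolding \<rho>_def using that by (intro member_le_sum) (auto simp: log_plus_nonneg)
      then have "cmod (w i / w 0) \<le> exp \<rho>"
        using exp_log_plus_ge[of "cmod (w i / w 0)"] by (meson exp_le_cancel_iff order_trans)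
      then show ?thesis using w by (simp add: u_def norm_divide field_simps)
    qed
    have lnu: "ln u = \<tau> - h + \<rho>"
      using w ln_eq_log_plus_diff[of "cmod (w 0)"] by (simp add: u_def ln_mult \<tau>_def h_def norm_divide)
    \<comment> \<open>\<open>\<tau>\<close> and \<open>h\<close> are the positive and negative parts
      of \<open>ln |w 0|\<close>, so one of them is zero.\<close>
    have th: "\<tau> = 0 \<or> h = 0"
      using w by (auto simp: \<tau>_def h_def log_plus_def norm_divide)
    have prods: "real L * \<tau> \<ge> 0" "real K * \<rho> \<ge> 0" "real L * \<rho> \<ge> 0" "real L * h \<ge> 0" "real K * h \<ge> 0" "ln C1 \<ge> 0"
      using nn C1 by auto
    \<comment> \<open>The gain \<open>K * h\<close> is capped at \<open>- ln t\<close>, since the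
      truncated logarithm cannot fall below \<open>ln t\<close>.\<close>
    have "ln (max G t) \<le> real L * \<tau> + real (K + L) * \<rho> + ln C1 - min (real K * h) (- ln t)"
    proof (cases "G \<le> t")
      case True
      have "ln (max G t) = ln t" using True by (simp add: max_def)
      then show ?thesis using prods by (simp add: distrib_right min_def)
    next
      case False
      then have G0: "G > 0" and mx: "max G t = G" using t by auto
      have goal: "ln G \<le> real L * \<tau> + real (K + L) * \<rho> + ln C1 - real K * h"
      proof (cases "u \<le> 1")
        case True
        have "G \<le> C0 * u ^ K" unfolding G_def by (rule C0(2)) (use w u0 True wi in auto)
        also have "\<dots> \<le> C1 * u ^ K" using C1 u0 by (intro mult_right_mono) auto
        finally have "ln G \<le> ln (C1 * u ^ K)" using G0 by (intro ln_mono) auto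
        also have "\<dots> = ln C1 + real K * (\<tau> - h + \<rho>)"
          using C1 u0 by (simp add: ln_mult ln_realpow lnu)
        finally have *: "ln G \<le> ln C1 + real K * (\<tau> - h + \<rho>)" .
        have "\<tau> = 0"
        proof -
          have "cmod (w 0) \<le> u" using nn(1) by (simp add: u_def mult_le_cancel_left1)
          then show ?thesis using True by (simp add: \<tau>_def log_plus_def)
        qed
        then show ?thesis using * prods by (simp add: algebra_simps)
      next
        case False
        have "G \<le> (\<Sum>\<alpha>\<in>exps n q. cmod (A \<alpha>)) * u ^ L"
          unfolding G_def L_def by (rule monomial_sum_growth) (use False wi in auto)
        also have "\<dots> \<le> C1 * u ^ L" using C1 u0 by (intro mult_right_mono) auto
        finally have "ln G \<le> ln (C1 * u ^ L)" using G0 by (intro ln_mono) auto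
        also have "\<dots> = ln C1 + real L * (\<tau> - h + \<rho>)"
          using C1 u0 by (simp add: ln_mult ln_realpow lnu)
        finally have *: "ln G \<le> ln C1 + real L * (\<tau> - h + \<rho>)" .
        have "ln u > 0" using False by simp
        \<comment> \<open>The vanishing order gives nothing here, but \<open>|w 0|\<close> can be
          small only if some ratio is large, so \<open>K * h\<close> is paid for by
          \<open>K * \<rho>\<close>. Together with \<open>n * q * \<rho>\<close> from the degree
          this explains the coefficient \<open>K + n * q\<close>.\<close>
        then have "h \<le> \<rho>" using lnu th nn by auto
        then have "real K * h \<le> real K * \<rho>" by (intro mult_left_mono) auto
        then show ?thesis using * prods by (simp add: algebra_simps)
      qed
      then show ?thesis unfolding mx by linarith
    qed
    then show "ln (max (cmod (\<Sum>\<alpha>\<in>exps n q. A \<alpha> * monomial_at n \<alpha> w)) t)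
       \<le> real (n * q) * log_plus (cmod (w 0)) + real (K + n * q) * (\<Sum>i<n. log_plus (cmod (w i / w 0)))
          + ln C1 - min (real K * log_plus (cmod (1 / w 0))) (- ln t)"
      unfolding G_def \<rho>_def \<tau>_def h_def L_def .
  qed
qed

section \<open>Integration over the sphere and removal of the truncation\<close>

lemma set_integral_le_of_truncations:
  fixes h :: "'a \<Rightarrow> real"
  assumes h: "set_integrable M B h" and nn: "\<And>x. h x \<ge> 0"
    and le: "\<And>b::nat. (LINT x : B | M. min (h x) (real b)) \<le> D"
  shows "(LINT x : B | M. h x) \<le> D"
proof (rule LIMSEQ_le_const2)
  have bm: "(\<lambda>x. indicator B x *\<^sub>R h x) \<in> borel_measurable M" using h by (auto simp: set_integrable_def)
  have eq: "indicator B x *\<^sub>R min (h x) (real b) = min (indicator B x *\<^sub>R h x) (real b)" for x b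
    by (auto simp: indicator_def)
  show "(\<lambda>b. LINT x : B | M. min (h x) (real b)) \<longlonglongrightarrow> (LINT x : B | M. h x)"
    unfolding set_lebesgue_integral_def eq
  proof (rule integral_dominated_convergence[where w = "\<lambda>x. indicator B x *\<^sub>R h x"])
    show "integrable M (\<lambda>x. indicator B x *\<^sub>R h x)" using h by (simp add: set_integrable_def)
    show "(\<lambda>x. min (indicator B x *\<^sub>R h x) (real b)) \<in> borel_measurable M" for b using bm by measurable
    show "AE x in M. (\<lambda>b. min (indicator B x *\<^sub>R h x) (real b)) \<longlonglongrightarrow> indicator B x *\<^sub>R h x"
    proof (rule AE_I2)
      fix x
      obtain b0 :: nat where b0: "indicator B x *\<^sub>R h x \<le> real b0" using real_arch_simple by blast
      have "min (indicator B x *\<^sub>R h x) (real b) = indicator B x *\<^sub>R h x" if "b \<ge> b0" for b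
        using b0 that by (intro min_absorb1) (meson of_nat_le_iff order_trans)
      then have "eventually (\<lambda>b. min (indicator B x *\<^sub>R h x) (real b) = indicator B x *\<^sub>R h x) sequentially"
        unfolding eventually_sequentially by blast
      then show "(\<lambda>b. min (indicator B x *\<^sub>R h x) (real b)) \<longlonglongrightarrow> indicator B x *\<^sub>R h x"
        by (rule tendsto_eventually)
    qed
    show "AE x in M. norm (min (indicator B x *\<^sub>R h x) (real b)) \<le> indicator B x *\<^sub>R h x" for b
      using nn by (intro AE_I2) (auto simp: indicator_def)
  qed (use bm in auto)
  show "\<exists>N. \<forall>b\<ge>N. (LINT x : B | M. min (h x) (real b)) \<le> D" using le by blast
qed

text \<open>Without integrability the proximity function of a quotient would be 0 by convention and
  useless as an upper bound. Integrability of \<open>log^+ |1/g|\<close> passes to all quotients,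
  since \<open>log^+\<close> of a product is at most the sum and \<open>log^+ |f|\<close> is bounded
  on the sphere.\<close>

lemma set_integrable_log_plus_quotient:
  fixes f g :: "complex ^ 'm::finite \<Rightarrow> complex"
  assumes f: "slice_holomorphic f" and g: "slice_holomorphic g"
    and int: "set_integrable lborel (ball 0 1) (\<lambda>x. log_plus (cmod (1 / g (r *\<^sub>R sgn x))))"
  shows "set_integrable lborel (ball 0 1) (\<lambda>x. log_plus (cmod (f (r *\<^sub>R sgn x) / g (r *\<^sub>R sgn x))))"
proof -
  have [measurable]: "f \<in> borel_measurable borel" "g \<in> borel_measurable borel"
    using f g by (auto simp: slice_holomorphic_def intro: borel_measurable_continuous_onI)
  have i1: "set_integrable lborel (ball 0 1) (\<lambda>x. log_max 1 f (r *\<^sub>R sgn x))"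
    by (rule set_integrable_log_max_sphere[OF f]) simp
  have "set_integrable lborel (ball 0 1) (\<lambda>x. log_max 1 f (r *\<^sub>R sgn x) + log_plus (cmod (1 / g (r *\<^sub>R sgn x))))"
    by (rule set_integral_add(1)[OF i1 int])
  then show ?thesis
    unfolding set_integrable_def
  proof (rule Bochner_Integration.integrable_bound)
    show "(\<lambda>x. indicator (ball 0 1) x *\<^sub>R log_plus (cmod (f (r *\<^sub>R sgn x) / g (r *\<^sub>R sgn x)))) \<in> borel_measurable lborel"
      unfolding real_scaleR_def by (intro borel_measurable_times borel_measurable_indicator) auto
    show "AE x in lborel. norm (indicator (ball 0 1) x *\<^sub>R log_plus (cmod (f (r *\<^sub>R sgn x) / g (r *\<^sub>R sgn x))))
        \<le> norm (indicator (ball 0 1) x *\<^sub>R (log_max 1 f (r *\<^sub>R sgn x) + log_plus (cmod (1 / g (r *\<^sub>R sgn x)))))"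
    proof (rule AE_I2)
      fix x :: "complex ^ 'm"
      have "log_plus (cmod (f (r *\<^sub>R sgn x) / g (r *\<^sub>R sgn x)))
          \<le> log_plus (cmod (f (r *\<^sub>R sgn x))) + log_plus (cmod (1 / g (r *\<^sub>R sgn x)))"
        using log_plus_mult_le[of "cmod (f (r *\<^sub>R sgn x))" "cmod (1 / g (r *\<^sub>R sgn x))"]
        by (simp add: norm_divide)
      then show "norm (indicator (ball 0 1) x *\<^sub>R log_plus (cmod (f (r *\<^sub>R sgn x) / g (r *\<^sub>R sgn x))))
        \<le> norm (indicator (ball 0 1) x *\<^sub>R (log_max 1 f (r *\<^sub>R sgn x) + log_plus (cmod (1 / g (r *\<^sub>R sgn x)))))"
        by (auto simp: indicator_def log_plus_eq_log_max[symmetric] log_plus_nonneg)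
    qed
  qed
qed

text \<open>The pointwise estimate is integrated over the sphere at truncation level
  \<open>t\<close> and compared with the lower Jensen bound for \<open>A(f)\<close>; then
  \<open>t\<close> tends to 0. A nonzero proximity function certifies that
  \<open>log^+ |1 / f 0|\<close> is integrable, as the integral of a nonintegrable function is
  0.\<close>

lemma high_order_proximity_bound:
  fixes f :: "nat \<Rightarrow> complex ^ 'm::finite \<Rightarrow> complex"
  assumes n: "n \<ge> 1" and f: "\<And>i. i < n \<Longrightarrow> slice_holomorphic (f i)"
    and nz: "\<not> (\<forall>z. f 0 z = 0)"
    and van: "vanishes_on Z n K (\<lambda>w. \<Sum>\<alpha>\<in>exps n q. A \<alpha> * monomial_at n \<alpha> w)"
    and Z: "\<And>z. (\<lambda>i. f i z) \<in> Z"
    and gnz: "(\<Sum>\<alpha>\<in>exps n q. A \<alpha> * monomial_at n \<alpha> (\<lambda>i. f i z1)) \<noteq> 0"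
  obtains C where "\<And>r. r \<ge> 1 \<Longrightarrow> prox r (\<lambda>z. 1 / f 0 z) \<noteq> 0 \<Longrightarrow>
     real K * prox r (\<lambda>z. 1 / f 0 z) \<le> real (n * q) * prox r (f 0)
       + real (K + n * q) * (\<Sum>i<n. prox r (\<lambda>z. f i z / f 0 z)) + C"
proof -
  define g where "g = (\<lambda>z. \<Sum>\<alpha>\<in>exps n q. A \<alpha> * monomial_at n \<alpha> (\<lambda>i. f i z))"
  have g: "slice_holomorphic g" unfolding g_def by (rule slice_holomorphic_monomial_sum[OF f])
  have g1: "g z1 \<noteq> 0" using gnz by (simp add: g_def)
  have f0: "slice_holomorphic (f 0)" using f n by simp
  have [measurable]: "f 0 \<in> borel_measurable borel"
    using f0 by (auto simp: slice_holomorphic_def intro: borel_measurable_continuous_onI)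
  obtain z0 where z0: "f 0 z0 \<noteq> 0" using nz by blast
  obtain C1 where C1: "\<And>w t. w \<in> Z \<Longrightarrow> w 0 \<noteq> 0 \<Longrightarrow> 0 < t \<Longrightarrow> t \<le> 1 \<Longrightarrow>
     ln (max (cmod (\<Sum>\<alpha>\<in>exps n q. A \<alpha> * monomial_at n \<alpha> w)) t)
       \<le> real (n * q) * log_plus (cmod (w 0)) + real (K + n * q) * (\<Sum>i<n. log_plus (cmod (w i / w 0)))
          + C1 - min (real K * log_plus (cmod (1 / w 0))) (- ln t)"
    using log_max_pointwise_bound[OF van] by blast
  obtain C2 where C2: "\<And>r t. r \<ge> 1 \<Longrightarrow> 0 < t \<Longrightarrow> t \<le> 1 \<Longrightarrow>
     - C2 \<le> (LINT x : ball 0 1 | lborel. log_max t g (r *\<^sub>R sgn x))"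
    using sphere_integral_log_max_lower[OF g g1] by blast
  define V where "V = measure lborel (ball (0 :: complex ^ 'm) 1)"
  have V: "V > 0" unfolding V_def by (rule content_ball_pos) simp
  have "real K * prox r (\<lambda>z. 1 / f 0 z) \<le> real (n * q) * prox r (f 0)
       + real (K + n * q) * (\<Sum>i<n. prox r (\<lambda>z. f i z / f 0 z)) + (C1 + C2 / V)"
    if r: "r \<ge> 1" and pnz: "prox r (\<lambda>z. 1 / f 0 z) \<noteq> 0" for r
  proof -
    let ?J = "\<lambda>h. LINT x : ball (0 :: complex ^ 'm) 1 | lborel. h x"
    let ?I = "\<lambda>h. set_integrable lborel (ball (0 :: complex ^ 'm) 1) h"
    define h where "h = (\<lambda>x. log_plus (cmod (1 / f 0 (r *\<^sub>R sgn x))))"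
    define \<tau> where "\<tau> = (\<lambda>x. log_plus (cmod (f 0 (r *\<^sub>R sgn x))))"
    define \<rho> where "\<rho> = (\<lambda>i x. log_plus (cmod (f i (r *\<^sub>R sgn x) / f 0 (r *\<^sub>R sgn x))))"
    have prox_h: "prox r (\<lambda>z. 1 / f 0 z) = ?J h / V" and prox_\<tau>: "prox r (f 0) = ?J \<tau> / V"
      and prox_\<rho>: "prox r (\<lambda>z. f i z / f 0 z) = ?J (\<rho> i) / V" for i
      by (simp_all add: prox_def sphere_avg_def h_def \<tau>_def \<rho>_def V_def)
    have Ih: "?I h"
    proof (rule ccontr)
      assume "\<not> ?I h"
      then have "?J h = 0"
        unfolding set_integrable_def set_lebesgue_integral_def by (rule not_integrable_integral_eq)
      then show False using pnz prox_h by simp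
    qed
    have I\<tau>: "?I \<tau>"
      using set_integrable_log_max_sphere[OF f0, of 1 0 1 r] by (simp add: \<tau>_def log_plus_eq_log_max)
    have I\<rho>: "?I (\<rho> i)" if "i < n" for i
      unfolding \<rho>_def by (rule set_integrable_log_plus_quotient[OF f[OF that] f0]) (use Ih in \<open>simp add: h_def\<close>)
    have I\<rho>s: "?I (\<lambda>x. \<Sum>i<n. \<rho> i x)" and J\<rho>s: "?J (\<lambda>x. \<Sum>i<n. \<rho> i x) = (\<Sum>i<n. ?J (\<rho> i))"
    proof -
      show "?I (\<lambda>x. \<Sum>i<n. \<rho> i x)"
        unfolding set_integrable_def scaleR_sum_right
        by (rule Bochner_Integration.integrable_sum) (use I\<rho> in \<open>auto simp: set_integrable_def\<close>)
      show "?J (\<lambda>x. \<Sum>i<n. \<rho> i x) = (\<Sum>i<n. ?J (\<rho> i))"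
        unfolding set_lebesgue_integral_def scaleR_sum_right
        by (rule Bochner_Integration.integral_sum) (use I\<rho> in \<open>auto simp: set_integrable_def\<close>)
    qed
    have Ic: "?I (\<lambda>x. C1)" by (rule set_integrable_bounded) auto
    have hm: "h \<in> borel_measurable borel" unfolding h_def by measurable
    have hnn: "h x \<ge> 0" for x by (simp add: h_def log_plus_nonneg)
    define E where "E = (\<lambda>x. real (n * q) * \<tau> x + real (K + n * q) * (\<Sum>i<n. \<rho> i x) + C1)"
    have IE: "?I E" unfolding E_def
      by (intro set_integral_add(1) set_integrable_mult_right I\<tau> I\<rho>s Ic)
    have JE: "?J E = real (n * q) * ?J \<tau> + real (K + n * q) * (\<Sum>i<n. ?J (\<rho> i)) + V * C1"
    proof -
      have "?J E = ?J (\<lambda>x. real (n * q) * \<tau> x + real (K + n * q) * (\<Sum>i<n. \<rho> i x)) + ?J (\<lambda>x. C1)"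
        unfolding E_def by (intro set_integral_add(2) set_integral_add(1) set_integrable_mult_right I\<tau> I\<rho>s Ic)
      also have "?J (\<lambda>x. real (n * q) * \<tau> x + real (K + n * q) * (\<Sum>i<n. \<rho> i x))
          = ?J (\<lambda>x. real (n * q) * \<tau> x) + ?J (\<lambda>x. real (K + n * q) * (\<Sum>i<n. \<rho> i x))"
        by (intro set_integral_add(2) set_integrable_mult_right I\<tau> I\<rho>s)
      finally show ?thesis unfolding set_integral_mult_right J\<rho>s set_integral_const_ball V_def .
    qed
    have trunc: "?J (\<lambda>x. min (real K * h x) (real b)) \<le> ?J E + C2" for b :: nat
    proof -
      \<comment> \<open>At this level the cap \<open>- ln t\<close> is exactly \<open>b\<close>,
        while \<open>C2\<close> does not depend on \<open>b\<close>.\<close>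
      define t where "t = exp (- real b)"
      have t: "0 < t" "t \<le> 1" by (auto simp: t_def)
      have Im: "?I (\<lambda>x. min (real K * h x) (real b))"
      proof (rule set_integrable_bounded[where B = "real b"])
        show "(\<lambda>x. min (real K * h x) (real b)) \<in> borel_measurable borel" using hm by measurable
        show "\<bar>min (real K * h x) (real b)\<bar> \<le> real b" for x
          using hnn[of x] by (simp add: abs_le_iff min_def)
      qed
      have Ig: "?I (\<lambda>x. log_max t g (r *\<^sub>R sgn x))"
        by (rule set_integrable_log_max_sphere[OF g t(1)])
      have "- C2 \<le> ?J (\<lambda>x. log_max t g (r *\<^sub>R sgn x))" by (rule C2[OF r t])
      also have "\<dots> \<le> ?J (\<lambda>x. E x - min (real K * h x) (real b))"
        unfolding set_lebesgue_integral_def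
      proof (rule integral_mono_AE)
        show "integrable lborel (\<lambda>x. indicator (ball 0 1) x *\<^sub>R log_max t g (r *\<^sub>R sgn x))"
          using Ig by (simp add: set_integrable_def)
        show "integrable lborel (\<lambda>x. indicator (ball 0 1) x *\<^sub>R (E x - min (real K * h x) (real b)))"
          using set_integral_diff(1)[OF IE Im] by (simp add: set_integrable_def)
        \<comment> \<open>The pointwise bound divides by \<open>f 0\<close>, whose zeros on the
          sphere form a null set.\<close>
        have "AE x in lborel. x \<in> ball 0 1 \<longrightarrow> f 0 (r *\<^sub>R sgn x) \<noteq> 0"
          by (rule AE_sphere_nonzero[OF f0 z0 r])
        then show "AE x in lborel. indicator (ball 0 1) x *\<^sub>R log_max t g (r *\<^sub>R sgn x)
            \<le> indicator (ball 0 1) x *\<^sub>R (E x - min (real K * h x) (real b))"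
        proof eventually_elim
          case (elim x)
          show ?case
          proof (cases "x \<in> ball 0 1")
            case True
            have "log_max t g (r *\<^sub>R sgn x) \<le> E x - min (real K * h x) (- ln t)"
              using C1[OF Z _ t, of "r *\<^sub>R sgn x"] elim True
              unfolding log_max_def g_def E_def \<tau>_def \<rho>_def h_def by auto
            then show ?thesis using True by (simp add: t_def)
          qed simp
        qed
      qed
      also have "\<dots> = ?J E - ?J (\<lambda>x. min (real K * h x) (real b))"
        by (rule set_integral_diff(2)[OF IE Im])
      finally show ?thesis by simp
    qed
    have "?J (\<lambda>x. real K * h x) \<le> ?J E + C2"
      by (rule set_integral_le_of_truncations[OF _ _ trunc]) (use Ih hnn in auto)
    then have "real K * ?J h \<le> real (n * q) * ?J \<tau> + real (K + n * q) * (\<Sum>i<n. ?J (\<rho> i)) + V * C1 + C2"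
      unfolding set_integral_mult_right JE .
    then have "(real K * ?J h) / V \<le> (real (n * q) * ?J \<tau> + real (K + n * q) * (\<Sum>i<n. ?J (\<rho> i)) + V * C1 + C2) / V"
      using V by (intro divide_right_mono) auto
    then show ?thesis
      using V unfolding prox_h prox_\<tau> prox_\<rho> by (simp add: add_divide_distrib sum_divide_distrib[symmetric])
  qed
  then show ?thesis by (rule that)
qed

section \<open>Exceptional sets, deficiency and the comparison at one radius\<close>

lemma ex_large_not_in_finite_measure:
  assumes "E \<in> sets lborel" "emeasure lborel E < \<infinity>"
  shows "\<exists>r\<ge>R. r \<notin> (E :: real set)"
proof (rule ccontr)
  assume "\<not> ?thesis"
  then have sub: "{R..} \<subseteq> E" by auto
  obtain c where c: "emeasure lborel E = ennreal c" "c \<ge> 0"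
    using assms(2) by (cases "emeasure lborel E") auto
  have "ennreal (c + 1) = emeasure lborel {R..R + (c + 1)}" using c(2) by simp
  also have "\<dots> \<le> emeasure lborel E" using sub assms(1) by (intro emeasure_mono) auto
  finally show False using c by (simp add: ennreal_le_iff)
qed

lemma alg_indep_monomial_sum_nonzero:
  assumes indep: "alg_indep {..<n} f" and A: "\<alpha> \<in> exps n q" "A \<alpha> \<noteq> 0"
  shows "\<exists>z. (\<Sum>\<alpha>\<in>exps n q. A \<alpha> * monomial_at n \<alpha> (\<lambda>i. f i z)) \<noteq> 0"
proof (rule ccontr)
  assume "\<not> ?thesis"
  then have zero: "(\<Sum>\<alpha>\<in>exps n q. A \<alpha> * monomial_at n \<alpha> (\<lambda>i. f i z)) = 0" for z by blast
  define P where "P = (\<lambda>\<alpha>. if \<alpha> \<in> exps n q then A \<alpha> else 0)"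
  have fin: "finite (exps n q)" by (rule finite_expo_vecs) auto
  have "is_poly_in {..<n} P"
    unfolding is_poly_in_def
  proof
    show "finite {\<alpha>. P \<alpha> \<noteq> 0}" by (rule finite_subset[OF _ fin]) (auto simp: P_def)
    show "\<forall>\<alpha>. P \<alpha> \<noteq> 0 \<longrightarrow> (\<forall>i. i \<notin> {..<n} \<longrightarrow> \<alpha> i = 0)"
      by (auto simp: P_def expo_vecs_def split: if_splits)
  qed
  moreover have "eval_poly_in {..<n} P (\<lambda>i. f i z) = 0" for z
  proof -
    have "eval_poly_in {..<n} P (\<lambda>i. f i z) = (\<Sum>\<alpha>\<in>exps n q. P \<alpha> * monomial_at n \<alpha> (\<lambda>i. f i z))"
      unfolding eval_poly_in_def monomial_at_def
      by (rule sum.mono_neutral_left[OF fin]) (auto simp: P_def)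
    also have "\<dots> = (\<Sum>\<alpha>\<in>exps n q. A \<alpha> * monomial_at n \<alpha> (\<lambda>i. f i z))"
      by (rule sum.cong) (auto simp: P_def)
    finally show ?thesis using zero by simp
  qed
  ultimately have "P \<alpha> = 0" using indep unfolding alg_indep_def by blast
  then show False using A by (simp add: P_def)
qed

lemma small_wrt_common_exceptional_set:
  fixes Q :: "nat \<Rightarrow> real \<Rightarrow> real"
  assumes "\<And>i. i < n \<Longrightarrow> small_wrt (Q i) T"
  obtains E where "E \<in> sets lborel" "emeasure lborel E < \<infinity>"
    "\<And>\<epsilon>. \<epsilon> > 0 \<Longrightarrow> \<exists>R. \<forall>r\<ge>R. r \<notin> E \<longrightarrow> (\<forall>i<n. \<bar>Q i r\<bar> \<le> \<epsilon> * T r)"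
proof -
  have "\<forall>i\<in>{..<n}. \<exists>E. E \<in> sets lborel \<and> emeasure lborel E < \<infinity> \<and>
        (\<forall>\<epsilon>>0. \<exists>R. \<forall>r\<ge>R. r \<notin> E \<longrightarrow> \<bar>Q i r\<bar> \<le> \<epsilon> * T r)"
    using assms unfolding small_wrt_def by blast
  from bchoice[OF this] obtain E where E: "\<And>i. i < n \<Longrightarrow> E i \<in> sets lborel"
    "\<And>i. i < n \<Longrightarrow> emeasure lborel (E i) < \<infinity>"
    "\<And>i \<epsilon>. i < n \<Longrightarrow> \<epsilon> > 0 \<Longrightarrow> \<exists>R. \<forall>r\<ge>R. r \<notin> E i \<longrightarrow> \<bar>Q i r\<bar> \<le> \<epsilon> * T r"
    by blast
  show ?thesis
  proof (rule that[of "\<Union>i<n. E i"])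
    show "(\<Union>i<n. E i) \<in> sets lborel" using E(1) by (intro sets.finite_UN) auto
    have "emeasure lborel (\<Union>i<n. E i) \<le> (\<Sum>i<n. emeasure lborel (E i))"
      using E(1) by (intro emeasure_subadditive_finite) auto
    also have "\<dots> < \<infinity>" using E(2) by simp
    finally show "emeasure lborel (\<Union>i<n. E i) < \<infinity>" .
    fix \<epsilon> :: real assume "\<epsilon> > 0"
    then have "\<forall>i\<in>{..<n}. \<exists>R. \<forall>r\<ge>R. r \<notin> E i \<longrightarrow> \<bar>Q i r\<bar> \<le> \<epsilon> * T r" using E(3) by blast
    from bchoice[OF this] obtain R where R: "\<And>i r. i < n \<Longrightarrow> r \<ge> R i \<Longrightarrow> r \<notin> E i \<Longrightarrow> \<bar>Q i r\<bar> \<le> \<epsilon> * T r" by blast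
    have "R i \<le> (\<Sum>i<n. \<bar>R i\<bar>)" if "i < n" for i
      using member_le_sum[of i "{..<n}" "\<lambda>i. \<bar>R i\<bar>"] that by simp
    then show "\<exists>R. \<forall>r\<ge>R. r \<notin> (\<Union>i<n. E i) \<longrightarrow> (\<forall>i<n. \<bar>Q i r\<bar> \<le> \<epsilon> * T r)"
      using R by (intro exI[of _ "\<Sum>i<n. \<bar>R i\<bar>"]) (meson UN_I lessThan_iff order_trans)
  qed
qed

lemma prox_nonneg: "prox r f \<ge> 0"
  unfolding prox_def sphere_avg_def set_lebesgue_integral_def
  by (intro divide_nonneg_nonneg integral_nonneg) (auto simp: log_plus_nonneg indicator_def)

text \<open>Besides the linear lower bound, positive deficiency yields that the proximity function
  of \<open>1 / f\<close> is eventually nonzero, which is the certificate of integrability.\<close>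

lemma deficiency_zero_pos:
  assumes "deficiency 0 f > 0"
  obtains \<delta> where "\<delta> > 0" "eventually (\<lambda>r. prox r (\<lambda>z. 1 / f z) \<noteq> 0 \<and> \<delta> * prox r f \<le> prox r (\<lambda>z. 1 / f z)) at_top"
proof -
  obtain d where d: "ereal 0 < d" "d < deficiency 0 f" using assms dense by (metis zero_ereal_def)
  then obtain \<delta> where \<delta>: "d = ereal \<delta>" "\<delta> > 0" by (cases d) auto
  have "eventually (\<lambda>r. ereal \<delta> < ereal (prox r (\<lambda>z. 1 / (f z - 0)) / char_entire r f)) at_top"
    using d(2) unfolding deficiency_def \<delta>(1) by (rule less_LiminfD)
  then have "eventually (\<lambda>r. prox r (\<lambda>z. 1 / f z) \<noteq> 0 \<and> \<delta> * prox r f \<le> prox r (\<lambda>z. 1 / f z)) at_top"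
  proof eventually_elim
    case (elim r)
    then have q: "\<delta> < prox r (\<lambda>z. 1 / f z) / prox r f" by (simp add: char_entire_def)
    \<comment> \<open>Division by 0 yields 0, so a ratio above \<open>\<delta> > 0\<close> excludes
      a zero denominator.\<close>
    then have "prox r f \<noteq> 0" using \<delta>(2) by auto
    then have "prox r f > 0" using prox_nonneg[of r f] by simp
    then have "\<delta> * prox r f > 0" "\<delta> * prox r f < prox r (\<lambda>z. 1 / f z)"
      using q \<delta>(2) by (auto simp: pos_less_divide_eq)
    then show ?case by linarith
  qed
  then show ?thesis using that \<delta>(2) by blast
qed

theorem mainTheorem3:
  fixes f :: "nat \<Rightarrow> complex ^ 'm::finite \<Rightarrow> complex" and n :: nat
  assumes "n \<ge> 1"
    and "\<And>i. i < n \<Longrightarrow> entire_Cm (f i)"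
    and "\<And>i. i < n \<Longrightarrow> \<not> (\<exists>c. \<forall>z. f i z = c)"
    and "\<And>i. i < n \<Longrightarrow>
           small_wrt (\<lambda>r. prox r (\<lambda>z. f i z / f 0 z)) (\<lambda>r. char_entire r (f 0))"
    and "alg_indep {..<n} f"
    and "deficiency 0 (f 0) > 0"
  shows "\<forall>F. transcendental_entire F \<longrightarrow>
           trdeg_gen (2 * n) (\<lambda>j. if j < n then f j else F \<circ> f (j - n)) = 2 * n"
proof (intro allI impI)
  fix F assume F: "transcendental_entire F"
  let ?g = "\<lambda>j. if j < n then f j else F \<circ> f (j - n)"
  have f: "slice_holomorphic (f i)" if "i < n" for i
    using assms(2)[OF that] by (rule entire_Cm_imp_slice_holomorphic)
  have nc0: "\<not> (\<exists>c. \<forall>z. f 0 z = c)" using assms(1,3) by simp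
  have indep: "alg_indep {..<2 * n} ?g"
  proof (rule ccontr)
    assume "\<not> alg_indep {..<2 * n} ?g"
    then obtain P \<gamma> where P: "is_poly_in {..<2 * n} P" "P \<gamma> \<noteq> 0"
      and rel: "\<And>z. eval_poly_in {..<2 * n} P (\<lambda>i. ?g i z) = 0"
      unfolding alg_indep_def by auto
    obtain \<delta> where \<delta>: "\<delta> > 0"
      and ev: "eventually (\<lambda>r. prox r (\<lambda>z. 1 / f 0 z) \<noteq> 0 \<and> \<delta> * prox r (f 0) \<le> prox r (\<lambda>z. 1 / f 0 z)) at_top"
      using deficiency_zero_pos[OF assms(6)] by blast
    \<comment> \<open>In \<open>n + 2\<close> the summand \<open>n\<close> pays for the degree term
      \<open>n * q * T\<close>, one unit for the error terms with
      \<open>m(r, f\<^sub>i/f\<^sub>0)\<close>, and one for the additive constant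
      \<open>C\<close>.\<close>
    obtain M :: nat where M: "real M \<ge> (real n + 2) / \<delta>" using real_arch_simple by blast
    have Md: "real M * \<delta> \<ge> real n + 2" using M \<delta> by (simp add: field_simps)
    then have M1: "M \<ge> 1" by (cases M) auto
    define Z where "Z = {w. eval_poly_in {..<2 * n} P (\<lambda>j. if j < n then w j else F (w (j - n))) = 0}"
    obtain q A \<alpha> where q: "q \<ge> 1" and A: "\<alpha> \<in> exps n q" "A \<alpha> \<noteq> 0"
      and van: "vanishes_on Z n (M * q) (\<lambda>w. \<Sum>\<alpha>\<in>exps n q. A \<alpha> * monomial_at n \<alpha> w)"
      using relation_high_order[OF assms(1) M1 F P] unfolding Z_def by blast
    have Z: "(\<lambda>i. f i z) \<in> Z" for z
    proof -
      have "(\<lambda>i. ?g i z) = (\<lambda>j. if j < n then f j z else F (f (j - n) z))" by auto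
      then show ?thesis using rel[of z] by (simp add: Z_def)
    qed
    obtain z1 where z1: "(\<Sum>\<alpha>\<in>exps n q. A \<alpha> * monomial_at n \<alpha> (\<lambda>i. f i z1)) \<noteq> 0"
      using alg_indep_monomial_sum_nonzero[where A = A, OF assms(5) A] by blast
    have nz: "\<not> (\<forall>z. f 0 z = 0)" using nc0 by blast
    define K where "K = M * q"
    define B where "B = real (K + n * q)"
    obtain C where C: "\<And>r. r \<ge> 1 \<Longrightarrow> prox r (\<lambda>z. 1 / f 0 z) \<noteq> 0 \<Longrightarrow>
       real K * prox r (\<lambda>z. 1 / f 0 z) \<le> real (n * q) * prox r (f 0)
         + B * (\<Sum>i<n. prox r (\<lambda>z. f i z / f 0 z)) + C"
      using high_order_proximity_bound[OF assms(1) f nz van Z z1] unfolding K_def B_def by blast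
    obtain E where E: "E \<in> sets lborel" "emeasure lborel E < \<infinity>"
      "\<And>\<epsilon>. \<epsilon> > 0 \<Longrightarrow> \<exists>R. \<forall>r\<ge>R. r \<notin> E \<longrightarrow> (\<forall>i<n. \<bar>prox r (\<lambda>z. f i z / f 0 z)\<bar> \<le> \<epsilon> * char_entire r (f 0))"
      using small_wrt_common_exceptional_set[where Q = "\<lambda>i r. prox r (\<lambda>z. f i z / f 0 z)", OF assms(4)] by blast
    have B: "B > 0" unfolding B_def K_def of_nat_0_less_iff using q M1 by simp
    have n0: "real n > 0" using assms(1) by simp
    \<comment> \<open>The \<open>n\<close> error terms, multiplied by \<open>B\<close>, then add up
      to at most \<open>T\<close>. Since \<open>B\<close> depends on \<open>q\<close>, the choice
      comes after that of \<open>A\<close>.\<close>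
    define \<epsilon> where "\<epsilon> = 1 / (B * real n)"
    have \<epsilon>: "\<epsilon> > 0" using B n0 by (simp add: \<epsilon>_def)
    obtain R1 where R1: "\<And>r i. r \<ge> R1 \<Longrightarrow> r \<notin> E \<Longrightarrow> i < n \<Longrightarrow> \<bar>prox r (\<lambda>z. f i z / f 0 z)\<bar> \<le> \<epsilon> * prox r (f 0)"
      using E(3)[OF \<epsilon>] unfolding char_entire_def by auto
    have "eventually (\<lambda>r. prox r (f 0) \<ge> \<bar>C\<bar> + 1) at_top"
      using prox_tends_to_infinity[OF f nc0] assms(1) by (auto simp: filterlim_at_top)
    with ev have "eventually (\<lambda>r. (prox r (\<lambda>z. 1 / f 0 z) \<noteq> 0 \<and> \<delta> * prox r (f 0) \<le> prox r (\<lambda>z. 1 / f 0 z))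
        \<and> prox r (f 0) \<ge> \<bar>C\<bar> + 1) at_top" by (rule eventually_conj)
    then obtain R2 where R2: "\<And>r. r \<ge> R2 \<Longrightarrow> prox r (\<lambda>z. 1 / f 0 z) \<noteq> 0"
      "\<And>r. r \<ge> R2 \<Longrightarrow> \<delta> * prox r (f 0) \<le> prox r (\<lambda>z. 1 / f 0 z)"
      "\<And>r. r \<ge> R2 \<Longrightarrow> prox r (f 0) \<ge> \<bar>C\<bar> + 1"
      unfolding eventually_at_top_linorder by blast
    \<comment> \<open>A single radius outside the exceptional set and beyond all thresholds suffices
      for the contradiction.\<close>
    obtain r where r: "r \<ge> max 1 (max R1 R2)" "r \<notin> E"
      using ex_large_not_in_finite_measure[OF E(1,2)] by blast
    define T where "T = prox r (f 0)"
    have T: "T \<ge> \<bar>C\<bar> + 1" using R2(3)[of r] r by (simp add: T_def)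
    have "(\<Sum>i<n. prox r (\<lambda>z. f i z / f 0 z)) \<le> (\<Sum>i<n. \<epsilon> * T)"
    proof (rule sum_mono)
      fix i assume "i \<in> {..<n}"
      then show "prox r (\<lambda>z. f i z / f 0 z) \<le> \<epsilon> * T" using R1[of r i] r by (auto simp: T_def)
    qed
    then have "B * (\<Sum>i<n. prox r (\<lambda>z. f i z / f 0 z)) \<le> B * (\<Sum>i<n. \<epsilon> * T)"
      using B by (intro mult_left_mono) auto
    also have "\<dots> = T" using B n0 by (simp add: \<epsilon>_def)
    finally have S: "B * (\<Sum>i<n. prox r (\<lambda>z. f i z / f 0 z)) \<le> T" .
    have "real K * (\<delta> * T) \<le> real K * prox r (\<lambda>z. 1 / f 0 z)"
      using R2(2)[of r] r by (intro mult_left_mono) (auto simp: T_def)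
    also have "\<dots> \<le> real (n * q) * T + B * (\<Sum>i<n. prox r (\<lambda>z. f i z / f 0 z)) + C"
      unfolding T_def by (rule C) (use r R2(1)[of r] in auto)
    finally have up: "real K * (\<delta> * T) \<le> real (n * q) * T + T + C" using S by linarith
    have "(real n + 2) * (real q * T) \<le> (real M * \<delta>) * (real q * T)"
      using Md T by (intro mult_right_mono) auto
    also have "\<dots> = real K * (\<delta> * T)" by (simp add: K_def mult_ac)
    finally have "(real n + 2) * (real q * T) \<le> real (n * q) * T + T + C" using up by linarith
    then have "2 * (real q * T) \<le> T + C" by (simp add: algebra_simps)
    moreover have "T \<le> real q * T" using q T mult_right_mono[of 1 "real q" T] by simp
    ultimately show False using T by linarith
  qed
  show "trdeg_gen (2 * n) ?g = 2 * n"
    unfolding trdeg_gen_def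
  proof (rule Max_eqI)
    have "{card I |I. I \<subseteq> {..<2 * n} \<and> alg_indep I ?g} \<subseteq> card ` Pow {..<2 * n}" by auto
    then show "finite {card I |I. I \<subseteq> {..<2 * n} \<and> alg_indep I ?g}" by (rule finite_subset) simp
    show "y \<le> 2 * n" if "y \<in> {card I |I. I \<subseteq> {..<2 * n} \<and> alg_indep I ?g}" for y
      using that card_mono[of "{..<2 * n}"] by fastforce
    show "2 * n \<in> {card I |I. I \<subseteq> {..<2 * n} \<and> alg_indep I ?g}"
      using indep by (intro CollectI exI[of _ "{..<2 * n}"]) auto
  qed
qed

end
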